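(* Let $X$ be a complex Banach space of finite (non-trivial) cotype, let $\xi_0$ be a non-trivial symmetric random variable with $\mathbb{E}|\xi_0|^s<\infty$ for some $s>\cot(X)$, and fix $1\le p<s$. Then there is a constant $C\ge 1$ such that for all $m,n\in\mathbb{N}$ and every $m$-homogeneous tetrahedral polynomial $P:\mathbb{C}^n\to X$, with associated symmetric $m$-linear operator $M$, we have \[ C^{-m}\big(\mathbb{E}\|P(\xi)\|^p\big)^{1/p}\le m^{m/2}\big(\mathbb{E}\|M(\xi^{(1)},\ldots,\xi^{(m)})\|^p\big)^{1/p}\le C^m\big(\mathbb{E}\|P(\xi)\|^p\big)^{1/p}, \] where $\xi,\xi^{(1)},\ldots,\xi^{(m)}$ are independent random vectors in $\mathbb{C}^n$ whose coordinates are iid copies of $\xi_0$.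
   Context: A polynomial $P:\mathbb{C}^n\to X$ is $m$-homogeneous tetrahedral if $P(z)=\sum_{A\subseteq[n],|A|=m}x_Az_A$ with $x_A\in X$ and $z_A=\prod_{k\in A}z_k$, where $[n]=\{1,\dots,n\}$. Its associated symmetric $m$-linear operator is the unique symmetric $m$-linear $M:(\mathbb{C}^n)^m\to X$ with $M(z,\ldots,z)=P(z)$. A random variable $\xi_0$ is symmetric if $\xi_0$ and $-\xi_0$ have the same distribution, and non-trivial if it is not almost surely $0$. $X$ has cotype $q\in[2,\infty)$ if there is $C$ with $(\sum_i\|x_i\|^q)^{1/q}\le C(\mathbb{E}\|\sum_i x_i\varepsilon_i\|^q)^{1/q}$ for all finite families $x_i\in X$, where $\varepsilon_i$ are independent Rademacher variables (uniform on $\{-1,1\}$); $\cot(X)$ is the infimum of all such $q$. *)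

theory Defs
  imports "HOL-Probability.Probability"
begin

text \<open>A complex Banach space is modelled as a real Banach space (type class banach)
  together with a complex scalar multiplication extending the real one and
  compatible with the norm.\<close>
definition complex_structure :: "(complex \<Rightarrow> 'x::real_normed_vector \<Rightarrow> 'x) \<Rightarrow> bool" where
  "complex_structure sc \<longleftrightarrow>
     (\<forall>r x. sc (complex_of_real r) x = r *\<^sub>R x) \<and>
     (\<forall>a b x. sc (a * b) x = sc a (sc b x)) \<and>
     (\<forall>a x y. sc a (x + y) = sc a x + sc a y) \<and>
     (\<forall>a b x. sc (a + b) x = sc a x + sc b x) \<and>
     (\<forall>a x. norm (sc a x) = cmod a * norm x)"

definition rademacher_moment :: "nat \<Rightarrow> (nat \<Rightarrow> 'x::real_normed_vector) \<Rightarrow> real \<Rightarrow> real" where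
  "rademacher_moment N x q =
     (\<Sum>\<epsilon>\<in>PiE {..<N} (\<lambda>_. {-1, 1::real}). norm (\<Sum>i<N. \<epsilon> i *\<^sub>R x i) powr q) / 2 ^ N"

definition has_cotype :: "'x::real_normed_vector itself \<Rightarrow> real \<Rightarrow> bool" where
  "has_cotype _ q \<longleftrightarrow> 2 \<le> q \<and>
     (\<exists>C. \<forall>N (x :: nat \<Rightarrow> 'x).
        (\<Sum>i<N. norm (x i) powr q) powr (1 / q) \<le> C * rademacher_moment N x q powr (1 / q))"

definition cotype_index :: "'x::real_normed_vector itself \<Rightarrow> real" where
  "cotype_index X = Inf {q. has_cotype X q}"

definition tetra_poly ::
  "(complex \<Rightarrow> 'x::real_normed_vector \<Rightarrow> 'x) \<Rightarrow> nat \<Rightarrow> nat \<Rightarrow> (nat set \<Rightarrow> 'x) \<Rightarrow> (nat \<Rightarrow> complex) \<Rightarrow> 'x" where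
  "tetra_poly sc n m x z = (\<Sum>A\<in>{A. A \<subseteq> {1..n} \<and> card A = m}. sc (\<Prod>k\<in>A. z k) (x A))"

definition sym_multilinear ::
  "(complex \<Rightarrow> 'x::real_normed_vector \<Rightarrow> 'x) \<Rightarrow> nat \<Rightarrow> ((nat \<Rightarrow> nat \<Rightarrow> complex) \<Rightarrow> 'x) \<Rightarrow> bool" where
  "sym_multilinear sc m L \<longleftrightarrow>
     (\<forall>u v. (\<forall>j\<in>{1..m}. u j = v j) \<longrightarrow> L u = L v) \<and>
     (\<forall>u j a b w w'. j \<in> {1..m} \<longrightarrow>
        L (u(j := (\<lambda>k. a * w k + b * w' k))) = sc a (L (u(j := w))) + sc b (L (u(j := w')))) \<and>
     (\<forall>u \<sigma>. \<sigma> permutes {1..m} \<longrightarrow> L (u \<circ> \<sigma>) = L u)"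

end

(* Everything is compared with averages over signs.  For fixed values of the other
   variables, P and the form L are affine in each coordinate, so Jensen's inequality in one coordinate
   at a time bounds the moments under a symmetric law from below by the sign averages.  In the other
   direction, L is linear in each of its m rows, and P equals m^m times the average over all colourings
   of {1..n} by m colours of L evaluated at the m colour classes; linear forms in symmetric variables
   are dominated by Rademacher sums: the variables are cut into layers of geometrically growing size,
   a layer of probability 1/N is compared with one class of a random colouring with N colours, and
   cotype controls the sum over the N classes.  Both bounds lose only a factor C^m.

   To compare P and L on signs, replace every coordinate of P by a normalized sum of m signs, a law
   whose moments are bounded independently of m.  Polarization bounds L by P at these sums, and
   averaging L over cyclic shifts of the first index, chosen independently for every coordinate,
   gives back P at the sums.  The normalization m^(-1/2) produces the factor m^(m/2). *)
theory Submission
  imports Defs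
begin

section \<open>Normalized sums over sign vectors\<close>

section \<open>Averages over signs\<close>

text \<open>The obstacle is that n is unbounded: nothing may be lost per coordinate. Jensen's
  inequality has constant 1, so the lower bounds change all coordinates for free and pay only |c|^m,
  by homogeneity, where c is the mean of h(z) z for a suitable sign function h. The upper bound for
  P cannot go coordinate by coordinate; a colouring makes m blocks in each of which L is linear, so
  that only K^m is paid, and polarizing back at the signs costs m^m / m! \<le> 3^m. The same two
  bounds serve two laws: that of the given variable and that of the normalized sum of m signs. The
  latter varies with m, so K may depend on a law only through a bound for its moment of order s, and
  the mean c must stay away from 0 uniformly in m; Kahane's inequality yields both. The layers can
  be summed because layer l has probability at most 2^(-l), whereas the r-th power of its size grows
  like 2^(l r / s) with r < s. Here r = max p q for some cotype q < s, and the passage from r back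
  to p is again Kahane's inequality.\<close>

definition savg :: "'i set \<Rightarrow> (('i \<Rightarrow> real) \<Rightarrow> 'b::real_vector) \<Rightarrow> 'b" where
  "savg I f = (1 / 2 ^ card I) *\<^sub>R (\<Sum>T\<in>Pow I. f (\<lambda>k. if k \<in> T then -1 else 1))"

text \<open>Sign vectors in \<open>savg\<close> are padded by 1 outside \<open>I\<close>, whereas
  points of \<open>PiM I\<close> are \<open>undefined\<close> there; functions local on
  \<open>I\<close> do not see the difference.\<close>

definition local_on :: "'i set \<Rightarrow> (('i \<Rightarrow> 'c) \<Rightarrow> 'b) \<Rightarrow> bool" where
  "local_on I f \<longleftrightarrow> (\<forall>e e'. (\<forall>k\<in>I. e k = e' k) \<longrightarrow> f e = f e')"

lemma local_onD: "local_on I f \<Longrightarrow> (\<And>k. k \<in> I \<Longrightarrow> e k = e' k) \<Longrightarrow> f e = f e'"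
  unfolding local_on_def by blast

lemma local_onI: "(\<And>e e'. (\<And>k. k \<in> I \<Longrightarrow> e k = e' k) \<Longrightarrow> f e = f e') \<Longrightarrow> local_on I f"
  unfolding local_on_def by blast

lemma savg_empty [simp]: "savg {} f = f (\<lambda>_. 1)"
  by (simp add: savg_def)

lemma savg_insert:
  assumes "finite I" "k \<notin> I"
  shows "savg (insert k I) f = (1/2) *\<^sub>R (savg I (\<lambda>e. f (e(k := 1))) + savg I (\<lambda>e. f (e(k := -1))))"
proof -
  have "(\<Sum>T\<in>Pow (insert k I). f (\<lambda>i. if i \<in> T then -1 else 1)) =
    (\<Sum>T\<in>Pow I. f (\<lambda>i. if i \<in> T then -1 else 1)) + (\<Sum>T\<in>insert k ` Pow I. f (\<lambda>i. if i \<in> T then -1 else 1))"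
    unfolding Pow_insert using assms by (intro sum.union_disjoint) auto
  also have "(\<Sum>T\<in>Pow I. f (\<lambda>i. if i \<in> T then -1 else 1)) =
      (\<Sum>T\<in>Pow I. f ((\<lambda>i. if i \<in> T then -1 else 1)(k := 1)))"
    using assms by (intro sum.cong refl arg_cong[where f = f]) (auto simp: fun_eq_iff)
  also have "(\<Sum>T\<in>insert k ` Pow I. f (\<lambda>i. if i \<in> T then -1 else 1)) =
      (\<Sum>T\<in>Pow I. f (\<lambda>i. if i \<in> insert k T then -1 else 1))"
    using assms by (intro sum.reindex_cong[of "insert k"]) (auto simp: inj_on_def)
  also have "\<dots> = (\<Sum>T\<in>Pow I. f ((\<lambda>i. if i \<in> T then -1 else 1)(k := -1)))"
    using assms by (intro sum.cong refl arg_cong[where f = f]) (auto simp: fun_eq_iff)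
  finally show ?thesis
    using assms by (simp add: savg_def scaleR_add_right mult.commute fun_upd_def)
qed

lemma savg_add: "savg I (\<lambda>e. f e + g e) = savg I f + savg I g"
  by (simp add: savg_def sum.distrib scaleR_add_right)

lemma savg_scaleR: "savg I (\<lambda>e. c *\<^sub>R f e) = c *\<^sub>R savg I f"
  by (simp add: savg_def scaleR_sum_right)

lemma savg_cmult: "savg I (\<lambda>e. c * f e) = c * savg I f" for f :: "_ \<Rightarrow> real"
  using savg_scaleR[of I c f] by simp

lemma savg_sum: "savg I (\<lambda>e. \<Sum>a\<in>A. f a e) = (\<Sum>a\<in>A. savg I (f a))"
  unfolding savg_def by (subst sum.swap) (simp add: scaleR_sum_right)

lemma savg_swap: "savg I (\<lambda>e. savg J (f e)) = savg J (\<lambda>e'. savg I (\<lambda>e. f e e'))"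
  unfolding savg_def scaleR_sum_right by (subst sum.swap) (simp add: mult.commute)

lemma savg_const [simp]: "finite I \<Longrightarrow> savg I (\<lambda>_. c) = c"
  by (simp add: savg_def card_Pow sum_constant_scaleR)

lemma savg_mono:
  fixes f g :: "_ \<Rightarrow> real"
  assumes "\<And>e. (\<And>k. e k = 1 \<or> e k = -1) \<Longrightarrow> f e \<le> g e"
  shows "savg I f \<le> savg I g"
  unfolding savg_def by (auto intro!: mult_left_mono sum_mono assms divide_right_mono)

lemma savg_cong:
  assumes "\<And>e. (\<And>k. e k = 1 \<or> e k = -1) \<Longrightarrow> f e = g e"
  shows "savg I f = savg I g"
  unfolding savg_def by (intro arg_cong2[where f = scaleR] refl sum.cong assms) auto

lemma savg_nonneg:
  fixes f :: "_ \<Rightarrow> real"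
  assumes "\<And>e. (\<And>k. e k = 1 \<or> e k = -1) \<Longrightarrow> 0 \<le> f e"
  shows "0 \<le> savg I f"
  unfolding savg_def by (auto intro!: mult_nonneg_nonneg sum_nonneg assms divide_nonneg_nonneg)

lemma norm_savg_le: "norm (savg I f) \<le> savg I (\<lambda>e. norm (f e))"
  unfolding savg_def by (auto intro!: divide_right_mono norm_sum)

text \<open>Multiplication by \<open>d\<close> turns the set of negative coordinates into its
  symmetric difference with \<open>D\<close>, an involution of \<open>Pow I\<close>. Since
  \<open>d\<close> is arbitrary off \<open>I\<close>, locality of \<open>f\<close> is used.\<close>

lemma savg_flip:
  assumes "finite I" "local_on I f" "\<And>k. k \<in> I \<Longrightarrow> d k = 1 \<or> d k = -1"
  shows "savg I (\<lambda>e. f (\<lambda>k. d k * e k)) = savg I f"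
proof -
  define D where "D = {k\<in>I. d k = -1}"
  have "(\<Sum>T\<in>Pow I. f (\<lambda>k. d k * (if k \<in> T then -1 else 1))) =
        (\<Sum>T\<in>Pow I. f (\<lambda>k. if k \<in> T then -1 else 1))"
  proof (rule sum.reindex_bij_witness[where i = "\<lambda>T. (T - D) \<union> (D - T)" and j = "\<lambda>T. (T - D) \<union> (D - T)"])
    fix T assume "T \<in> Pow I"
    show "f (\<lambda>k. if k \<in> T - D \<union> (D - T) then -1 else 1) = f (\<lambda>k. d k * (if k \<in> T then -1 else 1))"
      by (rule local_onD[OF assms(2)]) (use assms(3) in \<open>auto simp: D_def\<close>)
  qed (auto simp: D_def)
  then show ?thesis by (simp add: savg_def)
qed

lemma savg_permute:
  assumes "finite I" "\<pi> permutes I"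
  shows "savg I (\<lambda>e. f (\<lambda>k. e (\<pi> k))) = savg I f"
proof -
  have "(\<Sum>T\<in>Pow I. f (\<lambda>k. if \<pi> k \<in> T then -1 else 1)) =
        (\<Sum>T\<in>Pow I. f (\<lambda>k. if k \<in> T then -1 else 1))"
  proof (rule sum.reindex_bij_witness[where i = "\<lambda>T. \<pi> ` T" and j = "\<lambda>T. \<pi> -` T"])
    fix T assume T: "T \<in> Pow I"
    show "\<pi> ` (\<pi> -` T) = T"
      unfolding image_vimage_eq permutes_surj[OF assms(2)] by simp
    show "\<pi> -` (\<pi> ` T) = T"
      by (rule inj_vimage_image_eq[OF permutes_inj[OF assms(2)]])
    show "\<pi> -` T \<in> Pow I"
    proof (intro PowI subsetI)
      fix k assume "k \<in> \<pi> -` T"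
      then have "\<pi> k \<in> I" using T by blast
      then show "k \<in> I" by (simp only: permutes_in_image[OF assms(2)])
    qed
    show "\<pi> ` T \<in> Pow I"
    proof (intro PowI subsetI)
      fix k assume "k \<in> \<pi> ` T"
      then obtain i where "i \<in> I" "k = \<pi> i" using T by blast
      then show "k \<in> I" by (simp only: permutes_in_image[OF assms(2)])
    qed
    show "f (\<lambda>k. if k \<in> \<pi> -` T then -1 else 1) = f (\<lambda>k. if \<pi> k \<in> T then -1 else 1)"
      by (simp only: vimage_eq)
  qed
  then show ?thesis by (simp add: savg_def)
qed

lemma savg_Un:
  assumes "finite A" "finite B" "A \<inter> B = {}"
  shows "savg (A \<union> B) f = savg A (\<lambda>e. savg B (\<lambda>e'. f (\<lambda>k. if k \<in> B then e' k else e k)))"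
  using assms(2,3)
proof (induction B arbitrary: f rule: finite_induct)
  case (insert k B)
  have "savg (A \<union> insert k B) f = (1/2) *\<^sub>R (savg (A \<union> B) (\<lambda>e. f (e(k := 1))) + savg (A \<union> B) (\<lambda>e. f (e(k := -1))))"
    using insert assms by (simp add: savg_insert)
  also have "\<dots> = savg A (\<lambda>e. (1/2) *\<^sub>R (savg B (\<lambda>e'. f ((\<lambda>i. if i \<in> B then e' i else e i)(k := 1))) +
          savg B (\<lambda>e'. f ((\<lambda>i. if i \<in> B then e' i else e i)(k := -1)))))"
    using insert by (simp add: savg_add savg_scaleR)
  also have "\<dots> = savg A (\<lambda>e. savg (insert k B) (\<lambda>e'. f (\<lambda>i. if i \<in> insert k B then e' i else e i)))"
    using insert by (auto simp: savg_insert fun_upd_def intro!: arg_cong[where f = "savg _"] ext arg_cong2[where f = plus] arg_cong[where f = f])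
  finally show ?case .
qed auto

section \<open>Convexity and Jensen's inequality for finite averages\<close>

section \<open>Convexity of powers of the norm\<close>

text \<open>Only the endpoint 0 needs an argument; there the inequality becomes
  \<open>t powr p \<le> t\<close> on the unit interval.\<close>

lemma powr_convex_nonneg:
  fixes p :: real
  assumes "p \<ge> 1"
  shows "convex_on {0..} (\<lambda>x. x powr p)"
proof (rule convex_onI)
  fix t x y :: real assume t: "0 < t" "t < 1" and xy: "x \<in> {0..}" "y \<in> {0..}"
  have pw: "u powr p \<le> u" if "0 < u" "u < 1" for u :: real
    using powr_mono'[of 1 p u] that assms by auto
  consider "x = 0" | "y = 0" | "x > 0" "y > 0" using xy by force
  then show "((1 - t) *\<^sub>R x + t *\<^sub>R y) powr p \<le> (1 - t) * x powr p + t * y powr p"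
  proof cases
    case 1
    have "t powr p * y powr p \<le> t * y powr p" using t by (intro mult_right_mono pw) auto
    then show ?thesis using t xy 1 by (simp add: powr_mult)
  next
    case 2
    have "(1 - t) powr p * x powr p \<le> (1 - t) * x powr p" using t by (intro mult_right_mono pw) auto
    then show ?thesis using t xy 2 by (simp add: powr_mult)
  next
    case 3 then show ?thesis using convex_onD[OF powr_convex[OF assms], of t x y] t by auto
  qed
qed auto

lemma convex_combination_symmetric:
  fixes v w :: "'x::real_vector"
  shows "(1 - t) *\<^sub>R (v + w) + t *\<^sub>R (v - w) = v + (1 - 2 * t) *\<^sub>R w"
proof -
  have 1: "(1 - t) *\<^sub>R (v + w) = v + w - t *\<^sub>R v - t *\<^sub>R w"
    by (simp add: scaleR_left_diff_distrib scaleR_add_right)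
  have 2: "t *\<^sub>R (v - w) = t *\<^sub>R v - t *\<^sub>R w"
    by (rule scaleR_diff_right)
  have 3: "(1 - 2 * t) *\<^sub>R w = w - t *\<^sub>R w - t *\<^sub>R w"
    by (simp only: scaleR_left_diff_distrib mult_2 scaleR_left_distrib scaleR_one diff_diff_add)
  show ?thesis unfolding 1 2 3 by simp
qed

lemma norm_powr_convex:
  fixes u v :: "'x::real_normed_vector"
  assumes "p \<ge> 1" "0 \<le> t" "t \<le> 1"
  shows "norm ((1 - t) *\<^sub>R u + t *\<^sub>R v) powr p \<le> (1 - t) * norm u powr p + t * norm v powr p"
proof -
  have "norm ((1 - t) *\<^sub>R u + t *\<^sub>R v) \<le> (1 - t) * norm u + t * norm v"
    using norm_triangle_ineq[of "(1 - t) *\<^sub>R u" "t *\<^sub>R v"] assms by simp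
  then have "norm ((1 - t) *\<^sub>R u + t *\<^sub>R v) powr p \<le> ((1 - t) * norm u + t * norm v) powr p"
    using assms by (intro powr_mono2) auto
  also have "\<dots> \<le> (1 - t) * norm u powr p + t * norm v powr p"
    using convex_onD[OF powr_convex_nonneg[OF assms(1)], of t "norm u" "norm v"] assms by auto
  finally show ?thesis .
qed

lemma norm_add_powr_le:
  fixes u v :: "'x::real_normed_vector"
  assumes "p \<ge> 1"
  shows "norm (u + v) powr p \<le> 2 powr (p - 1) * (norm u powr p + norm v powr p)"
proof -
  have "norm (u + v) powr p = 2 powr p * norm ((1 - 1/2) *\<^sub>R u + (1/2) *\<^sub>R v) powr p"
  proof -
    have "u + v = 2 *\<^sub>R ((1 - 1/2) *\<^sub>R u + (1/2) *\<^sub>R v)" by (simp add: scaleR_add_right)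
    then have "norm (u + v) = 2 * norm ((1 - 1/2) *\<^sub>R u + (1/2) *\<^sub>R v)"
      by (metis norm_scaleR abs_numeral)
    then show ?thesis by (simp only: powr_mult norm_ge_zero zero_le_numeral)
  qed
  also have "\<dots> \<le> 2 powr p * ((1 - 1/2) * norm u powr p + (1/2) * norm v powr p)"
    by (intro mult_left_mono norm_powr_convex assms) auto
  also have "\<dots> = 2 powr (p - 1) * (norm u powr p + norm v powr p)"
    by (simp add: powr_diff field_simps)
  finally show ?thesis .
qed

lemma average_powr_le:
  fixes p :: real and f :: "'b \<Rightarrow> real"
  assumes "p \<ge> 1" "finite S" "S \<noteq> {}" "\<And>a. a \<in> S \<Longrightarrow> 0 \<le> f a"
  shows "((\<Sum>a\<in>S. f a) / card S) powr p \<le> (\<Sum>a\<in>S. f a powr p) / card S"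
proof -
  have "(\<Sum>a\<in>S. (1 / card S) *\<^sub>R f a) powr p \<le> (\<Sum>a\<in>S. 1 / card S * f a powr p)"
    by (rule convex_on_sum[OF assms(2,3) powr_convex_nonneg[OF assms(1)]]) (use assms in auto)
  then show ?thesis by (simp add: sum_divide_distrib)
qed

lemma savg_powr_le:
  fixes f :: "_ \<Rightarrow> real"
  assumes "p \<ge> 1" "finite I" "\<And>e. 0 \<le> f e"
  shows "savg I f powr p \<le> savg I (\<lambda>e. f e powr p)"
proof -
  have "((\<Sum>T\<in>Pow I. f (\<lambda>k. if k \<in> T then -1 else 1)) / real (card (Pow I))) powr p
     \<le> (\<Sum>T\<in>Pow I. f (\<lambda>k. if k \<in> T then -1 else 1) powr p) / real (card (Pow I))"
    by (rule average_powr_le) (use assms in auto)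
  then show ?thesis
    using assms by (simp add: savg_def card_Pow)
qed

lemma norm_savg_powr_le:
  assumes "p \<ge> 1" "finite I"
  shows "norm (savg I f) powr p \<le> savg I (\<lambda>e. norm (f e) powr p)"
  using powr_mono2[OF _ _ norm_savg_le[of I f], of p] savg_powr_le[OF assms, of "\<lambda>e. norm (f e)"] assms
  by auto

section \<open>Monotonicity of sign averages in the coefficients\<close>

section \<open>The contraction principle\<close>

text \<open>With t = (1 - a/b)/2 the points u + a y and u - a y are convex combinations of u + b y
  and u - b y with weights (1 - t, t) and (t, 1 - t). Adding the two convexity bounds makes t
  disappear.\<close>

lemma two_point_contraction:
  fixes u y :: "'x::real_normed_vector"
  assumes "p \<ge> 1" "\<bar>a\<bar> \<le> b"
  shows "norm (u + a *\<^sub>R y) powr p + norm (u - a *\<^sub>R y) powr p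
       \<le> norm (u + b *\<^sub>R y) powr p + norm (u - b *\<^sub>R y) powr p"
proof (cases "b = 0")
  case False
  define t where "t = (1 - a / b) / 2"
  have b: "b > 0" using assms False by linarith
  then have t: "0 \<le> t" "t \<le> 1" using assms by (auto simp: t_def field_simps)
  have tb: "(1 - 2 * t) *\<^sub>R b *\<^sub>R y = a *\<^sub>R y" using b by (simp add: t_def field_simps)
  have "(1 - t) *\<^sub>R (u + b *\<^sub>R y) + t *\<^sub>R (u - b *\<^sub>R y) = u + a *\<^sub>R y"
    "(1 - t) *\<^sub>R (u - b *\<^sub>R y) + t *\<^sub>R (u + b *\<^sub>R y) = u - a *\<^sub>R y"
    using convex_combination_symmetric[of t u "b *\<^sub>R y"] convex_combination_symmetric[of t u "- (b *\<^sub>R y)"]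
    unfolding scaleR_minus_right tb by simp_all
  then show ?thesis
    using norm_powr_convex[OF assms(1) t, of "u + b *\<^sub>R y" "u - b *\<^sub>R y"]
      norm_powr_convex[OF assms(1) t, of "u - b *\<^sub>R y" "u + b *\<^sub>R y"]
    by (simp add: algebra_simps)
qed (use assms in auto)

text \<open>The offset \<open>v\<close> is arbitrary so that the summand of a new index can be
  absorbed in it. The induction hypothesis changes the other coefficients, the two-point inequality
  the new one.\<close>

lemma contraction:
  fixes Y :: "'i \<Rightarrow> 'x::real_normed_vector"
  assumes "p \<ge> 1" "finite I" "\<And>k. k \<in> I \<Longrightarrow> \<bar>a k\<bar> \<le> b k"
  shows "savg I (\<lambda>e. norm (v + (\<Sum>k\<in>I. (a k * e k) *\<^sub>R Y k)) powr p)
       \<le> savg I (\<lambda>e. norm (v + (\<Sum>k\<in>I. (b k * e k) *\<^sub>R Y k)) powr p)"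
  using assms(2,3)
proof (induction I arbitrary: v rule: finite_induct)
  case (insert k I)
  let ?S = "\<lambda>c e. \<Sum>k\<in>I. (c k * e k) *\<^sub>R Y k"
  have S: "(\<Sum>i\<in>I. (c i * (e(k := x)) i) *\<^sub>R Y i) = ?S c e" for c e x
    using insert by (intro sum.cong) auto
  have S': "v + (\<Sum>i\<in>insert k I. (c i * (e(k := x)) i) *\<^sub>R Y i) = (v + (c k * x) *\<^sub>R Y k) + ?S c e" for c e x
    by (simp only: sum.insert[OF insert(1,2)] S) simp
  have eq: "savg (insert k I) (\<lambda>e. norm (v + (\<Sum>k\<in>insert k I. (c k * e k) *\<^sub>R Y k)) powr p) =
    (savg I (\<lambda>e. norm ((v + c k *\<^sub>R Y k) + ?S c e) powr p)
         + savg I (\<lambda>e. norm ((v - c k *\<^sub>R Y k) + ?S c e) powr p)) / 2" for c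
    by (simp only: savg_insert[OF insert(1,2)] S') simp
  have "savg I (\<lambda>e. norm ((v + a k *\<^sub>R Y k) + ?S a e) powr p)
         + savg I (\<lambda>e. norm ((v - a k *\<^sub>R Y k) + ?S a e) powr p) \<le>
      savg I (\<lambda>e. norm ((v + a k *\<^sub>R Y k) + ?S b e) powr p)
         + savg I (\<lambda>e. norm ((v - a k *\<^sub>R Y k) + ?S b e) powr p)"
    using insert by (intro add_mono insert.IH) auto
  also have "\<dots> = savg I (\<lambda>e. norm ((v + ?S b e) + a k *\<^sub>R Y k) powr p
         + norm ((v + ?S b e) - a k *\<^sub>R Y k) powr p)"
    by (simp add: savg_add algebra_simps)
  also have "\<dots> \<le> savg I (\<lambda>e. norm ((v + ?S b e) + b k *\<^sub>R Y k) powr p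
         + norm ((v + ?S b e) - b k *\<^sub>R Y k) powr p)"
    using insert assms by (intro savg_mono two_point_contraction) auto
  also have "\<dots> = savg I (\<lambda>e. norm ((v + b k *\<^sub>R Y k) + ?S b e) powr p)
         + savg I (\<lambda>e. norm ((v - b k *\<^sub>R Y k) + ?S b e) powr p)"
    by (simp add: savg_add algebra_simps)
  finally show ?case unfolding eq by simp
qed auto

section \<open>Hypercontractivity and Kahane's inequality\<close>

section \<open>Comparison of moments of Rademacher sums\<close>

lemma L2_average_triangle:
  fixes f g h :: "'a \<Rightarrow> real"
  assumes "finite S" "\<And>a. a \<in> S \<Longrightarrow> 0 \<le> h a" "\<And>a. a \<in> S \<Longrightarrow> h a \<le> s * f a + t * g a" "0 \<le> s" "0 \<le> t"
  shows "L2_set h S \<le> s * L2_set f S + t * L2_set g S"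
proof -
  have "L2_set h S \<le> L2_set (\<lambda>a. s * f a + t * g a) S"
    by (rule L2_set_mono) (use assms in auto)
  also have "\<dots> \<le> L2_set (\<lambda>a. s * f a) S + L2_set (\<lambda>a. t * g a) S" by (rule L2_set_triangle_ineq)
  finally show ?thesis using assms by (simp add: L2_set_right_distrib)
qed

text \<open>Bonami's two-point inequality between the second and the fourth moment. In terms of the
  mean a and the half difference b, the fourth moment is a^4 + 6 \<rho>^2 a^2 b^2 + \<rho>^4 b^4,
  and \<rho>^2 = 1/3 is the value at which the mixed term equals that of (a^2 + b^2)^2.\<close>

lemma two_point_hypercontractive:
  fixes f g F G :: real
  assumes "0 \<le> F" "0 \<le> G" "\<rho> = 1 / sqrt 3"
    and F: "F \<le> (1 + \<rho>) / 2 * f + (1 - \<rho>) / 2 * g" and G: "G \<le> (1 - \<rho>) / 2 * f + (1 + \<rho>) / 2 * g"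
  shows "(F ^ 4 + G ^ 4) / 2 \<le> ((f\<^sup>2 + g\<^sup>2) / 2)\<^sup>2"
proof -
  define a b where "a = (f + g) / 2" and "b = (f - g) / 2"
  have r2: "\<rho>\<^sup>2 = 1/3" by (simp add: assms power_divide)
  have "F \<le> a + \<rho> * b" "G \<le> a - \<rho> * b" using F G by (simp_all add: a_def b_def field_simps)
  then have "F ^ 4 \<le> (a + \<rho> * b) ^ 4" "G ^ 4 \<le> (a - \<rho> * b) ^ 4"
    using assms by (auto intro!: power_mono)
  then have "(F ^ 4 + G ^ 4) / 2 \<le> ((a + \<rho> * b) ^ 4 + (a - \<rho> * b) ^ 4) / 2" by simp
  also have "\<dots> = a ^ 4 + 6 * \<rho>\<^sup>2 * a\<^sup>2 * b\<^sup>2 + (\<rho>\<^sup>2)\<^sup>2 * b ^ 4"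
    by (simp add: power4_eq_xxxx power2_eq_square algebra_simps)
  also have "\<dots> = a ^ 4 + 2 * a\<^sup>2 * b\<^sup>2 + b ^ 4 / 9" by (simp add: r2 power_divide)
  also have "\<dots> \<le> a ^ 4 + 2 * a\<^sup>2 * b\<^sup>2 + b ^ 4" by simp
  also have "\<dots> = (a\<^sup>2 + b\<^sup>2)\<^sup>2"
    by (simp add: power4_eq_xxxx power2_eq_square algebra_simps)
  also have "a\<^sup>2 + b\<^sup>2 = (f\<^sup>2 + g\<^sup>2) / 2"
    by (simp add: a_def b_def power2_eq_square field_simps)
  finally show ?thesis .
qed

text \<open>Induction over the signs with a free offset: the hypothesis bounds the moments of order
  2 r with offsets v + \<rho> Y and v - \<rho> Y by \<phi>^4, and convexity of \<phi> compares these
  offsets with v + Y and v - Y in exactly the form that the two-point inequality accepts.\<close>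

lemma hypercontractive:
  fixes Y :: "'i \<Rightarrow> 'x::real_normed_vector"
  assumes "r \<ge> 2" "finite I" "\<rho> = 1 / sqrt 3"
  shows "savg I (\<lambda>e. norm (v + (\<Sum>k\<in>I. (\<rho> * e k) *\<^sub>R Y k)) powr (2 * r))
       \<le> (savg I (\<lambda>e. norm (v + (\<Sum>k\<in>I. e k *\<^sub>R Y k)) powr r))\<^sup>2"
  using assms(2)
proof (induction I arbitrary: v rule: finite_induct)
  case empty
  show ?case by (cases "v = 0") (simp_all add: power2_eq_square powr_add[symmetric])
next
  case (insert k I)
  define S where "S c e = (\<Sum>k\<in>I. (c * e k) *\<^sub>R Y k)" for c :: real and e :: "'i \<Rightarrow> real"
  have S: "(\<Sum>i\<in>I. (c * (e(k := x)) i) *\<^sub>R Y i) = S c e" for c e x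
    unfolding S_def using insert by (intro sum.cong) auto
  have S': "v + (\<Sum>i\<in>insert k I. (c * (e(k := x)) i) *\<^sub>R Y i) = (v + (c * x) *\<^sub>R Y k) + S c e" for c e x
    by (simp only: sum.insert[OF insert(1,2)] S) simp
  have eq: "savg (insert k I) (\<lambda>e. norm (v + (\<Sum>k\<in>insert k I. (c * e k) *\<^sub>R Y k)) powr q) =
    (savg I (\<lambda>e. norm ((v + c *\<^sub>R Y k) + S c e) powr q)
         + savg I (\<lambda>e. norm ((v - c *\<^sub>R Y k) + S c e) powr q)) / 2" for c q
    by (simp only: savg_insert[OF insert(1,2)] S') simp
  define \<phi> where "\<phi> v = sqrt (savg I (\<lambda>e. norm (v + S 1 e) powr r))" for v
  have \<phi>2: "(\<phi> v)\<^sup>2 = savg I (\<lambda>e. norm (v + S 1 e) powr r)" for v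
    unfolding \<phi>_def by (intro real_sqrt_pow2 savg_nonneg) auto
  have \<phi>0: "0 \<le> \<phi> v" for v unfolding \<phi>_def by (intro real_sqrt_ge_zero savg_nonneg) auto
  \<comment> \<open>Up to scaling, \<phi> is the L2 norm of the function
    \<open>norm (v + S 1 e) powr (r/2)\<close> of the signs. As r/2 \<ge> 1, this function is convex
    in v, and Minkowski's inequality passes convexity to \<phi>.\<close>
  have cvx: "\<phi> ((1 - t) *\<^sub>R u + t *\<^sub>R w) \<le> (1 - t) * \<phi> u + t * \<phi> w" if "0 \<le> t" "t \<le> 1" for t u w
  proof -
    have \<phi>L: "\<phi> v = sqrt (1 / 2 ^ card I) * L2_set (\<lambda>T. norm (v + S 1 (\<lambda>k. if k \<in> T then -1 else 1)) powr (r/2)) (Pow I)" for v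
    proof -
      have "(x powr (r/2))\<^sup>2 = x powr r" for x :: real
        by (simp add: power2_eq_square flip: powr_add)
      then show ?thesis by (simp add: \<phi>_def savg_def L2_set_def real_sqrt_divide)
    qed
    have "L2_set (\<lambda>T. norm (((1 - t) *\<^sub>R u + t *\<^sub>R w) + S 1 (\<lambda>k. if k \<in> T then -1 else 1)) powr (r/2)) (Pow I)
      \<le> (1 - t) * L2_set (\<lambda>T. norm (u + S 1 (\<lambda>k. if k \<in> T then -1 else 1)) powr (r/2)) (Pow I) +
        t * L2_set (\<lambda>T. norm (w + S 1 (\<lambda>k. if k \<in> T then -1 else 1)) powr (r/2)) (Pow I)"
    proof (rule L2_average_triangle)
      fix T
      let ?s = "S 1 (\<lambda>k. if k \<in> T then -1 else 1)"
      have "((1 - t) *\<^sub>R u + t *\<^sub>R w) + ?s = (1 - t) *\<^sub>R (u + ?s) + t *\<^sub>R (w + ?s)"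
        by (simp add: algebra_simps)
      then show "norm (((1 - t) *\<^sub>R u + t *\<^sub>R w) + ?s) powr (r/2) \<le>
          (1 - t) * norm (u + ?s) powr (r/2) + t * norm (w + ?s) powr (r/2)"
        using norm_powr_convex[of "r/2" t "u + ?s" "w + ?s"] assms that by simp
    qed (use that insert in auto)
    from mult_left_mono[OF this, of "sqrt (1 / 2 ^ card I)"] show ?thesis
      unfolding \<phi>L by (simp add: algebra_simps)
  qed
  have \<rho>: "0 \<le> \<rho>" "\<rho> \<le> 1" by (auto simp: assms)
  have F: "\<phi> (v + \<rho> *\<^sub>R Y k) \<le> (1 + \<rho>) / 2 * \<phi> (v + Y k) + (1 - \<rho>) / 2 * \<phi> (v - Y k)"
    using cvx[of "(1 - \<rho>) / 2" "v + Y k" "v - Y k"] \<rho>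
    unfolding convex_combination_symmetric by (simp add: field_simps)
  have G: "\<phi> (v - \<rho> *\<^sub>R Y k) \<le> (1 - \<rho>) / 2 * \<phi> (v + Y k) + (1 + \<rho>) / 2 * \<phi> (v - Y k)"
    using cvx[of "(1 + \<rho>) / 2" "v + Y k" "v - Y k"] \<rho>
    unfolding convex_combination_symmetric by (simp add: field_simps)
  have IH: "savg I (\<lambda>e. norm (u + S \<rho> e) powr (2 * r)) \<le> \<phi> u ^ 4" for u
  proof -
    have "\<phi> u ^ 4 = ((\<phi> u)\<^sup>2)\<^sup>2" by (simp flip: power_mult)
    then show ?thesis using insert.IH[of u] by (simp add: \<phi>2 S_def)
  qed
  have "savg (insert k I) (\<lambda>e. norm (v + (\<Sum>k\<in>insert k I. (\<rho> * e k) *\<^sub>R Y k)) powr (2 * r))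
     \<le> (\<phi> (v + \<rho> *\<^sub>R Y k) ^ 4 + \<phi> (v - \<rho> *\<^sub>R Y k) ^ 4) / 2"
    unfolding eq using IH[of "v + \<rho> *\<^sub>R Y k"] IH[of "v - \<rho> *\<^sub>R Y k"] by simp
  also have "\<dots> \<le> (((\<phi> (v + Y k))\<^sup>2 + (\<phi> (v - Y k))\<^sup>2) / 2)\<^sup>2"
    by (rule two_point_hypercontractive[OF _ _ assms(3) F G]) (auto simp: \<phi>0)
  also have "\<dots> = (savg (insert k I) (\<lambda>e. norm (v + (\<Sum>k\<in>insert k I. e k *\<^sub>R Y k)) powr r))\<^sup>2"
    by (simp only: \<phi>2 eq[of 1 r, unfolded mult_1 scaleR_one])
  finally show ?case .
qed

text \<open>Hypercontractivity gives E S^(2r) \<le> 3^r (E S^r)^2, so values far above the r-th mean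
  contribute little to E S^r. Below a height A one has S^r \<le> A^(r-p) S^p, which brings in the
  p-th moment.\<close>

lemma kahane_inequality:
  fixes Y :: "'i \<Rightarrow> 'x::real_normed_vector"
  assumes "p \<ge> 1" "r \<ge> 2" "p \<le> r" "finite I"
  shows "savg I (\<lambda>e. norm (\<Sum>k\<in>I. e k *\<^sub>R Y k) powr r) powr (p / r)
       \<le> 2 * (2 * 3 powr r) powr ((r - p) / r) * savg I (\<lambda>e. norm (\<Sum>k\<in>I. e k *\<^sub>R Y k) powr p)"
proof -
  define S where "S e = norm (\<Sum>k\<in>I. e k *\<^sub>R Y k)" for e
  define E Ep where "E = savg I (\<lambda>e. S e powr r)" and "Ep = savg I (\<lambda>e. S e powr p)"
  have S0: "0 \<le> S e" for e by (simp add: S_def)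
  have E0: "0 \<le> E" "0 \<le> Ep" unfolding E_def Ep_def by (auto intro!: savg_nonneg)
  have "savg I (\<lambda>e. (1 / sqrt 3) powr (2 * r) * S e powr (2 * r)) \<le> E\<^sup>2"
  proof -
    have "(\<Sum>k\<in>I. (1 / sqrt 3 * e k) *\<^sub>R Y k) = (1 / sqrt 3) *\<^sub>R (\<Sum>k\<in>I. e k *\<^sub>R Y k)" for e
      by (simp add: scaleR_sum_right)
    then show ?thesis
      using hypercontractive[OF assms(2,4) refl, of 0 Y]
      by (simp only: E_def S_def add_0 norm_scaleR powr_mult norm_ge_zero abs_ge_zero) simp
  qed
  moreover have "(1 / sqrt 3) powr (2 * r) = 1 / 3 powr r"
    by (simp add: powr_powr[symmetric] powr_divide)
  ultimately have hyp: "savg I (\<lambda>e. S e powr (2 * r)) \<le> 3 powr r * E\<^sup>2"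
    by (simp only: savg_cmult) (simp add: field_simps)
  have "E powr (p / r) \<le> 2 * (2 * 3 powr r) powr ((r - p) / r) * Ep"
  proof (cases "E = 0")
    case False
    then have Epos: "E > 0" using E0 by simp
    \<comment> \<open>The height is chosen such that A^r = 2 * 3^r * E: the part above
      \<open>A\<close> is then at most E / 2 and can be absorbed in the left side.\<close>
    define A where "A = (2 * 3 powr r * E) powr (1 / r)"
    have A: "A > 0" using Epos by (simp add: A_def)
    have Ar: "A powr r = 2 * 3 powr r * E" using Epos assms by (simp add: A_def powr_powr)
    have pw: "t powr r \<le> A powr (r - p) * t powr p + 1 / A powr r * t powr (2 * r)" if "t \<ge> 0" for t
    proof (cases "t \<le> A")
      case True
      have "t powr r = t powr (r - p) * t powr p" by (cases "t = 0") (simp_all add: powr_add[symmetric])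
      also have "\<dots> \<le> A powr (r - p) * t powr p"
        using True assms that by (intro mult_right_mono powr_mono2) auto
      finally show ?thesis by (smt (verit) divide_nonneg_nonneg mult_nonneg_nonneg powr_ge_zero)
    next
      case False
      have "t powr r * A powr r \<le> t powr r * t powr r"
        using False assms A by (intro mult_left_mono powr_mono2) auto
      also have "\<dots> = t powr (2 * r)" by (simp add: powr_add[symmetric])
      finally have "t powr r \<le> 1 / A powr r * t powr (2 * r)" using A by (simp add: field_simps)
      then show ?thesis by (smt (verit) mult_nonneg_nonneg powr_ge_zero)
    qed
    have "E \<le> savg I (\<lambda>e. A powr (r - p) * S e powr p + 1 / A powr r * S e powr (2 * r))"
      unfolding E_def by (intro savg_mono pw S0)
    also have "\<dots> = A powr (r - p) * Ep + 1 / A powr r * savg I (\<lambda>e. S e powr (2 * r))"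
      by (simp only: savg_add savg_cmult Ep_def)
    also have "\<dots> \<le> A powr (r - p) * Ep + 1 / A powr r * (3 powr r * E\<^sup>2)"
      using hyp by (intro add_left_mono mult_left_mono) auto
    also have "1 / A powr r * (3 powr r * E\<^sup>2) = E / 2"
      using Epos by (simp add: Ar power2_eq_square field_simps)
    finally have "E \<le> 2 * A powr (r - p) * Ep" by simp
    also have "A powr (r - p) = (2 * 3 powr r) powr ((r - p) / r) * E powr ((r - p) / r)"
      using Epos by (simp add: A_def powr_powr powr_mult)
    finally have "E powr (p / r) * E powr ((r - p) / r) \<le>
        (2 * (2 * 3 powr r) powr ((r - p) / r) * Ep) * E powr ((r - p) / r)"
      using assms Epos by (simp add: powr_add[symmetric] add_divide_distrib[symmetric] mult_ac)
    then show ?thesis using Epos by simp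
  qed (use E0 assms in auto)
  then show ?thesis by (simp add: E_def Ep_def S_def)
qed

section \<open>Complex multiplication on the space and complex coefficients\<close>

section \<open>Complex scalars\<close>

locale complex_normed =
  fixes sc :: "complex \<Rightarrow> 'x::real_normed_vector \<Rightarrow> 'x"
  assumes cs: "complex_structure sc"
begin

lemma sc_of_real: "sc (of_real a) x = a *\<^sub>R x"
  and sc_mult: "sc (a' * b) x = sc a' (sc b x)"
  and sc_add_right: "sc a' (x + y) = sc a' x + sc a' y"
  and sc_add_left: "sc (a' + b) x = sc a' x + sc b x"
  and norm_sc: "norm (sc a' x) = cmod a' * norm x"
  using cs by (auto simp: complex_structure_def)

lemma sc_0_left [simp]: "sc 0 x = 0" and sc_1 [simp]: "sc 1 x = x"
  using sc_of_real[of 0 x] sc_of_real[of 1 x] by auto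

lemma sc_0_right [simp]: "sc a 0 = 0"
  using norm_sc[of a 0] by simp

lemma sc_linear: "linear (sc a)"
proof
  show "sc a (r *\<^sub>R x) = r *\<^sub>R sc a x" for r x
    by (simp flip: sc_of_real sc_mult add: mult.commute)
qed (rule sc_add_right)

lemma sc_scaleR: "sc a (r *\<^sub>R x) = r *\<^sub>R sc a x"
  by (rule linear_scale[OF sc_linear])

lemma sc_scaleR_left: "sc (r *\<^sub>R a) x = r *\<^sub>R sc a x"
  by (simp add: scaleR_conv_of_real sc_mult sc_of_real)

lemma sc_sum_right: "sc a (\<Sum>i\<in>S. f i) = (\<Sum>i\<in>S. sc a (f i))"
  by (rule linear_sum[OF sc_linear])

lemma sc_linear_left: "linear (\<lambda>a. sc a x)"
  by unfold_locales (auto simp: sc_add_left sc_scaleR_left)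

lemma sc_sum_left: "sc (\<Sum>i\<in>S. f i) x = (\<Sum>i\<in>S. sc (f i) x)"
  by (rule linear_sum[OF sc_linear_left])

lemma continuous_on_sc [continuous_intros]:
  "continuous_on A f \<Longrightarrow> continuous_on A (\<lambda>z. sc (f z) x)"
proof -
  have "bounded_linear (\<lambda>a. sc a x)"
    using sc_linear_left by (rule linear_conv_bounded_linear[THEN iffD1])
  then show "continuous_on A f \<Longrightarrow> continuous_on A (\<lambda>z. sc (f z) x)"
    by (rule bounded_linear.continuous_on)
qed

text \<open>Real and imaginary parts of the coefficients are handled separately by the real
  contraction principle; multiplication by the imaginary unit is isometric. The factor 2^r is
  2^(r-1) from adding two vectors, times the two parts.\<close>

lemma complex_contraction:
  assumes "r \<ge> 1" "finite I" "\<And>k. k \<in> I \<Longrightarrow> cmod (z k) \<le> b k"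
  shows "savg I (\<lambda>e. norm (\<Sum>k\<in>I. e k *\<^sub>R sc (z k) (Y k)) powr r)
       \<le> 2 powr r * savg I (\<lambda>e. norm (\<Sum>k\<in>I. (b k * e k) *\<^sub>R Y k) powr r)"
proof -
  let ?N = "\<lambda>a e. norm (\<Sum>k\<in>I. (a k * e k) *\<^sub>R Y k) powr r"
  have dec: "sc w y = Re w *\<^sub>R y + sc \<i> (Im w *\<^sub>R y)" for w y
  proof -
    have "sc w y = sc (of_real (Re w) + \<i> * of_real (Im w)) y" by (rule arg_cong[OF complex_eq])
    then show ?thesis by (simp only: sc_add_left sc_mult sc_of_real)
  qed
  have "(\<Sum>k\<in>I. e k *\<^sub>R sc (z k) (Y k)) = (\<Sum>k\<in>I. (Re (z k) * e k) *\<^sub>R Y k) + sc \<i> (\<Sum>k\<in>I. (Im (z k) * e k) *\<^sub>R Y k)" for e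
  proof -
    have "e k *\<^sub>R sc (z k) (Y k) = (Re (z k) * e k) *\<^sub>R Y k + sc \<i> ((Im (z k) * e k) *\<^sub>R Y k)" for k
      by (subst dec) (simp only: scaleR_add_right scaleR_scaleR mult.commute sc_scaleR)
    then show ?thesis by (simp only: sum.distrib sc_sum_right)
  qed
  then have "norm (\<Sum>k\<in>I. e k *\<^sub>R sc (z k) (Y k)) powr r \<le> 2 powr (r - 1) * (?N (\<lambda>k. Re (z k)) e + ?N (\<lambda>k. Im (z k)) e)" for e
    using norm_add_powr_le[OF assms(1), of "\<Sum>k\<in>I. (Re (z k) * e k) *\<^sub>R Y k" "sc \<i> (\<Sum>k\<in>I. (Im (z k) * e k) *\<^sub>R Y k)"]
    by (simp add: norm_sc)
  then have "savg I (\<lambda>e. norm (\<Sum>k\<in>I. e k *\<^sub>R sc (z k) (Y k)) powr r) \<le>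
     savg I (\<lambda>e. 2 powr (r - 1) * (?N (\<lambda>k. Re (z k)) e + ?N (\<lambda>k. Im (z k)) e))"
    by (intro savg_mono)
  also have "\<dots> = 2 powr (r - 1) * (savg I (?N (\<lambda>k. Re (z k))) + savg I (?N (\<lambda>k. Im (z k))))"
    by (simp only: savg_cmult savg_add)
  also have "\<dots> \<le> 2 powr (r - 1) * (savg I (?N b) + savg I (?N b))"
  proof (intro mult_left_mono add_mono)
    have "\<bar>Re (z k)\<bar> \<le> b k" "\<bar>Im (z k)\<bar> \<le> b k" if "k \<in> I" for k
      using assms(3)[OF that] abs_Re_le_cmod[of "z k"] abs_Im_le_cmod[of "z k"] by linarith+
    then show "savg I (?N (\<lambda>k. Re (z k))) \<le> savg I (?N b)" "savg I (?N (\<lambda>k. Im (z k))) \<le> savg I (?N b)"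
      using contraction[OF assms(1,2), of _ b 0 Y] by simp_all
  qed simp
  also have "\<dots> = 2 powr r * savg I (?N b)" by (simp add: powr_diff)
  finally show ?thesis .
qed

end

section \<open>Cotype in r-th power form and on colour classes\<close>

section \<open>Cotype\<close>

text \<open>Two monotonicities: the l^r norm is at most the l^q norm, and Rademacher averages
  increase with the exponent by Jensen. The absolute value of \<open>C\<close> is taken because the
  definition of cotype does not prescribe its sign.\<close>

lemma cotype_power:
  assumes "has_cotype TYPE('x::real_normed_vector) q" "r \<ge> q"
  shows "\<exists>C\<ge>0. \<forall>N (x :: nat \<Rightarrow> 'x). (\<Sum>i<N. norm (x i) powr r) \<le> C * rademacher_moment N x r"
proof -
  from assms obtain C where q: "q \<ge> 2" and
    C: "\<And>N (x :: nat \<Rightarrow> 'x). (\<Sum>i<N. norm (x i) powr q) powr (1 / q) \<le> C * rademacher_moment N x q powr (1 / q)"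
    by (auto simp: has_cotype_def)
  have "(\<Sum>i<N. norm (x i) powr r) \<le> \<bar>C\<bar> powr r * rademacher_moment N x r" for N and x :: "nat \<Rightarrow> 'x"
  proof -
    define a where "a = (\<Sum>i<N. norm (x i) powr q)"
    have a0: "a \<ge> 0" unfolding a_def by (intro sum_nonneg) auto
    have R0: "rademacher_moment N x q \<ge> 0" unfolding rademacher_moment_def by (simp add: sum_nonneg)
    \<comment> \<open>Each \<open>norm (x i) powr q\<close> is at most the full sum
      \<open>a\<close>, so the excess exponent r - q is pulled out of the sum.\<close>
    have "(\<Sum>i<N. norm (x i) powr r) \<le> (\<Sum>i<N. norm (x i) powr q * a powr ((r - q) / q))"
    proof (rule sum_mono)
      fix i assume "i \<in> {..<N}"
      then have "norm (x i) powr q \<le> a" unfolding a_def by (intro member_le_sum) auto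
      then have "(norm (x i) powr q) powr ((r - q) / q) \<le> a powr ((r - q) / q)"
        using assms q by (intro powr_mono2) auto
      then have "norm (x i) powr q * norm (x i) powr (r - q) \<le> norm (x i) powr q * a powr ((r - q) / q)"
        using q by (intro mult_left_mono) (auto simp: powr_powr)
      then show "norm (x i) powr r \<le> norm (x i) powr q * a powr ((r - q) / q)"
        by (cases "x i = 0") (auto simp: powr_add[symmetric])
    qed
    also have "\<dots> = a * a powr ((r - q) / q)" by (simp add: a_def sum_distrib_right)
    also have "\<dots> = (a powr (1 / q)) powr r"
      using a0 q by (cases "a = 0") (auto simp: powr_powr powr_mult_base diff_divide_distrib)
    also have "\<dots> \<le> (\<bar>C\<bar> * rademacher_moment N x q powr (1 / q)) powr r"
    proof (rule powr_mono2)
      show "a powr (1/q) \<le> \<bar>C\<bar> * rademacher_moment N x q powr (1 / q)"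
        using C[where N=N and x=x] unfolding a_def
        by (rule order_trans) (auto intro!: mult_right_mono)
    qed (use assms q in auto)
    also have "\<dots> = \<bar>C\<bar> powr r * rademacher_moment N x q powr (r / q)"
      using R0 by (simp add: powr_mult powr_powr)
    also have "\<dots> \<le> \<bar>C\<bar> powr r * rademacher_moment N x r"
    proof (rule mult_left_mono)
      let ?E = "PiE {..<N} (\<lambda>_. {-1, 1::real})"
      have cE: "real (card ?E) = 2 ^ N" by (simp add: card_PiE)
      have "((\<Sum>e\<in>?E. norm (\<Sum>i<N. e i *\<^sub>R x i) powr q) / card ?E) powr (r / q)
          \<le> (\<Sum>e\<in>?E. (norm (\<Sum>i<N. e i *\<^sub>R x i) powr q) powr (r / q)) / card ?E"
        using assms q by (intro average_powr_le) (auto intro!: finite_PiE simp: PiE_eq_empty_iff)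
      then show "rademacher_moment N x q powr (r / q) \<le> rademacher_moment N x r"
        unfolding rademacher_moment_def cE using q by (simp add: powr_powr)
    qed auto
    finally show ?thesis .
  qed
  then show ?thesis by (intro exI[of _ "\<bar>C\<bar> powr r"]) auto
qed

text \<open>Cotype is applied, for fixed \<open>e\<close>, to the partial sums over the colour
  classes, with one auxiliary sign \<theta> per colour. For fixed \<theta> the products of
  \<open>\<theta> (c k)\<close> and \<open>e k\<close> are again uniform signs, so the average over
  \<theta> drops out.\<close>

lemma cotype_colouring:
  assumes "has_cotype TYPE('x::real_normed_vector) q" "r \<ge> q"
  shows "\<exists>C\<ge>0. \<forall>(N::nat) (B :: 'i set) c (Y :: 'i \<Rightarrow> 'x). finite B \<longrightarrow> c ` B \<subseteq> {..<N} \<longrightarrow>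
     (\<Sum>l<N. savg B (\<lambda>e. norm (\<Sum>k\<in>{k\<in>B. c k = l}. e k *\<^sub>R Y k) powr r))
      \<le> C * savg B (\<lambda>e. norm (\<Sum>k\<in>B. e k *\<^sub>R Y k) powr r)"
proof -
  obtain C where "C \<ge> 0" and
    C: "\<And>N (x :: nat \<Rightarrow> 'x). (\<Sum>i<N. norm (x i) powr r) \<le> C * rademacher_moment N x r"
    using cotype_power[OF assms] by blast
  have "(\<Sum>l<N. savg B (\<lambda>e. norm (\<Sum>k\<in>{k\<in>B. c k = l}. e k *\<^sub>R Y k) powr r))
      \<le> C * savg B (\<lambda>e. norm (\<Sum>k\<in>B. e k *\<^sub>R Y k) powr r)"
    if B: "finite B" "c ` B \<subseteq> {..<N}" for N :: nat and B :: "'i set" and c and Y :: "'i \<Rightarrow> 'x"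
  proof -
    let ?E = "PiE {..<N} (\<lambda>_. {-1, 1::real})"
    let ?F = "\<lambda>e. norm (\<Sum>k\<in>B. e k *\<^sub>R Y k) powr r"
    have cE: "real (card ?E) = 2 ^ N" by (simp add: card_PiE)
    define x where "x e l = (\<Sum>k\<in>{k\<in>B. c k = l}. e k *\<^sub>R Y k)" for e l
    have grp: "(\<Sum>l<N. \<theta> l *\<^sub>R x e l) = (\<Sum>k\<in>B. (\<theta> (c k) * e k) *\<^sub>R Y k)" for \<theta> e
    proof -
      have "(\<Sum>l<N. \<theta> l *\<^sub>R x e l) = (\<Sum>l<N. \<Sum>k\<in>{k\<in>B. c k = l}. (\<theta> (c k) * e k) *\<^sub>R Y k)"
        by (simp add: x_def scaleR_sum_right)
      also have "\<dots> = (\<Sum>k\<in>B. (\<theta> (c k) * e k) *\<^sub>R Y k)"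
        using B by (intro sum.group) auto
      finally show ?thesis .
    qed
    have "(\<Sum>l<N. savg B (\<lambda>e. norm (x e l) powr r)) = savg B (\<lambda>e. \<Sum>l<N. norm (x e l) powr r)"
      by (simp only: savg_sum)
    also have "\<dots> \<le> savg B (\<lambda>e. C * rademacher_moment N (x e) r)"
      by (intro savg_mono C)
    also have "\<dots> = C / 2 ^ N * (\<Sum>\<theta>\<in>?E. savg B (\<lambda>e. ?F (\<lambda>k. \<theta> (c k) * e k)))"
      by (simp only: rademacher_moment_def grp savg_cmult savg_sum[symmetric] times_divide_eq_right[symmetric])
         (simp add: savg_cmult[symmetric] savg_sum[symmetric] mult_ac)
    also have "(\<Sum>\<theta>\<in>?E. savg B (\<lambda>e. ?F (\<lambda>k. \<theta> (c k) * e k))) = (\<Sum>\<theta>\<in>?E. savg B ?F)"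
    proof (intro sum.cong refl savg_flip B)
      show "local_on B ?F" by (intro local_onI) simp
      show "\<theta> (c k) = 1 \<or> \<theta> (c k) = -1" if "\<theta> \<in> ?E" "k \<in> B" for \<theta> k
        using PiE_mem[OF that(1), of "c k"] B(2) that(2) by auto
    qed
    also have "C / 2 ^ N * \<dots> = C * savg B ?F" by (simp add: cE)
    finally show ?thesis by (simp add: x_def)
  qed
  then show ?thesis using \<open>C \<ge> 0\<close> by blast
qed

lemma ex_cotype_less:
  assumes "\<exists>q. has_cotype TYPE('x::real_normed_vector) q" "cotype_index TYPE('x) < s"
  shows "\<exists>q. has_cotype TYPE('x) q \<and> 2 \<le> q \<and> q < s"
proof -
  have "{q. has_cotype TYPE('x) q} \<noteq> {}" using assms by auto
  from cInf_lessD[OF this, of s] assms(2) show ?thesis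
    by (auto simp: cotype_index_def has_cotype_def)
qed

section \<open>Measurability and exchange of laws block by block\<close>

section \<open>Product measures on complex coordinates\<close>

definition borel_prob :: "complex measure \<Rightarrow> bool" where
  "borel_prob \<nu> \<longleftrightarrow> prob_space \<nu> \<and> sets \<nu> = sets borel"

lemma borel_probD: "borel_prob \<nu> \<Longrightarrow> prob_space \<nu>" "borel_prob \<nu> \<Longrightarrow> sets \<nu> = sets borel"
  by (auto simp: borel_prob_def)

lemma space_borel_prob: "borel_prob \<nu> \<Longrightarrow> space \<nu> = UNIV"
  using sets_eq_imp_space_eq[of \<nu> borel] by (simp add: borel_prob_def)

lemma product_sigma_finite_borel_prob: "(\<And>i. borel_prob (N i)) \<Longrightarrow> product_sigma_finite N"
  unfolding product_sigma_finite_def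
  using borel_probD(1) prob_space_imp_sigma_finite by blast

text \<open>Continuity refers to the space of all functions, whose Borel sets form the product
  sigma-algebra because the index type is countable. Padding with 0 off \<open>I\<close> carries
  this over to \<open>PiM I\<close>.\<close>

lemma measurable_local_continuous:
  fixes g :: "('i::countable \<Rightarrow> complex) \<Rightarrow> real"
  assumes "continuous_on UNIV g" "local_on I g" "\<And>i. i \<in> I \<Longrightarrow> sets (N i) = sets borel"
  shows "g \<in> borel_measurable (PiM I N)"
proof -
  have "(\<lambda>z k. if k \<in> I then z k else 0) \<in> measurable (PiM I N) (PiM UNIV (\<lambda>_. borel :: complex measure))"
  proof (rule measurable_PiM_single')
    fix i :: 'i
    show "(\<lambda>z. if i \<in> I then z i else 0) \<in> measurable (PiM I N) borel"
    proof (cases "i \<in> I")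
      case True
      then have "(\<lambda>z. z i) \<in> measurable (PiM I N) (N i)" by measurable
      then show ?thesis using True by (simp cong: measurable_cong_sets add: assms(3))
    qed simp
  qed auto
  moreover have "g \<in> borel_measurable (PiM UNIV (\<lambda>_. borel :: complex measure))"
    using borel_measurable_continuous_onI[OF assms(1)]
    by (simp cong: measurable_cong_sets add: sets_PiM_equal_borel)
  ultimately have "(\<lambda>z. g (\<lambda>k. if k \<in> I then z k else 0)) \<in> borel_measurable (PiM I N)"
    by (rule measurable_compose)
  moreover have "g (\<lambda>k. if k \<in> I then z k else 0) = g z" for z
    by (rule local_onD[OF assms(2)]) simp
  ultimately show ?thesis by simp
qed

lemma nn_integral_block_mono:
  assumes "finite I" "B \<subseteq> I" "\<And>i. borel_prob (N i)" "\<And>i. borel_prob (N' i)"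
    and "\<And>i. i \<in> I - B \<Longrightarrow> N i = N' i"
    and f [measurable]: "f \<in> borel_measurable (PiM I N)" "f \<in> borel_measurable (PiM I N')"
    and le: "\<And>z. (\<integral>\<^sup>+w. f (\<lambda>k. if k \<in> B then w k else z k) \<partial>PiM B N)
        \<le> \<kappa> * (\<integral>\<^sup>+w. f (\<lambda>k. if k \<in> B then w k else z k) \<partial>PiM B N')"
  shows "(\<integral>\<^sup>+z. f z \<partial>PiM I N) \<le> \<kappa> * (\<integral>\<^sup>+z. f z \<partial>PiM I N')"
proof -
  interpret N: product_sigma_finite N by (rule product_sigma_finite_borel_prob) fact
  interpret N': product_sigma_finite N' by (rule product_sigma_finite_borel_prob) fact
  have fin: "finite B" "finite (I - B)" using assms finite_subset by auto
  interpret NB: finite_product_sigma_finite N' B by standard (rule fin)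
  have I: "(I - B) \<union> B = I" and disj: "(I - B) \<inter> B = {}" using assms by auto
  have merge: "merge (I - B) B (x, y) = (\<lambda>k. if k \<in> B then y k else x k)"
    if "x \<in> space (PiM (I - B) N'')" for x y and N'' :: "_ \<Rightarrow> complex measure"
    using that by (auto simp: merge_def space_PiM PiE_def extensional_def fun_eq_iff)
  have eqM: "PiM (I - B) N = PiM (I - B) N'" using assms by (intro PiM_cong) auto
  have "(\<integral>\<^sup>+z. f z \<partial>PiM I N) = (\<integral>\<^sup>+x. \<integral>\<^sup>+y. f (merge (I - B) B (x, y)) \<partial>PiM B N \<partial>PiM (I - B) N)"
    using N.product_nn_integral_fold[OF disj fin(2,1), unfolded I, OF f(1)] .
  also have "\<dots> = (\<integral>\<^sup>+x. \<integral>\<^sup>+y. f (merge (I - B) B (x, y)) \<partial>PiM B N \<partial>PiM (I - B) N')"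
    by (simp only: eqM)
  also have "\<dots> \<le> (\<integral>\<^sup>+x. \<kappa> * (\<integral>\<^sup>+y. f (merge (I - B) B (x, y)) \<partial>PiM B N') \<partial>PiM (I - B) N')"
    by (intro nn_integral_mono) (simp only: merge le)
  also have "\<dots> = \<kappa> * (\<integral>\<^sup>+x. (\<integral>\<^sup>+y. f (merge (I - B) B (x, y)) \<partial>PiM B N') \<partial>PiM (I - B) N')"
  proof (rule nn_integral_cmult)
    have "f \<in> borel_measurable (PiM ((I - B) \<union> B) N')" using f(2) I by simp
    then have "(\<lambda>x. f (merge (I - B) B x)) \<in> borel_measurable (PiM (I - B) N' \<Otimes>\<^sub>M PiM B N')"
      by (rule measurable_compose[OF measurable_merge])
    then show "(\<lambda>x. \<integral>\<^sup>+y. f (merge (I - B) B (x, y)) \<partial>PiM B N') \<in> borel_measurable (PiM (I - B) N')"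
      by (intro NB.borel_measurable_nn_integral) simp
  qed
  also have "\<dots> = \<kappa> * (\<integral>\<^sup>+z. f z \<partial>PiM I N')"
    by (simp only: N'.product_nn_integral_fold[OF disj fin(2,1), unfolded I, OF f(2)])
  finally show ?thesis .
qed

text \<open>The law is exchanged on one whole colour class at a time, so the exponent of \<kappa>
  counts colours and not coordinates. Upper bounds use m classes; the bounds by Jensen use
  singletons as classes and \<kappa> = 1.\<close>

lemma nn_integral_colours_mono:
  fixes \<delta> :: "'i \<Rightarrow> 'j" and f :: "('i \<Rightarrow> complex) \<Rightarrow> ennreal"
  assumes "finite I" "borel_prob \<nu>" "borel_prob \<nu>'" "finite C" "\<delta> ` I \<subseteq> C"
    and f: "\<And>N. (\<And>i. sets (N i) = sets borel) \<Longrightarrow> f \<in> borel_measurable (PiM I N)"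
    and le: "\<And>j z. j \<in> C \<Longrightarrow>
        (\<integral>\<^sup>+w. f (\<lambda>k. if k \<in> {k\<in>I. \<delta> k = j} then w k else z k) \<partial>PiM {k\<in>I. \<delta> k = j} (\<lambda>_. \<nu>))
        \<le> \<kappa> * (\<integral>\<^sup>+w. f (\<lambda>k. if k \<in> {k\<in>I. \<delta> k = j} then w k else z k) \<partial>PiM {k\<in>I. \<delta> k = j} (\<lambda>_. \<nu>'))"
  shows "(\<integral>\<^sup>+z. f z \<partial>PiM I (\<lambda>_. \<nu>)) \<le> \<kappa> ^ card C * (\<integral>\<^sup>+z. f z \<partial>PiM I (\<lambda>_. \<nu>'))"
proof -
  have "(\<integral>\<^sup>+z. f z \<partial>PiM I (\<lambda>k. if \<delta> k \<in> D then \<nu> else \<nu>')) \<le> \<kappa> ^ card D * (\<integral>\<^sup>+z. f z \<partial>PiM I (\<lambda>_. \<nu>'))"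
    if "D \<subseteq> C" for D
    using finite_subset[OF that \<open>finite C\<close>] that
  proof (induction D rule: finite_induct)
    case (insert j D)
    let ?B = "{k\<in>I. \<delta> k = j}" and ?N = "\<lambda>D k. if \<delta> k \<in> D then \<nu> else \<nu>'"
    have N: "borel_prob (?N D i)" for D i using assms by auto
    have eq: "PiM ?B (?N (insert j D)) = PiM ?B (\<lambda>_. \<nu>)" "PiM ?B (?N D) = PiM ?B (\<lambda>_. \<nu>')"
      using insert by (auto intro!: PiM_cong)
    have "(\<integral>\<^sup>+z. f z \<partial>PiM I (?N (insert j D))) \<le> \<kappa> * (\<integral>\<^sup>+z. f z \<partial>PiM I (?N D))"
    proof (rule nn_integral_block_mono[where B = ?B])
      show "f \<in> borel_measurable (PiM I (?N (insert j D)))" "f \<in> borel_measurable (PiM I (?N D))"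
        by (intro f borel_probD N)+
      show "(\<integral>\<^sup>+w. f (\<lambda>k. if k \<in> ?B then w k else z k) \<partial>PiM ?B (?N (insert j D)))
        \<le> \<kappa> * (\<integral>\<^sup>+w. f (\<lambda>k. if k \<in> ?B then w k else z k) \<partial>PiM ?B (?N D))" for z
        unfolding eq using insert by (intro le) auto
    qed (use assms in auto)
    also have "\<dots> \<le> \<kappa> * (\<kappa> ^ card D * (\<integral>\<^sup>+z. f z \<partial>PiM I (\<lambda>_. \<nu>')))"
      using insert by (intro mult_left_mono) auto
    finally show ?case using insert by (simp add: mult.assoc)
  qed simp
  from this[of C] have "(\<integral>\<^sup>+z. f z \<partial>PiM I (\<lambda>k. if \<delta> k \<in> C then \<nu> else \<nu>')) \<le> \<kappa> ^ card C * (\<integral>\<^sup>+z. f z \<partial>PiM I (\<lambda>_. \<nu>'))"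
    by simp
  also have "PiM I (\<lambda>k. if \<delta> k \<in> C then \<nu> else \<nu>') = PiM I (\<lambda>_. \<nu>)"
    using assms(5) by (intro PiM_cong) auto
  finally show ?thesis .
qed

section \<open>Laws of random signs and insertion of signs into symmetric laws\<close>

section \<open>Sign measures and symmetrization\<close>

text \<open>The amplitude \<open>c\<close> is 1 when a linear form is dominated by signs, and a
  nonzero mean when Jensen's inequality is applied.\<close>

definition sign_law :: "complex \<Rightarrow> complex measure" where
  "sign_law c = distr (measure_pmf (pmf_of_set {1, -1::real})) borel (\<lambda>e. of_real e * c)"

lemma borel_prob_sign_law: "borel_prob (sign_law c)"
  unfolding borel_prob_def sign_law_def
  by (auto intro!: prob_space.prob_space_distr measure_pmf.prob_space_axioms)

lemma nn_integral_sign_law: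
  assumes "f \<in> borel_measurable borel"
  shows "(\<integral>\<^sup>+z. f z \<partial>sign_law c) = (f c + f (-c)) / 2"
  using assms by (simp add: sign_law_def nn_integral_distr nn_integral_pmf_of_set)

lemma continuous_on_update:
  fixes g :: "('i \<Rightarrow> complex) \<Rightarrow> real"
  assumes "continuous_on UNIV g"
  shows "continuous_on UNIV (\<lambda>x. g (x(i := y)))" "continuous_on UNIV (\<lambda>y. g (x(i := y)))"
proof -
  have coord: "continuous_on UNIV (\<lambda>x::'i \<Rightarrow> complex. (x(i := y)) j)" "continuous_on UNIV (\<lambda>y::complex. (x(i := y)) j)" for x j
    by (cases "j = i"; simp add: continuous_on_product_coordinates)+
  show "continuous_on UNIV (\<lambda>x. g (x(i := y)))"
    by (rule continuous_on_compose2[OF assms continuous_on_coordinatewise_then_product[OF coord(1)]]) simp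
  show "continuous_on UNIV (\<lambda>y. g (x(i := y)))"
    by (rule continuous_on_compose2[OF assms continuous_on_coordinatewise_then_product[OF coord(2)]]) simp
qed

lemma nn_integral_PiM_sign_law:
  fixes g :: "('i::countable \<Rightarrow> complex) \<Rightarrow> real"
  assumes "finite I" "continuous_on UNIV g" "local_on I g" "\<And>z. 0 \<le> g z"
  shows "(\<integral>\<^sup>+z. ennreal (g z) \<partial>PiM I (\<lambda>_. sign_law c)) = ennreal (savg I (\<lambda>e. g (\<lambda>k. of_real (e k) * c)))"
  using assms
proof (induction I arbitrary: g rule: finite_induct)
  case empty
  \<comment> \<open>The product over the empty set sits on the constant function
    \<open>undefined\<close>, the empty sign average on the constant \<open>c\<close>; locality over
    the empty set identifies the two values.\<close>
  have "g (\<lambda>_. undefined) = g (\<lambda>_. c)" using empty by (auto simp: local_on_def)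
  then show ?case by (simp add: PiM_empty nn_integral_count_space_finite)
next
  case (insert i I)
  interpret product_sigma_finite "\<lambda>_::'i. sign_law c"
    by (rule product_sigma_finite_borel_prob) (rule borel_prob_sign_law)
  have sets: "sets (sign_law c) = sets borel" using borel_prob_sign_law borel_probD by blast
  note cont = continuous_on_update(1)[OF insert.prems(1), of i] and cont' = continuous_on_update(2)[OF insert.prems(1), of _ i]
  have loc: "local_on I (\<lambda>x. g (x(i := y)))" for y
    by (intro local_onI local_onD[OF insert.prems(2)]) auto
  have IH: "(\<integral>\<^sup>+x. ennreal (g (x(i := y))) \<partial>PiM I (\<lambda>_. sign_law c)) =
      ennreal (savg I (\<lambda>e. g ((\<lambda>k. of_real (e k) * c)(i := y))))" for y
    by (rule insert.IH[OF cont loc insert.prems(3)])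
  have m: "(\<lambda>x. ennreal (g (x(i := y)))) \<in> borel_measurable (PiM I (\<lambda>_. sign_law c))" for y
    by (intro measurable_compose[OF measurable_local_continuous[OF cont loc] measurable_ennreal] sets)
  have "(\<integral>\<^sup>+z. ennreal (g z) \<partial>PiM (insert i I) (\<lambda>_. sign_law c)) =
     (\<integral>\<^sup>+x. \<integral>\<^sup>+y. ennreal (g (x(i := y))) \<partial>sign_law c \<partial>PiM I (\<lambda>_. sign_law c))"
    using insert by (intro product_nn_integral_insert measurable_compose[OF measurable_local_continuous measurable_ennreal] sets) auto
  also have "\<dots> = (\<integral>\<^sup>+x. (ennreal (g (x(i := c))) + ennreal (g (x(i := -c)))) / 2 \<partial>PiM I (\<lambda>_. sign_law c))"
    by (intro nn_integral_cong nn_integral_sign_law measurable_compose[OF borel_measurable_continuous_onI[OF cont'] measurable_ennreal])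
  also have "\<dots> = ((\<integral>\<^sup>+x. ennreal (g (x(i := c))) \<partial>PiM I (\<lambda>_. sign_law c)) +
        (\<integral>\<^sup>+x. ennreal (g (x(i := -c))) \<partial>PiM I (\<lambda>_. sign_law c))) / 2"
    using m by (simp add: nn_integral_divide nn_integral_add)
  also have "\<dots> = ennreal ((1/2) * (savg I (\<lambda>e. g ((\<lambda>k. of_real (e k) * c)(i := c))) + savg I (\<lambda>e. g ((\<lambda>k. of_real (e k) * c)(i := -c)))))"
    unfolding IH using insert.prems(3)
    by (simp add: ennreal_plus[symmetric] savg_nonneg divide_ennreal del: ennreal_plus flip: ennreal_numeral)
  also have "\<dots> = ennreal (savg (insert i I) (\<lambda>e. g (\<lambda>k. of_real (e k) * c)))"
  proof -
    have "(\<lambda>k. of_real ((e(i := x)) k) * c) = (\<lambda>k. of_real (e k) * c)(i := of_real x * c)" for e x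
      by auto
    then show ?thesis by (simp add: savg_insert[OF insert(1,2)])
  qed
  finally show ?case .
qed

definition symmetric_law :: "complex measure \<Rightarrow> bool" where
  "symmetric_law \<nu> \<longleftrightarrow> borel_prob \<nu> \<and> distr \<nu> borel uminus = distr \<nu> borel (\<lambda>z. z)"

lemma symmetric_law_borel_prob: "symmetric_law \<nu> \<Longrightarrow> borel_prob \<nu>"
  by (simp add: symmetric_law_def)

lemma nn_integral_symmetric_law:
  assumes "symmetric_law \<nu>" "f \<in> borel_measurable borel"
  shows "(\<integral>\<^sup>+z. f (-z) \<partial>\<nu>) = (\<integral>\<^sup>+z. f z \<partial>\<nu>)"
proof -
  have m: "uminus \<in> borel_measurable \<nu>" "(\<lambda>z. z) \<in> borel_measurable \<nu>"
    using assms(1) by (auto simp: symmetric_law_def borel_prob_def cong: measurable_cong_sets)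
  have "(\<integral>\<^sup>+z. f z \<partial>distr \<nu> borel uminus) = (\<integral>\<^sup>+z. f z \<partial>distr \<nu> borel (\<lambda>z. z))"
    using assms by (simp add: symmetric_law_def)
  then show ?thesis using m assms(2) by (simp add: nn_integral_distr)
qed

text \<open>The flipped point is restricted to \<open>I\<close> in order to stay in the extensional
  space of the product, the domain on which \<open>f\<close> is measurable.\<close>

lemma nn_integral_PiM_flip:
  assumes "finite I" "symmetric_law \<nu>" "f \<in> borel_measurable (PiM I (\<lambda>_. \<nu>))" "\<And>k. e k = 1 \<or> e k = (-1::real)"
  shows "(\<integral>\<^sup>+z. f (\<lambda>k\<in>I. of_real (e k) * z k) \<partial>PiM I (\<lambda>_. \<nu>)) = (\<integral>\<^sup>+z. f z \<partial>PiM I (\<lambda>_. \<nu>))"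
  using assms(1,3)
proof (induction I arbitrary: f rule: finite_induct)
  case empty
  then show ?case by (simp add: PiM_empty nn_integral_count_space_finite restrict_def)
next
  case (insert i I)
  note bp = symmetric_law_borel_prob[OF assms(2)]
  interpret product_sigma_finite "\<lambda>_. \<nu>" by (rule product_sigma_finite_borel_prob) (rule bp)
  have sets[measurable_cong]: "sets \<nu> = sets borel" using bp borel_probD by blast
  have spc: "space \<nu> = UNIV" using bp space_borel_prob by blast
  note insert.prems[measurable]
  let ?M = "\<lambda>I. PiM I (\<lambda>_. \<nu>)"
  let ?r = "\<lambda>I z. \<lambda>k\<in>I. complex_of_real (e k) * z k"
  have r[measurable]: "?r J \<in> measurable (?M J) (?M J)" for J
    by measurable
  have fr: "(\<lambda>z. f (?r (insert i I) z)) \<in> borel_measurable (?M (insert i I))"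
    by (rule measurable_compose[OF r insert.prems])
  have "(\<integral>\<^sup>+z. f (?r (insert i I) z) \<partial>?M (insert i I)) =
      (\<integral>\<^sup>+x. \<integral>\<^sup>+y. f (?r (insert i I) (x(i := y))) \<partial>\<nu> \<partial>?M I)"
    using insert fr by (intro product_nn_integral_insert) auto
  also have "\<dots> = (\<integral>\<^sup>+x. \<integral>\<^sup>+y. f ((?r I x)(i := of_real (e i) * y)) \<partial>\<nu> \<partial>?M I)"
    using insert(2) by (intro nn_integral_cong arg_cong[where f = f]) (auto simp: fun_eq_iff)
  also have "\<dots> = (\<integral>\<^sup>+x. \<integral>\<^sup>+y. f ((?r I x)(i := y)) \<partial>\<nu> \<partial>?M I)"
  proof (rule nn_integral_cong)
    fix x assume x: "x \<in> space (?M I)"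
    have "?r I x \<in> space (?M I)" by (auto simp: space_PiM spc)
    then have "(\<lambda>y. (?r I x)(i := y)) \<in> measurable \<nu> (?M (insert i I))"
      by (rule measurable_component_update) (rule insert(2))
    then have "(\<lambda>y. f ((?r I x)(i := y))) \<in> borel_measurable \<nu>"
      by (rule measurable_compose) (rule insert.prems)
    then have "(\<lambda>y. f ((?r I x)(i := y))) \<in> borel_measurable borel"
      by (simp cong: measurable_cong_sets add: sets)
    from nn_integral_symmetric_law[OF assms(2) this]
    show "(\<integral>\<^sup>+y. f ((?r I x)(i := of_real (e i) * y)) \<partial>\<nu>) = (\<integral>\<^sup>+y. f ((?r I x)(i := y)) \<partial>\<nu>)"
      using assms(4)[of i] by auto
  qed
  also have "\<dots> = (\<integral>\<^sup>+x. \<integral>\<^sup>+y. f (x(i := y)) \<partial>\<nu> \<partial>?M I)"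
  proof (rule insert.IH)
    show "(\<lambda>x. \<integral>\<^sup>+y. f (x(i := y)) \<partial>\<nu>) \<in> borel_measurable (?M I)" by measurable
  qed
  also have "\<dots> = (\<integral>\<^sup>+z. f z \<partial>?M (insert i I))"
    using insert by (intro product_nn_integral_insert[symmetric]) auto
  finally show ?case .
qed

lemma nn_integral_symmetrize:
  fixes g :: "('i::countable \<Rightarrow> complex) \<Rightarrow> real"
  assumes "finite I" "symmetric_law \<nu>" "continuous_on UNIV g" "local_on I g" "\<And>z. 0 \<le> g z"
  shows "(\<integral>\<^sup>+z. ennreal (g z) \<partial>PiM I (\<lambda>_. \<nu>)) =
    (\<integral>\<^sup>+z. ennreal (savg I (\<lambda>e. g (\<lambda>k. of_real (e k) * z k))) \<partial>PiM I (\<lambda>_. \<nu>))"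
proof -
  let ?s = "\<lambda>T k. if k \<in> T then -1 else 1 :: real"
  have m: "g \<in> borel_measurable (PiM I (\<lambda>_. \<nu>))"
    using assms symmetric_law_borel_prob borel_probD by (intro measurable_local_continuous) blast+
  have "continuous_on UNIV (\<lambda>z. g (\<lambda>k. of_real (?s T k) * z k))" for T
    by (rule continuous_on_compose2[OF assms(3)])
       (auto intro!: continuous_on_coordinatewise_then_product continuous_intros simp: continuous_on_product_coordinates)
  moreover have "local_on I (\<lambda>z. g (\<lambda>k. of_real (?s T k) * z k))" for T
    by (intro local_onI local_onD[OF assms(4)]) auto
  ultimately have mT: "(\<lambda>z. g (\<lambda>k. of_real (?s T k) * z k)) \<in> borel_measurable (PiM I (\<lambda>_. \<nu>))" for T
    using assms symmetric_law_borel_prob borel_probD by (intro measurable_local_continuous) blast+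
  have flip: "(\<integral>\<^sup>+z. ennreal (g (\<lambda>k. of_real (?s T k) * z k)) \<partial>PiM I (\<lambda>_. \<nu>)) = (\<integral>\<^sup>+z. ennreal (g z) \<partial>PiM I (\<lambda>_. \<nu>))" for T
  proof -
    have "(\<integral>\<^sup>+z. ennreal (g (\<lambda>k. of_real (?s T k) * z k)) \<partial>PiM I (\<lambda>_. \<nu>)) =
      (\<integral>\<^sup>+z. ennreal (g (\<lambda>k\<in>I. of_real (?s T k) * z k)) \<partial>PiM I (\<lambda>_. \<nu>))"
      by (intro nn_integral_cong arg_cong[where f = ennreal] local_onD[OF assms(4)]) simp
    also have "\<dots> = (\<integral>\<^sup>+z. ennreal (g z) \<partial>PiM I (\<lambda>_. \<nu>))"
      using m by (intro nn_integral_PiM_flip[OF assms(1,2)]) auto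
    finally show ?thesis .
  qed
  have "ennreal (savg I (\<lambda>e. g (\<lambda>k. of_real (e k) * z k))) =
      ennreal (1 / 2 ^ card I) * (\<Sum>T\<in>Pow I. ennreal (g (\<lambda>k. of_real (?s T k) * z k)))" for z
  proof -
    have "(\<Sum>T\<in>Pow I. ennreal (g (\<lambda>k. of_real (?s T k) * z k))) = ennreal (\<Sum>T\<in>Pow I. g (\<lambda>k. of_real (?s T k) * z k))"
      by (intro sum_ennreal assms(5))
    then show ?thesis
      by (simp only: savg_def real_scaleR_def) (intro ennreal_mult sum_nonneg assms(5), simp)
  qed
  then have "(\<integral>\<^sup>+z. ennreal (savg I (\<lambda>e. g (\<lambda>k. of_real (e k) * z k))) \<partial>PiM I (\<lambda>_. \<nu>)) =
      ennreal (1 / 2 ^ card I) * (\<Sum>T\<in>Pow I. (\<integral>\<^sup>+z. ennreal (g (\<lambda>k. of_real (?s T k) * z k)) \<partial>PiM I (\<lambda>_. \<nu>)))"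
    using mT by (simp add: nn_integral_cmult nn_integral_sum)
  also have "\<dots> = ennreal (1 / 2 ^ card I) * (2 ^ card I * (\<integral>\<^sup>+z. ennreal (g z) \<partial>PiM I (\<lambda>_. \<nu>)))"
    unfolding flip using assms(1) by (simp add: card_Pow)
  also have "\<dots> = (ennreal (1 / 2 ^ card I) * ennreal (2 ^ card I)) * (\<integral>\<^sup>+z. ennreal (g z) \<partial>PiM I (\<lambda>_. \<nu>))"
    by (simp add: mult.assoc ennreal_power flip: ennreal_numeral)
  also have "ennreal (1 / 2 ^ card I) * ennreal (2 ^ card I) = 1"
    by (simp flip: ennreal_mult' ennreal_1)
  finally show ?thesis by simp
qed

section \<open>Random selections compared with random colourings\<close>

section \<open>Linear forms in independent symmetric variables\<close>

text \<open>Jensen's inequality for the points x_l / w_l with weights w_l / W. The total weight W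
  \<le> 1 costs nothing since W^r \<le> W. With summable weights the number of terms does not enter,
  which allows infinitely many layers.\<close>

lemma weighted_powr_le:
  fixes r :: real
  assumes "r \<ge> 1" "finite S" "(\<Sum>l\<in>S. w l) \<le> 1" "\<And>l. l \<in> S \<Longrightarrow> 0 < w l" "\<And>l. l \<in> S \<Longrightarrow> 0 \<le> x l"
  shows "(\<Sum>l\<in>S. x l) powr r \<le> (\<Sum>l\<in>S. w l powr (1 - r) * x l powr r)"
proof (cases "S = {}")
  case False
  define W where "W = (\<Sum>l\<in>S. w l)"
  have W: "0 < W" "W \<le> 1" unfolding W_def using assms False by (auto intro!: sum_pos)
  have "(\<Sum>l\<in>S. (w l / W) *\<^sub>R (x l / w l)) powr r \<le> (\<Sum>l\<in>S. (w l / W) * (x l / w l) powr r)"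
  proof (rule convex_on_sum[OF assms(2) False powr_convex_nonneg[OF assms(1)]])
    show "(\<Sum>l\<in>S. w l / W) = 1" using W by (simp add: W_def flip: sum_divide_distrib)
    show "0 \<le> w l / W" "x l / w l \<in> {0..}" if "l \<in> S" for l
      using assms(4,5)[OF that] W by auto
  qed
  also have "(\<Sum>l\<in>S. (w l / W) *\<^sub>R (x l / w l)) = (\<Sum>l\<in>S. x l) / W"
    unfolding sum_divide_distrib by (intro sum.cong refl) (use assms(4) in force)
  also have "(\<Sum>l\<in>S. (w l / W) * (x l / w l) powr r) = (\<Sum>l\<in>S. w l powr (1 - r) * x l powr r) / W"
    unfolding sum_divide_distrib
  proof (intro sum.cong refl)
    fix l assume l: "l \<in> S"
    then show "(w l / W) * (x l / w l) powr r = w l powr (1 - r) * x l powr r / W"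
      using assms(4)[OF l] assms(5)[OF l] by (simp add: powr_divide powr_diff)
  qed
  finally have "((\<Sum>l\<in>S. x l) / W) powr r * W \<le> (\<Sum>l\<in>S. w l powr (1 - r) * x l powr r)"
    using W by (simp add: field_simps)
  moreover have "(\<Sum>l\<in>S. x l) powr r \<le> ((\<Sum>l\<in>S. x l) / W) powr r * W"
  proof -
    have "W powr r \<le> W powr 1" using W assms by (intro powr_mono') auto
    then have "(\<Sum>l\<in>S. x l) powr r * W powr r \<le> (\<Sum>l\<in>S. x l) powr r * W"
      using W by (intro mult_left_mono) auto
    moreover have "((\<Sum>l\<in>S. x l) / W) powr r = (\<Sum>l\<in>S. x l) powr r / W powr r"
      by (rule powr_divide)
    ultimately show ?thesis using W by (simp add: pos_le_divide_eq)
  qed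
  ultimately show ?thesis by linarith
qed simp

lemma measurable_selection:
  fixes G :: "'i set \<Rightarrow> real" and \<nu> :: "complex measure"
  assumes "finite B" "sets \<nu> = sets borel" "A \<in> sets borel"
  shows "(\<lambda>z. ennreal (G {k\<in>B. z k \<in> A})) \<in> borel_measurable (PiM B (\<lambda>_. \<nu>))"
proof -
  note [measurable_cong] = assms(2)
  have [measurable]: "A \<in> sets \<nu>" using assms by simp
  have "ennreal (G {k\<in>B. z k \<in> A}) =
      (\<Sum>T\<in>Pow B. if (\<forall>k\<in>B. z k \<in> A \<longleftrightarrow> k \<in> T) then ennreal (G T) else 0)" for z
  proof -
    have "(\<forall>k\<in>B. z k \<in> A \<longleftrightarrow> k \<in> T) \<longleftrightarrow> T = {k\<in>B. z k \<in> A}" if "T \<in> Pow B" for T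
      using that by blast
    then have "(\<Sum>T\<in>Pow B. if (\<forall>k\<in>B. z k \<in> A \<longleftrightarrow> k \<in> T) then ennreal (G T) else 0) =
      (\<Sum>T\<in>Pow B. if T = {k\<in>B. z k \<in> A} then ennreal (G T) else 0)"
      by (intro sum.cong if_cong refl) blast
    also have "\<dots> = ennreal (G {k\<in>B. z k \<in> A})"
      using assms(1) by (subst sum.delta) auto
    finally show ?thesis by simp
  qed
  then show ?thesis using assms(1) by simp
qed

text \<open>If the events \<open>z k \<in> A\<close> have probability at most \<open>1 / N\<close>, the random set they select is dominated
  by a colour class of a uniformly random colouring with \<open>N\<close> colours.\<close>
lemma nn_integral_selection_le:
  fixes G :: "'i set \<Rightarrow> real"
  assumes "finite B" "borel_prob \<nu>" "A \<in> sets borel" "measure \<nu> A \<le> 1 / real N" "j < N"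
    and "\<And>T. 0 \<le> G T" "\<And>T T'. T \<subseteq> T' \<Longrightarrow> T' \<subseteq> B \<Longrightarrow> G T \<le> G T'"
  shows "(\<integral>\<^sup>+z. ennreal (G {k\<in>B. z k \<in> A}) \<partial>PiM B (\<lambda>_. \<nu>))
      \<le> ennreal ((\<Sum>c\<in>PiE B (\<lambda>_. {..<N}). G {k\<in>B. c k = j}) / N ^ card B)"
  using assms(1,6,7)
proof (induction B arbitrary: G rule: finite_induct)
  case empty
  then show ?case by (simp add: PiM_empty nn_integral_count_space_finite)
next
  case (insert i B)
  interpret product_sigma_finite "\<lambda>_. \<nu>" by (rule product_sigma_finite_borel_prob) fact
  interpret prob_space \<nu> using assms(2) by (rule borel_probD)
  have sets[measurable_cong]: "sets \<nu> = sets borel" using assms(2) by (rule borel_probD)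
  have spc: "space \<nu> = UNIV" using assms(2) by (rule space_borel_prob)
  have A[measurable]: "A \<in> sets \<nu>" using assms(3) by (simp add: sets)
  define a where "a = measure \<nu> A"
  have N: "N > 0" using assms by simp
  have a: "0 \<le> a" "a \<le> 1 / real N" "1 / real N \<le> 1" using assms(4) N by (auto simp: a_def)
  \<comment> \<open>The average of \<open>G\<close> when \<open>i\<close> is included with
    probability exactly 1/N, as in a uniform colouring; the induction hypothesis is applied to
    it.\<close>
  define G' where "G' T = (1 / real N) * G (insert i T) + (1 - 1 / real N) * G T" for T
  have G'0: "0 \<le> G' T" for T unfolding G'_def using insert.prems(1) a by (intro add_nonneg_nonneg mult_nonneg_nonneg) auto
  have G'mono: "G' T \<le> G' T'" if "T \<subseteq> T'" "T' \<subseteq> B" for T T'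
    unfolding G'_def using that a by (intro add_mono mult_left_mono insert.prems(2)) auto
  have set_upd: "{k \<in> insert i B. (x(i := y)) k \<in> A} = (if y \<in> A then insert i {k\<in>B. x k \<in> A} else {k\<in>B. x k \<in> A})"
    for x :: "'i \<Rightarrow> complex" and y using insert(2) by auto
  have meas: "(\<lambda>z. ennreal (G {k \<in> insert i B. z k \<in> A})) \<in> borel_measurable (PiM (insert i B) (\<lambda>_. \<nu>))"
    using insert(1) by (intro measurable_selection sets assms(3)) simp
  have "(\<integral>\<^sup>+z. ennreal (G {k \<in> insert i B. z k \<in> A}) \<partial>PiM (insert i B) (\<lambda>_. \<nu>)) =
    (\<integral>\<^sup>+x. \<integral>\<^sup>+y. ennreal (G {k \<in> insert i B. (x(i := y)) k \<in> A}) \<partial>\<nu> \<partial>PiM B (\<lambda>_. \<nu>))"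
    by (rule product_nn_integral_insert[OF insert(1,2) meas])
  also have "\<dots> \<le> (\<integral>\<^sup>+x. ennreal (G' {k\<in>B. x k \<in> A}) \<partial>PiM B (\<lambda>_. \<nu>))"
  proof (rule nn_integral_mono)
    fix x :: "'i \<Rightarrow> complex"
    let ?T = "{k\<in>B. x k \<in> A}"
    have "(\<integral>\<^sup>+y. ennreal (G {k \<in> insert i B. (x(i := y)) k \<in> A}) \<partial>\<nu>) =
       (\<integral>\<^sup>+y. ennreal (G (insert i ?T)) * indicator A y + ennreal (G ?T) * indicator (UNIV - A) y \<partial>\<nu>)"
      unfolding set_upd by (intro nn_integral_cong) (auto simp: indicator_def)
    also have "\<dots> = ennreal (G (insert i ?T)) * emeasure \<nu> A + ennreal (G ?T) * emeasure \<nu> (UNIV - A)"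
      using sets.compl_sets[OF A] spc by (subst nn_integral_add) (auto simp: nn_integral_cmult_indicator)
    also have "\<dots> = ennreal (G (insert i ?T) * a + G ?T * (1 - a))"
      using insert.prems(1) prob_compl[OF A] a
      by (simp add: emeasure_eq_measure a_def spc ennreal_mult ennreal_plus)
    also have "\<dots> \<le> ennreal (G' ?T)"
    proof (rule ennreal_leI)
      \<comment> \<open>Since \<open>G\<close> is monotone, raising the probability of including
        \<open>i\<close> from \<open>a\<close> to 1/N can only increase the mean.\<close>
      have "0 \<le> (1 / real N - a) * (G (insert i ?T) - G ?T)"
        using a insert.prems(2)[of ?T "insert i ?T"] by (intro mult_nonneg_nonneg) auto
      then show "G (insert i ?T) * a + G ?T * (1 - a) \<le> G' ?T"
        by (simp add: G'_def algebra_simps)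
    qed
    finally show "(\<integral>\<^sup>+y. ennreal (G {k \<in> insert i B. (x(i := y)) k \<in> A}) \<partial>\<nu>) \<le> ennreal (G' ?T)" .
  qed
  also have "\<dots> \<le> ennreal ((\<Sum>c\<in>PiE B (\<lambda>_. {..<N}). G' {k\<in>B. c k = j}) / N ^ card B)"
    by (rule insert.IH[OF G'0 G'mono])
  also have "(\<Sum>c\<in>PiE B (\<lambda>_. {..<N}). G' {k\<in>B. c k = j}) =
      (\<Sum>c\<in>PiE (insert i B) (\<lambda>_. {..<N}). G {k \<in> insert i B. c k = j}) / N"
  proof -
    have fin: "finite (PiE B (\<lambda>_. {..<N}))" using insert(1) by (intro finite_PiE) auto
    have "(\<Sum>c\<in>PiE (insert i B) (\<lambda>_. {..<N}). G {k \<in> insert i B. c k = j}) =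
        (\<Sum>(y, c)\<in>{..<N} \<times> PiE B (\<lambda>_. {..<N}). G {k \<in> insert i B. (c(i := y)) k = j})"
      unfolding PiE_insert_eq using inj_combinator[OF insert(2), of "\<lambda>_. {..<N}"]
      by (subst sum.reindex) (auto simp: case_prod_unfold)
    also have "\<dots> = (\<Sum>c\<in>PiE B (\<lambda>_. {..<N}). \<Sum>y<N. G {k \<in> insert i B. (c(i := y)) k = j})"
      by (simp only: sum.cartesian_product[symmetric]) (rule sum.swap)
    also have "\<dots> = (\<Sum>c\<in>PiE B (\<lambda>_. {..<N}). real N * G' {k\<in>B. c k = j})"
    proof (intro sum.cong refl)
      fix c
      let ?T = "{k\<in>B. c k = j}"
      have "{k \<in> insert i B. (c(i := y)) k = j} = (if y = j then insert i ?T else ?T)" for y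
        using insert(2) by auto
      then have "(\<Sum>y<N. G {k \<in> insert i B. (c(i := y)) k = j}) = (\<Sum>y<N. G ?T + (if y = j then G (insert i ?T) - G ?T else 0))"
        by (intro sum.cong) auto
      also have "\<dots> = real N * G ?T + (G (insert i ?T) - G ?T)"
        using assms(5) by (simp add: sum.distrib)
      also have "\<dots> = real N * G' ?T" using N by (simp add: G'_def field_simps)
      finally show "(\<Sum>y<N. G {k \<in> insert i B. (c(i := y)) k = j}) = real N * G' ?T" .
    qed
    finally show ?thesis using N by (simp add: sum_distrib_left[symmetric])
  qed
  finally show ?case using insert(1,2) by (simp add: field_simps)
qed

section \<open>Splitting a linear form into layers by the size of its variables\<close>

context complex_normed
begin

text \<open>Discarding indices is the contraction principle with coefficients 0 and 1.\<close>

lemma colour_class_moment_mono: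
  fixes Y :: "'i \<Rightarrow> 'x"
  assumes "r \<ge> 1" "finite B" "T \<subseteq> T'" "T' \<subseteq> B"
  shows "savg B (\<lambda>e. norm (\<Sum>k\<in>T. e k *\<^sub>R Y k) powr r) \<le> savg B (\<lambda>e. norm (\<Sum>k\<in>T'. e k *\<^sub>R Y k) powr r)"
proof -
  have eq: "(\<Sum>k\<in>B. ((if k \<in> T then 1 else 0) * e k) *\<^sub>R Y k) = (\<Sum>k\<in>T. e k *\<^sub>R Y k)" if "T \<subseteq> B" for T e
    using assms(2) that by (intro sum.mono_neutral_cong_right) auto
  have "savg B (\<lambda>e. norm (0 + (\<Sum>k\<in>B. ((if k \<in> T then 1 else 0) * e k) *\<^sub>R Y k)) powr r)
      \<le> savg B (\<lambda>e. norm (0 + (\<Sum>k\<in>B. ((if k \<in> T' then 1 else 0) * e k) *\<^sub>R Y k)) powr r)"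
    by (rule contraction[OF assms(1,2)]) (use assms(3) in auto)
  then show ?thesis
    using assms(3,4) by (simp only: eq[OF assms(4)] eq[OF order_trans[OF assms(3,4)]] add_0)
qed

text \<open>The selected set is dominated by each of the N colour classes alike. Adding the N bounds
  and summing over the classes inside the average over colourings lets \<open>cot\<close> bound N
  times the integral by \<open>D\<close>; this gain of 1/N is what makes rare layers cheap.\<close>

lemma layer_moment_le:
  fixes Y :: "'i \<Rightarrow> 'x"
  assumes "r \<ge> 1" and B: "finite B" and \<nu>: "borel_prob \<nu>" "A \<in> sets borel" "measure \<nu> A \<le> 1 / real N" "N > 0"
    and cot: "\<And>c. c ` B \<subseteq> {..<N} \<Longrightarrow> (\<Sum>l<N. savg B (\<lambda>e. norm (\<Sum>k\<in>{k\<in>B. c k = l}. e k *\<^sub>R Y k) powr r)) \<le> D"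
  shows "(\<integral>\<^sup>+z. ennreal (savg B (\<lambda>e. norm (\<Sum>k\<in>{k\<in>B. z k \<in> A}. e k *\<^sub>R Y k) powr r)) \<partial>PiM B (\<lambda>_. \<nu>)) \<le> ennreal (D / N)"
proof -
  define G where "G T = savg B (\<lambda>e. norm (\<Sum>k\<in>T. e k *\<^sub>R Y k) powr r)" for T
  have G0: "0 \<le> G T" for T unfolding G_def by (intro savg_nonneg) auto
  have Gmono: "G T \<le> G T'" if "T \<subseteq> T'" "T' \<subseteq> B" for T T'
    unfolding G_def by (rule colour_class_moment_mono[OF assms(1) B that])
  let ?P = "PiE B (\<lambda>_. {..<N})"
  let ?J = "\<integral>\<^sup>+z. ennreal (G {k\<in>B. z k \<in> A}) \<partial>PiM B (\<lambda>_. \<nu>)"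
  let ?a = "\<lambda>j. (\<Sum>c\<in>?P. G {k\<in>B. c k = j}) / N ^ card B"
  have "?J \<le> ennreal (?a j)" if "j < N" for j
    by (rule nn_integral_selection_le[OF B \<nu>(1-3) that G0 Gmono])
  then have "(\<Sum>j<N. ?J) \<le> (\<Sum>j<N. ennreal (?a j))" by (intro sum_mono) auto
  also have "\<dots> = ennreal (\<Sum>j<N. ?a j)"
    by (intro sum_ennreal divide_nonneg_nonneg sum_nonneg G0) auto
  also have "(\<Sum>j<N. ?a j) = (\<Sum>c\<in>?P. \<Sum>j<N. G {k\<in>B. c k = j}) / N ^ card B"
    by (simp only: sum_divide_distrib[symmetric]) (subst sum.swap, rule refl)
  also have "ennreal \<dots> \<le> ennreal D"
  proof (rule ennreal_leI)
    have "(\<Sum>c\<in>?P. \<Sum>j<N. G {k\<in>B. c k = j}) \<le> (\<Sum>c\<in>?P. D)"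
      unfolding G_def by (intro sum_mono cot) (auto dest: PiE_mem)
    also have "\<dots> = D * N ^ card B" using B by (simp add: card_PiE)
    finally show "(\<Sum>c\<in>?P. \<Sum>j<N. G {k\<in>B. c k = j}) / N ^ card B \<le> D"
      using \<nu>(4) by (simp add: field_simps)
  qed
  finally have "of_nat N * ?J \<le> ennreal D" by simp
  then have "(of_nat N * ?J) / of_nat N \<le> ennreal D / of_nat N" by (rule divide_right_mono_ennreal)
  also have "(of_nat N * ?J) / of_nat N = ?J"
    unfolding mult.commute[of "of_nat N"] by (rule ennreal_mult_divide_eq) (use \<nu>(4) in auto)
  also have "ennreal D / of_nat N \<le> ennreal (D / N)"
  proof (cases "D \<ge> 0")
    case True then show ?thesis using \<nu>(4) by (simp add: divide_ennreal ennreal_of_nat_eq_real_of_nat)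
  qed (auto simp: ennreal_neg)
  finally show ?thesis by (simp add: G_def)
qed

text \<open>A finite \<open>B\<close> meets finitely many layers. The sizes are replaced by the
  majorant \<open>b\<close>, whose sum splits by layers, and the weighted power inequality separates
  the layers at the price w_l^(1-r).\<close>

lemma moment_le_layers:
  fixes Y :: "'i \<Rightarrow> 'x" and t w :: "nat \<Rightarrow> real"
  assumes "r \<ge> 1" "finite B" "\<And>l. 0 \<le> t l" "\<And>l. 0 < w l" "\<And>L. (\<Sum>l<L. w l) \<le> 1"
    and cov: "\<And>u. \<exists>l. cmod u \<le> t l \<and> u \<in> A l"
  shows "ennreal (savg B (\<lambda>e. norm (\<Sum>k\<in>B. e k *\<^sub>R sc (z k) (Y k)) powr r))
    \<le> (\<Sum>l. ennreal (2 powr r * (w l powr (1 - r) * t l powr r)) *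
          ennreal (savg B (\<lambda>e. norm (\<Sum>k\<in>{k\<in>B. z k \<in> A l}. e k *\<^sub>R Y k) powr r)))"
proof -
  define F where "F l = savg B (\<lambda>e. norm (\<Sum>k\<in>{k\<in>B. z k \<in> A l}. e k *\<^sub>R Y k) powr r)" for l
  have F0: "0 \<le> F l" for l unfolding F_def by (intro savg_nonneg) auto
  obtain l' where l': "\<And>u. cmod u \<le> t (l' u) \<and> u \<in> A (l' u)"
    using choice[of "\<lambda>u l. cmod u \<le> t l \<and> u \<in> A l"] cov by blast
  define l where "l k = l' (z k)" for k
  have l: "cmod (z k) \<le> t (l k)" "z k \<in> A (l k)" for k
    using l'[of "z k"] by (auto simp: l_def)
  obtain L where L: "l k < L" if "k \<in> B" for k
  proof (rule that[of "Suc (Max (l ` B))"])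
    fix k assume "k \<in> B"
    then have "l k \<le> Max (l ` B)" using assms(2) by simp
    then show "l k < Suc (Max (l ` B))" by simp
  qed
  \<comment> \<open>The sets \<open>A i\<close> may overlap, so all layers containing the value are
    counted; this can only enlarge the majorant.\<close>
  define b where "b k = (\<Sum>i<L. t i * (if z k \<in> A i then 1 else 0))" for k
  have zb: "cmod (z k) \<le> b k" if "k \<in> B" for k
  proof -
    have "t (l k) * (if z k \<in> A (l k) then 1 else 0) \<le> b k"
      unfolding b_def using L[OF that] assms(3)
      by (intro member_le_sum[of "l k" _ "\<lambda>i. t i * (if z k \<in> A i then 1 else 0)"]) auto
    then show ?thesis using l[of k] by simp
  qed
  let ?S = "\<lambda>i e. \<Sum>k\<in>{k\<in>B. z k \<in> A i}. e k *\<^sub>R Y k"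
  have split: "(\<Sum>k\<in>B. (b k * e k) *\<^sub>R Y k) = (\<Sum>i<L. t i *\<^sub>R ?S i e)" for e
  proof -
    have "(\<Sum>k\<in>B. (b k * e k) *\<^sub>R Y k) = (\<Sum>k\<in>B. \<Sum>i<L. t i *\<^sub>R (if z k \<in> A i then e k *\<^sub>R Y k else 0))"
      unfolding b_def sum_distrib_right scaleR_sum_left by (intro sum.cong refl) auto
    also have "\<dots> = (\<Sum>i<L. t i *\<^sub>R (\<Sum>k\<in>B. if z k \<in> A i then e k *\<^sub>R Y k else 0))"
      unfolding scaleR_sum_right by (rule sum.swap)
    also have "\<dots> = (\<Sum>i<L. t i *\<^sub>R ?S i e)"
      using assms(2) by (simp add: sum.inter_filter)
    finally show ?thesis .
  qed
  have pw: "norm (\<Sum>k\<in>B. (b k * e k) *\<^sub>R Y k) powr r \<le> (\<Sum>i<L. (w i powr (1 - r) * t i powr r) * norm (?S i e) powr r)" for e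
  proof -
    have "norm (\<Sum>i<L. t i *\<^sub>R ?S i e) \<le> (\<Sum>i<L. t i * norm (?S i e))"
      by (rule order_trans[OF norm_sum]) (simp add: assms(3))
    then have "norm (\<Sum>i<L. t i *\<^sub>R ?S i e) powr r \<le> (\<Sum>i<L. t i * norm (?S i e)) powr r"
      using assms(1) by (intro powr_mono2) auto
    also have "\<dots> \<le> (\<Sum>i<L. w i powr (1 - r) * (t i * norm (?S i e)) powr r)"
      using assms by (intro weighted_powr_le) auto
    finally show ?thesis using assms(3) by (simp add: split powr_mult mult.assoc)
  qed
  have "savg B (\<lambda>e. norm (\<Sum>k\<in>B. e k *\<^sub>R sc (z k) (Y k)) powr r)
     \<le> 2 powr r * savg B (\<lambda>e. norm (\<Sum>k\<in>B. (b k * e k) *\<^sub>R Y k) powr r)"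
    by (rule complex_contraction[OF assms(1,2) zb])
  also have "\<dots> \<le> 2 powr r * savg B (\<lambda>e. \<Sum>i<L. (w i powr (1 - r) * t i powr r) * norm (?S i e) powr r)"
    by (intro mult_left_mono savg_mono pw) auto
  also have "\<dots> = (\<Sum>i<L. 2 powr r * (w i powr (1 - r) * t i powr r) * F i)"
    by (simp only: savg_sum savg_cmult F_def sum_distrib_left mult.assoc)
  finally have "ennreal (savg B (\<lambda>e. norm (\<Sum>k\<in>B. e k *\<^sub>R sc (z k) (Y k)) powr r))
    \<le> ennreal (\<Sum>i<L. 2 powr r * (w i powr (1 - r) * t i powr r) * F i)" by (rule ennreal_leI)
  also have "\<dots> = (\<Sum>i<L. ennreal (2 powr r * (w i powr (1 - r) * t i powr r)) * ennreal (F i))"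
    using F0 by (simp add: ennreal_mult flip: sum_ennreal)
  also have "\<dots> \<le> (\<Sum>l. ennreal (2 powr r * (w l powr (1 - r) * t l powr r)) * ennreal (F l))"
    by (intro sum_le_suminf) auto
  finally show ?thesis by (simp add: F_def)
qed

text \<open>Markov's inequality for the s-th moment. The clause l = 0 makes the lowest layer the
  whole plane, where the bound is the trivial 1.\<close>

lemma markov_layer:
  assumes "borel_prob \<nu>" "(\<integral>\<^sup>+z. ennreal (cmod z powr s) \<partial>\<nu>) \<le> ennreal K0" "K0 > 0" "s > 0"
  shows "measure \<nu> {z. l = 0 \<or> K0 * 2 ^ l \<le> cmod z powr s} \<le> 1 / real (2 ^ l)"
proof (cases "l = 0")
  case False
  interpret prob_space \<nu> using assms(1) by (rule borel_probD)
  have sets[measurable_cong]: "sets \<nu> = sets borel" using assms(1) by (rule borel_probD)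
  have spc: "space \<nu> = UNIV" using assms(1) by (rule space_borel_prob)
  have "emeasure \<nu> {z\<in>space \<nu>. 1 \<le> ennreal (1 / (K0 * 2 ^ l)) * ennreal (cmod z powr s)}
    \<le> ennreal (1 / (K0 * 2 ^ l)) * (\<integral>\<^sup>+z. ennreal (cmod z powr s) * indicator (space \<nu>) z \<partial>\<nu>)"
    by (rule nn_integral_Markov_inequality) auto
  also have "\<dots> \<le> ennreal (1 / (K0 * 2 ^ l)) * ennreal K0"
    using assms(2) by (intro mult_left_mono) (auto simp: spc)
  also have "\<dots> = ennreal (1 / 2 ^ l)" using assms(3) by (simp flip: ennreal_mult')
  also have "{z\<in>space \<nu>. 1 \<le> ennreal (1 / (K0 * 2 ^ l)) * ennreal (cmod z powr s)} = {z. l = 0 \<or> K0 * 2 ^ l \<le> cmod z powr s}"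
    using False assms(3) by (auto simp: spc field_simps simp flip: ennreal_mult' ennreal_1)
  finally show ?thesis by (simp add: emeasure_eq_measure)
next
  case True
  interpret prob_space \<nu> using assms(1) by (rule borel_probD)
  show ?thesis using True by simp
qed

end

section \<open>Domination of linear forms by Rademacher sums\<close>

context complex_normed
begin

lemma continuous_on_norm_powr:
  assumes "continuous_on UNIV F" "p > 0"
  shows "continuous_on UNIV (\<lambda>z. norm (F z :: 'y::real_normed_vector) powr p)"
  using assms by (intro continuous_on_powr' continuous_intros) auto

lemma continuous_on_linear_form:
  fixes Y :: "'i::countable \<Rightarrow> 'x"
  shows "continuous_on UNIV (\<lambda>z. \<Sum>k\<in>B. sc (z k) (Y k))"
  by (intro continuous_intros continuous_on_product_coordinates)

text \<open>The layer is the least l with |u|^s < 2 K0 2^l. If l > 0, failure at l - 1 is exactly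
  the lower bound K0 2^l.\<close>

lemma layer_cover:
  fixes u :: complex
  assumes "K0 > 0" "s > 0"
  shows "\<exists>l::nat. cmod u \<le> (2 * K0 * 2 ^ l) powr (1 / s) \<and> u \<in> {z. l = 0 \<or> K0 * 2 ^ l \<le> cmod z powr s}"
proof -
  let ?P = "\<lambda>l::nat. cmod u powr s < 2 * K0 * 2 ^ l"
  obtain n :: nat where "cmod u powr s / (2 * K0) < 2 ^ n" using real_arch_pow[of 2] by auto
  then have "?P n" using assms by (simp add: field_simps)
  then have P: "?P (LEAST l. ?P l)" by (rule LeastI)
  define l where "l = (LEAST l. ?P l)"
  have "(cmod u powr s) powr (1 / s) \<le> (2 * K0 * 2 ^ l) powr (1 / s)"
    using P assms by (intro powr_mono2) (auto simp: l_def)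
  then have "cmod u \<le> (2 * K0 * 2 ^ l) powr (1 / s)" using assms by (simp add: powr_powr)
  moreover have "K0 * 2 ^ l \<le> cmod u powr s" if nz: "l \<noteq> 0"
  proof -
    obtain l' where l': "l = Suc l'" using nz by (cases l) auto
    have "\<not> ?P l'" using not_less_Least[of l' ?P] l' by (auto simp: l_def)
    then show ?thesis by (simp add: l' mult_ac)
  qed
  ultimately show ?thesis by (intro exI[of _ l]) auto
qed

text \<open>Size and probability of layer l combine to 2^(-l (1 - r/s)) up to a constant. The ratio
  \<theta> of the weights is chosen such that their cost (\<theta>^l)^(1-r) equals 2^(l (1 - r/s) /
  2), half of the available exponent, and the other half remains as geometric decay.\<close>

lemma layer_series:
  fixes r s K0 :: real
  assumes "1 < r" "r < s" "K0 > 0"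
  defines "\<theta> \<equiv> 2 powr (- (1 - r / s) / (2 * (r - 1)))"
  shows "0 < \<theta>" "\<theta> < 1"
    and "((1 - \<theta>) * \<theta> ^ l) powr (1 - r) * ((2 * K0 * 2 ^ l) powr (1 / s)) powr r / 2 ^ l
        = ((1 - \<theta>) powr (1 - r) * (2 * K0) powr (r / s)) * (2 powr (- (1 - r / s) / 2)) ^ l"
    and "2 powr (- (1 - r / s) / 2) < 1"
proof -
  have rs: "0 < 1 - r / s" using assms by (simp add: field_simps)
  have "- (1 - r / s) / (2 * (r - 1)) < 0" "- (1 - r / s) / 2 < 0"
    using rs assms(1) by (auto intro!: divide_neg_pos)
  from this[THEN powr_less_mono, of 2] show \<theta>: "0 < \<theta>" "\<theta> < 1" and "2 powr (- (1 - r / s) / 2) < 1"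
    unfolding \<theta>_def by simp_all
  have e1: "(\<theta> ^ l) powr (1 - r) = (2 powr (real l * ((1 - r / s) / 2)))"
  proof -
    have 1: "\<theta> ^ l = 2 powr (- (1 - r / s) / (2 * (r - 1)) * real l)"
      unfolding \<theta>_def by (simp add: powr_powr flip: powr_realpow)
    have 2: "- (1 - r / s) / (2 * (r - 1)) * real l * (1 - r) = real l * ((1 - r / s) / 2)"
      using assms(1) by (simp add: divide_simps) (simp add: algebra_simps)
    show ?thesis by (simp only: 1 2 powr_powr)
  qed
  have e2: "((2 * K0 * 2 ^ l) powr (1 / s)) powr r = (2 * K0) powr (r / s) * 2 powr (real l * (r / s))"
    using assms(3) by (simp add: powr_powr powr_mult flip: powr_realpow)
  have e3: "2 powr (real l * ((1 - r / s) / 2)) * 2 powr (real l * (r / s)) / 2 ^ l = (2 powr (- (1 - r / s) / 2)) ^ l"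
  proof -
    have 1: "(2::real) ^ l = 2 powr real l" by (simp add: powr_realpow)
    have 2: "(2 powr (- (1 - r / s) / 2)) ^ l = 2 powr (real l * (- (1 - r / s) / 2))"
      by (simp add: powr_powr mult.commute flip: powr_realpow)
    have 3: "real l * ((1 - r / s) / 2) + real l * (r / s) - real l = real l * (- (1 - r / s) / 2)"
      by (simp add: field_simps)
    show ?thesis unfolding 1 2 powr_add[symmetric] powr_diff[symmetric] 3 ..
  qed
  show "((1 - \<theta>) * \<theta> ^ l) powr (1 - r) * ((2 * K0 * 2 ^ l) powr (1 / s)) powr r / 2 ^ l
        = ((1 - \<theta>) powr (1 - r) * (2 * K0) powr (r / s)) * (2 powr (- (1 - r / s) / 2)) ^ l"
    unfolding powr_mult[of "1 - \<theta>"] e1 e2 e3[symmetric] by simp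
qed

text \<open>One constant for all finite index sets and all coefficients in the space. The
  \<open>itself\<close> argument fixes the index type: \<open>nat\<close> for the variables of P,
  \<open>nat \<times> nat\<close> for the entries of the matrix in L.\<close>

definition lform_moment_bound :: "complex measure \<Rightarrow> real \<Rightarrow> real \<Rightarrow> 'i itself \<Rightarrow> bool" where
  "lform_moment_bound \<nu> p K _ \<longleftrightarrow> (\<forall>(B :: 'i set) Y. finite B \<longrightarrow>
     (\<integral>\<^sup>+z. ennreal (norm (\<Sum>k\<in>B. sc (z k) (Y k)) powr p) \<partial>PiM B (\<lambda>_. \<nu>))
      \<le> ennreal (K * savg B (\<lambda>e. norm (\<Sum>k\<in>B. e k *\<^sub>R Y k) powr p)))"

text \<open>After inserting random signs, the layers are bounded by Markov's inequality and cotype,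
  and the series over the layers converges because r < s. The law is quantified after
  \<open>K\<close>, which depends on it only through \<open>K0\<close>: the normalized sums of m
  signs need one constant for all m.\<close>

lemma lform_moment_bound_cotype:
  assumes "has_cotype TYPE('x) q" "q \<le> r" "r < s" "K0 > 0"
  shows "\<exists>K\<ge>0. \<forall>\<nu>. symmetric_law \<nu> \<longrightarrow> (\<integral>\<^sup>+z. ennreal (cmod z powr s) \<partial>\<nu>) \<le> ennreal K0 \<longrightarrow>
     lform_moment_bound \<nu> r K TYPE('i::countable)"
proof -
  have r: "2 \<le> r" using assms by (auto simp: has_cotype_def)
  obtain D where D: "D \<ge> 0" "\<And>N (B :: 'i set) c (Y :: 'i \<Rightarrow> 'x). finite B \<Longrightarrow> c ` B \<subseteq> {..<N::nat} \<Longrightarrow>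
     (\<Sum>l<N. savg B (\<lambda>e. norm (\<Sum>k\<in>{k\<in>B. c k = l}. e k *\<^sub>R Y k) powr r))
      \<le> D * savg B (\<lambda>e. norm (\<Sum>k\<in>B. e k *\<^sub>R Y k) powr r)"
    using cotype_colouring[OF assms(1,2)] by blast
  define \<theta> where "\<theta> = 2 powr (- (1 - r / s) / (2 * (r - 1)))"
  define t where "t l = (2 * K0 * 2 ^ l) powr (1 / s)" for l :: nat
  define w where "w l = (1 - \<theta>) * \<theta> ^ l" for l :: nat
  define A where "A l = {z. l = 0 \<or> K0 * 2 ^ l \<le> cmod z powr s}" for l :: nat
  define \<rho> where "\<rho> = 2 powr (- (1 - r / s) / 2)"
  define c where "c = (1 - \<theta>) powr (1 - r) * (2 * K0) powr (r / s)"
  have \<theta>: "0 < \<theta>" "\<theta> < 1" and \<rho>: "0 \<le> \<rho>" "\<rho> < 1"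
    and ser: "w l powr (1 - r) * t l powr r / 2 ^ l = c * \<rho> ^ l" for l
    using layer_series[of r s K0] r assms by (auto simp: \<theta>_def \<rho>_def c_def w_def t_def)
  have c: "c \<ge> 0" by (simp add: c_def)
  have w: "0 < w l" for l using \<theta> by (simp add: w_def)
  have wsum: "(\<Sum>l<L. w l) \<le> 1" for L
  proof -
    have "(\<Sum>l<L. w l) = 1 - \<theta> ^ L"
      unfolding w_def sum_distrib_left[symmetric] using \<theta> by (simp add: sum_gp_strict)
    then show ?thesis using \<theta> by simp
  qed
  have A: "A l \<in> sets borel" for l
    unfolding A_def by (cases "l = 0") auto
  show ?thesis
  proof (intro exI[of _ "2 powr r * c * D / (1 - \<rho>)"] conjI allI impI)
    show "0 \<le> 2 powr r * c * D / (1 - \<rho>)" using c D \<rho> by simp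
    fix \<nu> assume \<nu>: "symmetric_law \<nu>" "(\<integral>\<^sup>+z. ennreal (cmod z powr s) \<partial>\<nu>) \<le> ennreal K0"
    note bp = symmetric_law_borel_prob[OF \<nu>(1)]
    show "lform_moment_bound \<nu> r (2 powr r * c * D / (1 - \<rho>)) TYPE('i)"
      unfolding lform_moment_bound_def
    proof (intro allI impI)
      fix B :: "'i set" and Y :: "'i \<Rightarrow> 'x" assume B: "finite B"
      let ?M = "PiM B (\<lambda>_. \<nu>)"
      define E where "E = savg B (\<lambda>e. norm (\<Sum>k\<in>B. e k *\<^sub>R Y k) powr r)"
      have E: "E \<ge> 0" unfolding E_def by (intro savg_nonneg) auto
      define F where "F l z = savg B (\<lambda>e. norm (\<Sum>k\<in>{k\<in>B. z k \<in> A l}. e k *\<^sub>R Y k) powr r)" for l z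
      define g where "g z = norm (\<Sum>k\<in>B. sc (z k) (Y k)) powr r" for z
      have cont: "continuous_on UNIV g" unfolding g_def
        using r by (intro continuous_on_norm_powr continuous_on_linear_form) auto
      have loc: "local_on B g" unfolding g_def by (intro local_onI) simp
      have "(\<integral>\<^sup>+z. ennreal (g z) \<partial>?M) = (\<integral>\<^sup>+z. ennreal (savg B (\<lambda>e. g (\<lambda>k. of_real (e k) * z k))) \<partial>?M)"
        by (rule nn_integral_symmetrize[OF B \<nu>(1) cont loc]) (simp add: g_def)
      also have "\<dots> \<le> (\<integral>\<^sup>+z. (\<Sum>l. ennreal (2 powr r * (w l powr (1 - r) * t l powr r)) * ennreal (F l z)) \<partial>?M)"
        unfolding g_def F_def sc_mult sc_of_real
      proof (intro nn_integral_mono moment_le_layers)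
        show "\<exists>l. cmod u \<le> t l \<and> u \<in> A l" for u
          unfolding t_def A_def using layer_cover[of K0 s u] assms r by simp
      qed (use r B w wsum assms in \<open>auto simp: t_def\<close>)
      also have "\<dots> = (\<Sum>l. \<integral>\<^sup>+z. ennreal (2 powr r * (w l powr (1 - r) * t l powr r)) * ennreal (F l z) \<partial>?M)"
        unfolding F_def
        by (intro nn_integral_suminf borel_measurable_times_ennreal borel_measurable_const
           measurable_selection[of B \<nu> _ "\<lambda>T. savg B (\<lambda>e. norm (\<Sum>k\<in>T. e k *\<^sub>R Y k) powr r)"] B A borel_probD[OF bp])
      also have "\<dots> = (\<Sum>l. ennreal (2 powr r * (w l powr (1 - r) * t l powr r)) * (\<integral>\<^sup>+z. ennreal (F l z) \<partial>?M))"
        unfolding F_def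
        by (intro suminf_cong nn_integral_cmult
           measurable_selection[of B \<nu> _ "\<lambda>T. savg B (\<lambda>e. norm (\<Sum>k\<in>T. e k *\<^sub>R Y k) powr r)"] B A borel_probD[OF bp])
      also have "\<dots> \<le> (\<Sum>l. ennreal ((2 powr r * c * D * E) * \<rho> ^ l))"
      proof (intro suminf_le allI)
        fix l
        have "(\<integral>\<^sup>+z. ennreal (F l z) \<partial>?M) \<le> ennreal (D * E / real (2 ^ l))"
          unfolding F_def
        proof (rule layer_moment_le[OF _ B bp A])
          show "measure \<nu> (A l) \<le> 1 / real (2 ^ l)"
            unfolding A_def using assms r by (intro markov_layer[OF bp \<nu>(2)]) auto
          show "(\<Sum>j<2 ^ l. savg B (\<lambda>e. norm (\<Sum>k\<in>{k\<in>B. c k = j}. e k *\<^sub>R Y k) powr r)) \<le> D * E"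
            if "c ` B \<subseteq> {..<2 ^ l}" for c :: "'i \<Rightarrow> nat"
            unfolding E_def by (rule D(2)[OF B that])
        qed (use r in auto)
        then have "ennreal (2 powr r * (w l powr (1 - r) * t l powr r)) * (\<integral>\<^sup>+z. ennreal (F l z) \<partial>?M)
          \<le> ennreal (2 powr r * (w l powr (1 - r) * t l powr r)) * ennreal (D * E / real (2 ^ l))"
          by (rule mult_left_mono) simp
        also have "\<dots> = ennreal ((2 powr r * D * E) * (w l powr (1 - r) * t l powr r / 2 ^ l))"
          using D E by (simp add: mult_ac flip: ennreal_mult)
        finally show "ennreal (2 powr r * (w l powr (1 - r) * t l powr r)) * (\<integral>\<^sup>+z. ennreal (F l z) \<partial>?M)
          \<le> ennreal ((2 powr r * c * D * E) * \<rho> ^ l)"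
          unfolding ser by (simp only: mult_ac)
      qed auto
      also have "\<dots> = ennreal ((2 powr r * c * D * E) * (1 / (1 - \<rho>)))"
        using \<rho> c D E
        by (intro suminf_ennreal_eq sums_mult geometric_sums) auto
      finally show "(\<integral>\<^sup>+z. ennreal (norm (\<Sum>k\<in>B. sc (z k) (Y k)) powr r) \<partial>?M)
         \<le> ennreal (2 powr r * c * D / (1 - \<rho>) * savg B (\<lambda>e. norm (\<Sum>k\<in>B. e k *\<^sub>R Y k) powr r))"
        by (simp add: g_def E_def)
    qed
  qed
qed

text \<open>With A the r-th mean of the Rademacher sum, x^p \<le> A^p + A^(p-r) x^r holds below and
  above the level A. Integration gives (1 + K) A^p, and Kahane's inequality replaces A^p by the p-th
  moment of the signs.\<close>

lemma lform_moment_bound_lower_exponent: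
  fixes \<nu> :: "complex measure"
  assumes "lform_moment_bound \<nu> r K TYPE('i::countable)" "borel_prob \<nu>" "K \<ge> 0" "1 \<le> p" "p \<le> r" "2 \<le> r"
  shows "lform_moment_bound \<nu> p ((1 + K) * (2 * (2 * 3 powr r) powr ((r - p) / r))) TYPE('i)"
  unfolding lform_moment_bound_def
proof (intro allI impI)
  fix B :: "'i set" and Y :: "'i \<Rightarrow> 'x" assume B: "finite B"
  let ?M = "PiM B (\<lambda>_. \<nu>)"
  let ?E = "\<lambda>p. savg B (\<lambda>e. norm (\<Sum>k\<in>B. e k *\<^sub>R Y k) powr p)"
  let ?N = "\<lambda>z. norm (\<Sum>k\<in>B. sc (z k) (Y k))"
  interpret prob_space \<nu> using assms(2) by (rule borel_probD)
  interpret P: prob_space ?M by (rule prob_space_PiM) (rule prob_space_axioms)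
  have E0: "?E r \<ge> 0" by (intro savg_nonneg) auto
  show "(\<integral>\<^sup>+z. ennreal (?N z powr p) \<partial>?M) \<le> ennreal ((1 + K) * (2 * (2 * 3 powr r) powr ((r - p) / r)) * ?E p)"
  proof (cases "?E r = 0")
    \<comment> \<open>The level A would be 0 here. By monotonicity in the index set every single
      \<open>Y k\<close> vanishes, and with it the linear form.\<close>
    case True
    have "norm (Y k) powr r = 0" if "k \<in> B" for k
    proof -
      have "savg B (\<lambda>e. norm (\<Sum>k\<in>{k}. e k *\<^sub>R Y k) powr r) \<le> ?E r"
        using that assms B by (intro colour_class_moment_mono) auto
      also have "savg B (\<lambda>e. norm (\<Sum>k\<in>{k}. e k *\<^sub>R Y k) powr r) = savg B (\<lambda>e. norm (Y k) powr r)"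
      proof (rule savg_cong)
        fix e :: "'i \<Rightarrow> real" assume "\<And>k. e k = 1 \<or> e k = -1"
        then have "\<bar>e k\<bar> = 1" by (metis abs_1 abs_minus)
        then show "norm (\<Sum>k\<in>{k}. e k *\<^sub>R Y k) powr r = norm (Y k) powr r" by simp
      qed
      finally show ?thesis using True B by simp
    qed
    then have "?N z = 0" for z by simp
    then show ?thesis using assms by simp
  next
    case False
    define A where "A = ?E r powr (1 / r)"
    have A: "A > 0" using False E0 by (simp add: A_def)
    have Ar: "A powr r = ?E r" using assms E0 by (simp add: A_def powr_powr)
    have pw: "x powr p \<le> A powr p + A powr (p - r) * x powr r" if "x \<ge> 0" for x
    proof (cases "x \<le> A")
      case True
      then have "x powr p \<le> A powr p" using that assms by (intro powr_mono2) auto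
      then show ?thesis by (smt (verit) mult_nonneg_nonneg powr_ge_zero)
    next
      case False
      have "x powr p = x powr (p - r) * x powr r" by (simp flip: powr_add)
      also have "\<dots> \<le> A powr (p - r) * x powr r"
        using False A assms by (intro mult_right_mono powr_mono2') auto
      finally show ?thesis by (smt (verit) powr_ge_zero)
    qed
    have m: "(\<lambda>z. ?N z powr r) \<in> borel_measurable ?M"
      using assms borel_probD(2)[OF assms(2)]
      by (intro measurable_local_continuous[where I = B] continuous_on_norm_powr continuous_on_linear_form local_onI) auto
    have "(\<integral>\<^sup>+z. ennreal (?N z powr p) \<partial>?M) \<le>
        (\<integral>\<^sup>+z. ennreal (A powr p) + ennreal (A powr (p - r)) * ennreal (?N z powr r) \<partial>?M)"
      using pw by (intro nn_integral_mono) (simp flip: ennreal_mult ennreal_plus)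
    also have "\<dots> = ennreal (A powr p) + ennreal (A powr (p - r)) * (\<integral>\<^sup>+z. ennreal (?N z powr r) \<partial>?M)"
      using m by (simp add: nn_integral_add nn_integral_cmult P.emeasure_space_1)
    also have "\<dots> \<le> ennreal (A powr p) + ennreal (A powr (p - r)) * ennreal (K * ?E r)"
      using assms(1) B unfolding lform_moment_bound_def by (intro add_left_mono mult_left_mono) auto
    also have "\<dots> = ennreal (A powr p + A powr (p - r) * (K * A powr r))"
      unfolding Ar[symmetric] using assms(3) by (simp flip: ennreal_mult ennreal_plus)
    also have "A powr p + A powr (p - r) * (K * A powr r) = (1 + K) * A powr p"
    proof -
      have "A powr (p - r) * A powr r = A powr p" by (simp flip: powr_add)
      then show ?thesis by (simp add: algebra_simps)
    qed
    also have "A powr p = ?E r powr (p / r)" by (simp add: A_def powr_powr)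
    also have "ennreal ((1 + K) * ?E r powr (p / r)) \<le> ennreal ((1 + K) * (2 * (2 * 3 powr r) powr ((r - p) / r) * ?E p))"
      using assms kahane_inequality[OF assms(4,6,5) B, of Y] by (intro ennreal_leI mult_left_mono) auto
    finally show ?thesis by (simp only: mult.assoc)
  qed
qed

lemma lform_moment_bound_ex:
  assumes "has_cotype TYPE('x) q" "q < s" "1 \<le> p" "p < s" "K0 > 0"
  shows "\<exists>K\<ge>1. \<forall>\<nu>. symmetric_law \<nu> \<longrightarrow> (\<integral>\<^sup>+z. ennreal (cmod z powr s) \<partial>\<nu>) \<le> ennreal K0 \<longrightarrow>
     lform_moment_bound \<nu> p K TYPE('i::countable)"
proof -
  \<comment> \<open>The argument by cotype works for exponents from \<open>q\<close> on, while
    \<open>p\<close> may be smaller; both lie below \<open>s\<close>, hence so does the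
    maximum.\<close>
  define r where "r = max p q"
  have r: "q \<le> r" "r < s" "2 \<le> r" "p \<le> r" using assms by (auto simp: r_def has_cotype_def)
  obtain K where K: "K \<ge> 0" "\<And>\<nu>. symmetric_law \<nu> \<Longrightarrow> (\<integral>\<^sup>+z. ennreal (cmod z powr s) \<partial>\<nu>) \<le> ennreal K0 \<Longrightarrow>
     lform_moment_bound \<nu> r K TYPE('i)"
    using lform_moment_bound_cotype[where 'i = 'i, OF assms(1) r(1,2) assms(5)] by blast
  let ?K = "(1 + K) * (2 * (2 * 3 powr r) powr ((r - p) / r))"
  have "1 \<le> 3 powr r" using r by (intro ge_one_powr_ge_zero) auto
  then have "1 \<le> (2 * 3 powr r) powr ((r - p) / r)"
    using r by (intro ge_one_powr_ge_zero) auto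
  then have "1 * 1 \<le> ?K" using K(1) by (intro mult_mono) auto
  moreover have "lform_moment_bound \<nu> p ?K TYPE('i)"
    if "symmetric_law \<nu>" "(\<integral>\<^sup>+z. ennreal (cmod z powr s) \<partial>\<nu>) \<le> ennreal K0" for \<nu>
    using K that assms r by (intro lform_moment_bound_lower_exponent symmetric_law_borel_prob) auto
  ultimately show ?thesis by (intro exI[of _ ?K]) auto
qed

end

section \<open>Supporting affine functions and transfer between a law and signs\<close>

section \<open>Jensen's inequality and the lower bound\<close>

text \<open>A hyperplane separates (x, \<phi> x) from the strict epigraph. It is not vertical, since
  the epigraph lies over the whole space, so division by \<beta> > 0 turns it into a slope.\<close>

lemma convex_subgradient:
  fixes \<phi> :: "'a::euclidean_space \<Rightarrow> real"
  assumes "convex_on UNIV \<phi>"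
  shows "\<exists>D. \<forall>y. \<phi> x + D \<bullet> (y - x) \<le> \<phi> y"
proof -
  let ?T = "{(y, t). \<phi> y < t}"
  have conv: "convex ?T"
  proof (rule convexI)
    fix a b :: "'a \<times> real" and u v :: real
    assume ab: "a \<in> ?T" "b \<in> ?T" and uv: "0 \<le> u" "0 \<le> v" "u + v = 1"
    have u: "u = 1 - v" using uv by simp
    have "\<phi> (u *\<^sub>R fst a + v *\<^sub>R fst b) \<le> u * \<phi> (fst a) + v * \<phi> (fst b)"
      using convex_onD[OF assms, of v "fst a" "fst b"] uv by (simp add: u)
    also have "\<dots> < u * snd a + v * snd b"
    proof (cases "v = 0")
      case True then show ?thesis using ab u by auto
    next
      case False
      then have "v * \<phi> (fst b) < v * snd b" using ab uv by auto
      moreover have "u * \<phi> (fst a) \<le> u * snd a" using ab uv by (intro mult_left_mono) auto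
      ultimately show ?thesis by simp
    qed
    finally show "u *\<^sub>R a + v *\<^sub>R b \<in> ?T" by (cases a; cases b) simp
  qed
  have "(x, \<phi> x + 1) \<in> ?T" by simp
  then have "?T \<noteq> {}" by blast
  then obtain a b where a: "a \<noteq> 0" and le: "\<And>z. z \<in> {(x, \<phi> x)} \<Longrightarrow> inner a z \<le> b" "\<And>z. z \<in> ?T \<Longrightarrow> b \<le> inner a z"
    using separating_hyperplane_sets[of "{(x, \<phi> x)}" ?T] conv by auto
  obtain \<alpha> \<beta> where ab: "a = (\<alpha>, \<beta>)" by (cases a)
  have sep: "\<alpha> \<bullet> x + \<beta> * \<phi> x \<le> \<alpha> \<bullet> y + \<beta> * t" if "\<phi> y < t" for y t
    using le(1)[of "(x, \<phi> x)"] le(2)[of "(y, t)"] that by (simp add: ab)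
  have "\<beta> \<ge> 0" using sep[of x "\<phi> x + 1"] by (simp add: algebra_simps)
  moreover have "\<beta> \<noteq> 0"
  proof
    assume "\<beta> = 0"
    then have "\<alpha> \<bullet> x \<le> \<alpha> \<bullet> (x - \<alpha>)" using sep[of "x - \<alpha>" "\<phi> (x - \<alpha>) + 1"] by simp
    then have "\<alpha> \<bullet> \<alpha> \<le> 0" by (simp add: inner_diff_right)
    then have "\<alpha> = 0" using inner_gt_zero_iff[of \<alpha>] by linarith
    then show False using a ab \<open>\<beta> = 0\<close> by (simp add: zero_prod_def)
  qed
  ultimately have \<beta>: "\<beta> > 0" by simp
  have "\<phi> x + (- (1 / \<beta>) *\<^sub>R \<alpha>) \<bullet> (y - x) \<le> \<phi> y" for y
  \<comment> \<open>The separated epigraph is strict, so the graph point over y is reached only as a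
    limit from above.\<close>
  proof (rule field_le_epsilon)
    fix d :: real assume "d > 0"
    from sep[of y "\<phi> y + d"] this have "\<alpha> \<bullet> x + \<beta> * \<phi> x \<le> \<alpha> \<bullet> y + \<beta> * (\<phi> y + d)" by simp
    then show "\<phi> x + (- (1 / \<beta>) *\<^sub>R \<alpha>) \<bullet> (y - x) \<le> \<phi> y + d"
      using \<beta> by (simp add: inner_diff_right field_simps)
  qed
  then show ?thesis by blast
qed

text \<open>The supporting affine function at the mean is integrated; when the right side is
  infinite there is nothing to prove.\<close>

lemma nn_integral_jensen:
  fixes \<phi> :: "complex \<Rightarrow> real" and X :: "'a \<Rightarrow> complex"
  assumes "prob_space M" "integrable M X" "convex_on UNIV \<phi>" "\<And>z. 0 \<le> \<phi> z"
  shows "ennreal (\<phi> (\<integral>x. X x \<partial>M)) \<le> (\<integral>\<^sup>+x. ennreal (\<phi> (X x)) \<partial>M)"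
proof (cases "(\<integral>\<^sup>+x. ennreal (\<phi> (X x)) \<partial>M) = \<infinity>")
  case False
  interpret prob_space M by fact
  let ?w = "\<integral>x. X x \<partial>M"
  obtain D where D: "\<And>y. \<phi> ?w + D \<bullet> (y - ?w) \<le> \<phi> y" using convex_subgradient[OF assms(3)] by blast
  have "continuous_on UNIV \<phi>" by (rule convex_on_continuous[OF open_UNIV assms(3)])
  then have m: "(\<lambda>x. \<phi> (X x)) \<in> borel_measurable M"
    by (intro measurable_compose[OF borel_measurable_integrable[OF assms(2)]] borel_measurable_continuous_onI)
  have int: "integrable M (\<lambda>x. \<phi> (X x))"
    using False assms(4) m by (intro integrableI_bounded) (auto simp: less_top)
  have "\<phi> ?w = (\<integral>x. \<phi> ?w + D \<bullet> (X x - ?w) \<partial>M)"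
    using assms(2) by (simp add: inner_diff_right prob_space)
  also have "\<dots> \<le> (\<integral>x. \<phi> (X x) \<partial>M)"
    using assms(2) int D by (intro integral_mono) auto
  finally have "ennreal (\<phi> ?w) \<le> ennreal (\<integral>x. \<phi> (X x) \<partial>M)" by (rule ennreal_leI)
  also have "\<dots> = (\<integral>\<^sup>+x. ennreal (\<phi> (X x)) \<partial>M)"
    using int assms(4) by (intro nn_integral_eq_integral[symmetric]) auto
  finally show ?thesis .
qed auto

text \<open>The law of a symmetric variable \<open>z\<close> is the average of the laws of \<open>h(z) z\<close> and \<open>- h(z) z\<close>,
  whose means \<open>c\<close> and \<open>-c\<close> need not vanish.\<close>
lemma symmetric_law_jensen:
  fixes \<phi> :: "complex \<Rightarrow> real" and h :: "complex \<Rightarrow> real"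
  assumes "symmetric_law \<nu>" "integrable \<nu> (\<lambda>z. z)" "h \<in> borel_measurable borel" "\<And>z. h z = 1 \<or> h z = -1"
    and "convex_on UNIV \<phi>" "\<And>z. 0 \<le> \<phi> z"
  defines "c \<equiv> \<integral>z. h z *\<^sub>R z \<partial>\<nu>"
  shows "(ennreal (\<phi> c) + ennreal (\<phi> (- c))) / 2 \<le> (\<integral>\<^sup>+z. ennreal (\<phi> z) \<partial>\<nu>)"
proof -
  note bp = symmetric_law_borel_prob[OF assms(1)]
  interpret prob_space \<nu> using bp by (rule borel_probD)
  have sets[measurable_cong]: "sets \<nu> = sets borel" using bp by (rule borel_probD)
  note assms(3)[measurable]
  have "continuous_on UNIV \<phi>" by (rule convex_on_continuous[OF open_UNIV assms(5)])
  then have \<phi>[measurable]: "\<phi> \<in> borel_measurable borel" by (rule borel_measurable_continuous_onI)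
  have abs_h: "\<bar>h z\<bar> = 1" for z using assms(4)[of z] by auto
  have int: "integrable \<nu> (\<lambda>z. h z *\<^sub>R z)"
    by (rule Bochner_Integration.integrable_bound[OF assms(2)]) (auto simp: abs_h)
  have "ennreal (\<phi> c) + ennreal (\<phi> (- c)) \<le> (\<integral>\<^sup>+z. ennreal (\<phi> (h z *\<^sub>R z)) \<partial>\<nu>) + (\<integral>\<^sup>+z. ennreal (\<phi> (- (h z *\<^sub>R z))) \<partial>\<nu>)"
    using nn_integral_jensen[OF prob_space_axioms int assms(5,6)]
      nn_integral_jensen[OF prob_space_axioms integrable_minus[OF int] assms(5,6)]
    unfolding c_def by (intro add_mono) simp_all
  also have "\<dots> = (\<integral>\<^sup>+z. ennreal (\<phi> (h z *\<^sub>R z)) + ennreal (\<phi> (- (h z *\<^sub>R z))) \<partial>\<nu>)"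
    by (rule nn_integral_add[symmetric]) auto
  also have "\<dots> = (\<integral>\<^sup>+z. ennreal (\<phi> z) + ennreal (\<phi> (- z)) \<partial>\<nu>)"
  proof (rule nn_integral_cong)
    fix z show "ennreal (\<phi> (h z *\<^sub>R z)) + ennreal (\<phi> (- (h z *\<^sub>R z))) = ennreal (\<phi> z) + ennreal (\<phi> (- z))"
      using assms(4)[of z] by (auto simp: add.commute)
  qed
  also have "\<dots> = (\<integral>\<^sup>+z. ennreal (\<phi> z) \<partial>\<nu>) + (\<integral>\<^sup>+z. ennreal (\<phi> (- z)) \<partial>\<nu>)"
    by (rule nn_integral_add) auto
  also have "(\<integral>\<^sup>+z. ennreal (\<phi> (- z)) \<partial>\<nu>) = (\<integral>\<^sup>+z. ennreal (\<phi> z) \<partial>\<nu>)"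
    by (rule nn_integral_symmetric_law[OF assms(1)]) auto
  finally have "ennreal (\<phi> c) + ennreal (\<phi> (- c)) \<le> (\<integral>\<^sup>+z. ennreal (\<phi> z) \<partial>\<nu>) * 2" by (simp add: mult_2_right)
  then have "(ennreal (\<phi> c) + ennreal (\<phi> (- c))) / 2 \<le> ((\<integral>\<^sup>+z. ennreal (\<phi> z) \<partial>\<nu>) * 2) / 2"
    by (rule divide_right_mono_ennreal)
  then show ?thesis by (simp add: ennreal_mult_divide_eq)
qed

lemma nn_integral_PiM_singleton:
  assumes "borel_prob \<nu>" "f \<in> borel_measurable borel"
  shows "(\<integral>\<^sup>+w. f (w k) \<partial>PiM {k} (\<lambda>_. \<nu>)) = (\<integral>\<^sup>+t. f t \<partial>\<nu>)"
proof -
  interpret product_sigma_finite "\<lambda>_. \<nu>" by (rule product_sigma_finite_borel_prob) fact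
  show ?thesis
    using assms(2) borel_probD(2)[OF assms(1)]
    by (intro product_nn_integral_singleton) (simp cong: measurable_cong_sets)
qed

context complex_normed
begin

lemma convex_on_norm_affine:
  assumes "p \<ge> 1"
  shows "convex_on UNIV (\<lambda>t. norm (a + sc t b) powr p)"
proof (rule convex_onI)
  fix t :: real and x y :: complex assume t: "0 < t" "t < 1"
  have "a + sc ((1 - t) *\<^sub>R x + t *\<^sub>R y) b = (1 - t) *\<^sub>R (a + sc x b) + t *\<^sub>R (a + sc y b)"
    by (simp add: sc_add_left sc_scaleR_left scaleR_add_right)
  then show "norm (a + sc ((1 - t) *\<^sub>R x + t *\<^sub>R y) b) powr p \<le> (1 - t) * norm (a + sc x b) powr p + t * norm (a + sc y b) powr p"
    using norm_powr_convex[OF assms, of t "a + sc x b" "a + sc y b"] t by simp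
qed simp

text \<open>Each coordinate is a colour class of its own and is replaced with factor 1, because
  \<open>F\<close> is affine in it and Jensen's inequality is lossless. The law enters only through
  the amplitude \<open>c\<close>.\<close>

lemma lower_moment:
  fixes F :: "('i::countable \<Rightarrow> complex) \<Rightarrow> 'x"
  assumes "finite I" "symmetric_law \<nu>" "integrable \<nu> (\<lambda>z. z)" "h \<in> borel_measurable borel" "\<And>z. h z = 1 \<or> h z = (-1::real)"
    and "1 \<le> p" "continuous_on UNIV F" "local_on I F"
    and affine: "\<And>k z. k \<in> I \<Longrightarrow> \<exists>a b. \<forall>t. F (z(k := t)) = a + sc t b"
  defines "c \<equiv> \<integral>z. h z *\<^sub>R z \<partial>\<nu>"
  shows "ennreal (savg I (\<lambda>e. norm (F (\<lambda>k. of_real (e k) * c)) powr p)) \<le> (\<integral>\<^sup>+z. ennreal (norm (F z) powr p) \<partial>PiM I (\<lambda>_. \<nu>))"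
proof -
  note bp = symmetric_law_borel_prob[OF assms(2)]
  have cont: "continuous_on UNIV (\<lambda>z. norm (F z) powr p)"
    using assms by (intro continuous_on_norm_powr) auto
  have loc: "local_on I (\<lambda>z. norm (F z) powr p)"
    by (intro local_onI arg_cong[where f = "\<lambda>y. norm y powr p"] local_onD[OF assms(8)])
  have "(\<integral>\<^sup>+z. ennreal (norm (F z) powr p) \<partial>PiM I (\<lambda>_. sign_law c))
     \<le> 1 ^ card I * (\<integral>\<^sup>+z. ennreal (norm (F z) powr p) \<partial>PiM I (\<lambda>_. \<nu>))"
  proof (rule nn_integral_colours_mono[OF assms(1) borel_prob_sign_law bp assms(1), of "\<lambda>k. k"])
    show "(\<lambda>z. ennreal (norm (F z) powr p)) \<in> borel_measurable (PiM I N)" if "\<And>i. sets (N i) = sets borel" for N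
      by (intro measurable_compose[OF measurable_local_continuous[OF cont loc that] measurable_ennreal])
  next
    fix j z assume j: "j \<in> I"
    obtain a b where ab: "\<And>t. F (z(j := t)) = a + sc t b" using affine[OF j] by blast
    let ?\<phi> = "\<lambda>t. norm (a + sc t b) powr p"
    have B: "{k\<in>I. k = j} = {j}" using j by auto
    have upd: "(\<lambda>k. if k \<in> {j} then w k else z k) = z(j := w j)" for w by auto
    have "continuous_on UNIV ?\<phi>" using assms(6) by (intro continuous_on_norm_powr continuous_intros) auto
    then have m: "(\<lambda>t. ennreal (?\<phi> t)) \<in> borel_measurable borel"
      by (intro measurable_compose[OF borel_measurable_continuous_onI measurable_ennreal])
    show "(\<integral>\<^sup>+w. ennreal (norm (F (\<lambda>k. if k \<in> {k\<in>I. k = j} then w k else z k)) powr p) \<partial>PiM {k\<in>I. k = j} (\<lambda>_. sign_law c))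
      \<le> 1 * (\<integral>\<^sup>+w. ennreal (norm (F (\<lambda>k. if k \<in> {k\<in>I. k = j} then w k else z k)) powr p) \<partial>PiM {k\<in>I. k = j} (\<lambda>_. \<nu>))"
      unfolding B upd ab nn_integral_PiM_singleton[OF borel_prob_sign_law m] nn_integral_PiM_singleton[OF bp m]
        nn_integral_sign_law[OF m] mult_1 c_def
      by (rule symmetric_law_jensen[OF assms(2-5) convex_on_norm_affine[OF assms(6)]]) simp
  qed simp
  also have "(\<integral>\<^sup>+z. ennreal (norm (F z) powr p) \<partial>PiM I (\<lambda>_. sign_law c)) =
      ennreal (savg I (\<lambda>e. norm (F (\<lambda>k. of_real (e k) * c)) powr p))"
    by (rule nn_integral_PiM_sign_law[OF assms(1) cont loc]) simp
  finally show ?thesis by simp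
qed

text \<open>On a class \<open>F\<close> is a linear form, so passing to signs costs one factor
  \<open>K\<close>; hence a power of \<open>K\<close> with the number of classes as exponent,
  whatever the size of \<open>I\<close>.\<close>

lemma upper_moment:
  fixes F :: "('i::countable \<Rightarrow> complex) \<Rightarrow> 'x" and \<delta> :: "'i \<Rightarrow> 'j"
  assumes "lform_moment_bound \<nu> p K TYPE('i)" "borel_prob \<nu>" "K \<ge> 0" "1 \<le> p" "finite I" "finite C" "\<delta> ` I \<subseteq> C"
    and "continuous_on UNIV F" "local_on I F"
    and lin: "\<And>j z. j \<in> C \<Longrightarrow> \<exists>Y. \<forall>w. F (\<lambda>k. if k \<in> {k\<in>I. \<delta> k = j} then w k else z k) = (\<Sum>k\<in>{k\<in>I. \<delta> k = j}. sc (w k) (Y k))"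
  shows "(\<integral>\<^sup>+z. ennreal (norm (F z) powr p) \<partial>PiM I (\<lambda>_. \<nu>)) \<le> ennreal (K ^ card C * savg I (\<lambda>e. norm (F (\<lambda>k. of_real (e k))) powr p))"
proof -
  have cont: "continuous_on UNIV (\<lambda>z. norm (F z) powr p)"
    using assms by (intro continuous_on_norm_powr) auto
  have loc: "local_on I (\<lambda>z. norm (F z) powr p)"
    by (intro local_onI arg_cong[where f = "\<lambda>y. norm y powr p"] local_onD[OF assms(9)])
  have "(\<integral>\<^sup>+z. ennreal (norm (F z) powr p) \<partial>PiM I (\<lambda>_. \<nu>))
     \<le> ennreal K ^ card C * (\<integral>\<^sup>+z. ennreal (norm (F z) powr p) \<partial>PiM I (\<lambda>_. sign_law 1))"
  proof (rule nn_integral_colours_mono[OF assms(5,2) borel_prob_sign_law assms(6,7)])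
    show "(\<lambda>z. ennreal (norm (F z) powr p)) \<in> borel_measurable (PiM I N)" if "\<And>i. sets (N i) = sets borel" for N
      by (intro measurable_compose[OF measurable_local_continuous[OF cont loc that] measurable_ennreal])
  next
    fix j z assume j: "j \<in> C"
    let ?B = "{k\<in>I. \<delta> k = j}"
    obtain Y where Y: "\<And>w. F (\<lambda>k. if k \<in> ?B then w k else z k) = (\<Sum>k\<in>?B. sc (w k) (Y k))"
      using lin[OF j] by blast
    have B: "finite ?B" using assms(5) by simp
    have "(\<integral>\<^sup>+w. ennreal (norm (\<Sum>k\<in>?B. sc (w k) (Y k)) powr p) \<partial>PiM ?B (\<lambda>_. \<nu>))
       \<le> ennreal (K * savg ?B (\<lambda>e. norm (\<Sum>k\<in>?B. e k *\<^sub>R Y k) powr p))"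
      using assms(1) B unfolding lform_moment_bound_def by blast
    also have "\<dots> = ennreal K * ennreal (savg ?B (\<lambda>e. norm (\<Sum>k\<in>?B. e k *\<^sub>R Y k) powr p))"
      using assms(3) by (intro ennreal_mult savg_nonneg) auto
    also have "ennreal (savg ?B (\<lambda>e. norm (\<Sum>k\<in>?B. e k *\<^sub>R Y k) powr p)) =
        (\<integral>\<^sup>+w. ennreal (norm (\<Sum>k\<in>?B. sc (w k) (Y k)) powr p) \<partial>PiM ?B (\<lambda>_. sign_law 1))"
      using assms(4) B by (subst nn_integral_PiM_sign_law)
        (auto intro!: continuous_on_norm_powr continuous_on_linear_form local_onI simp: sc_of_real)
    finally show "(\<integral>\<^sup>+w. ennreal (norm (F (\<lambda>k. if k \<in> ?B then w k else z k)) powr p) \<partial>PiM ?B (\<lambda>_. \<nu>))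
      \<le> ennreal K * (\<integral>\<^sup>+w. ennreal (norm (F (\<lambda>k. if k \<in> ?B then w k else z k)) powr p) \<partial>PiM ?B (\<lambda>_. sign_law 1))"
      unfolding Y .
  qed
  also have "(\<integral>\<^sup>+z. ennreal (norm (F z) powr p) \<partial>PiM I (\<lambda>_. sign_law 1)) =
      ennreal (savg I (\<lambda>e. norm (F (\<lambda>k. of_real (e k))) powr p))"
    using nn_integral_PiM_sign_law[OF assms(5) cont loc, of 1] by simp
  also have "ennreal K ^ card C * \<dots> = ennreal (K ^ card C * savg I (\<lambda>e. norm (F (\<lambda>k. of_real (e k))) powr p))"
    using assms(3) by (simp add: ennreal_power ennreal_mult savg_nonneg)
  finally show ?thesis .
qed

end

section \<open>Polarization, the coefficients of L, and averages over colourings\<close>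

section \<open>Polarization\<close>

text \<open>Orthogonality of the Walsh functions. If \<delta> is bijective the signs occur in pairs;
  otherwise some colour i is missed, and flipping \<theta> at i changes the sign of the
  product.\<close>

lemma savg_prod_colouring:
  assumes "finite A" "finite C" "card A = card C" "\<delta> ` A \<subseteq> C"
  shows "savg C (\<lambda>\<theta>. (\<Prod>j\<in>C. \<theta> j) * (\<Prod>k\<in>A. \<theta> (\<delta> k))) = (if bij_betw \<delta> A C then 1 else 0)"
proof (cases "bij_betw \<delta> A C")
  case True
  have "(\<Prod>j\<in>C. \<theta> j) * (\<Prod>k\<in>A. \<theta> (\<delta> k)) = 1" if "\<And>k. \<theta> k = 1 \<or> \<theta> k = -1" for \<theta> :: "_ \<Rightarrow> real"
  proof -
    have "\<theta> j * \<theta> j = 1" for j using that[of j] by auto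
    then show ?thesis by (simp add: prod.reindex_bij_betw[OF True] flip: prod.distrib)
  qed
  then have "savg C (\<lambda>\<theta>. (\<Prod>j\<in>C. \<theta> j) * (\<Prod>k\<in>A. \<theta> (\<delta> k))) = savg C (\<lambda>_. 1)"
    by (rule savg_cong)
  then show ?thesis using True assms(2) by simp
next
  case False
  have "\<delta> ` A \<noteq> C"
    using False assms eq_card_imp_inj_on[of A \<delta>] by (auto simp: bij_betw_def)
  then obtain i where i: "i \<in> C" "i \<notin> \<delta> ` A" using assms(4) by blast
  let ?f = "\<lambda>\<theta>. (\<Prod>j\<in>C. \<theta> j) * (\<Prod>k\<in>A. \<theta> (\<delta> k)) :: real"
  let ?d = "\<lambda>j. if j = i then -1 else 1 :: real"
  have "savg C ?f = savg C (\<lambda>\<theta>. ?f (\<lambda>j. ?d j * \<theta> j))"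
  proof (rule savg_flip[symmetric, OF assms(2)])
    show "local_on C ?f"
      using assms(4) by (intro local_onI arg_cong2[where f = times] prod.cong) auto
  qed auto
  also have "\<dots> = savg C (\<lambda>\<theta>. (-1) * ?f \<theta>)"
  proof (rule savg_cong)
    fix \<theta> :: "_ \<Rightarrow> real"
    have "(\<Prod>j\<in>C. ?d j) = -1" using assms(2) i by (simp add: prod.delta)
    then have 1: "(\<Prod>j\<in>C. ?d j * \<theta> j) = - (\<Prod>j\<in>C. \<theta> j)" by (simp only: prod.distrib)
    have 2: "(\<Prod>k\<in>A. ?d (\<delta> k) * \<theta> (\<delta> k)) = (\<Prod>k\<in>A. \<theta> (\<delta> k))"
      using i by (intro prod.cong) auto
    show "?f (\<lambda>j. ?d j * \<theta> j) = (-1) * ?f \<theta>" unfolding 1 2 by simp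
  qed
  also have "\<dots> = - savg C ?f" by (simp only: savg_cmult)
  finally show ?thesis using False by simp
qed

lemma card_bijections:
  assumes "finite A" "finite C" "card A = card C"
  shows "card {f \<in> PiE A (\<lambda>_. C). bij_betw f A C} = fact (card C)"
proof -
  have "bij_betw f A C \<longleftrightarrow> inj_on f A" if "f \<in> PiE A (\<lambda>_. C)" for f
  proof
    assume "inj_on f A"
    moreover have "f ` A \<subseteq> C" using that by (auto dest: PiE_mem)
    ultimately have "f ` A = C" using assms by (intro card_subset_eq) (auto simp: card_image)
    then show "bij_betw f A C" using \<open>inj_on f A\<close> by (simp add: bij_betw_def)
  qed (simp add: bij_betw_def)
  then have "{f \<in> PiE A (\<lambda>_. C). bij_betw f A C} = {f \<in> PiE A (\<lambda>_. C). inj_on f A}" by blast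
  moreover have "prod ((-) k) {0..<k} = fact k" for k :: nat
    by (simp add: fact_prod_rev)
  ultimately show ?thesis
    using card_inj_on_subset_funcset[OF assms(1,2) order_refl] assms(3) by simp
qed

locale sym_poly = complex_normed sc for sc :: "complex \<Rightarrow> 'x::real_normed_vector \<Rightarrow> 'x" +
  fixes m n :: nat and x :: "nat set \<Rightarrow> 'x" and L :: "(nat \<Rightarrow> nat \<Rightarrow> complex) \<Rightarrow> 'x"
  assumes sym: "sym_multilinear sc m L" and diag: "L (\<lambda>_. z) = tetra_poly sc n m x z"
begin

abbreviation "P \<equiv> tetra_poly sc n m x"
abbreviation "\<A> \<equiv> {A. A \<subseteq> {1..n} \<and> card A = m}"

lemma finite_\<A>: "finite \<A>" by (rule finite_subset[of _ "Pow {1..n}"]) auto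

lemma \<A>D: "A \<in> \<A> \<Longrightarrow> finite A" "A \<in> \<A> \<Longrightarrow> card A = m" "A \<in> \<A> \<Longrightarrow> A \<subseteq> {1..n}"
  by (auto intro: finite_subset)

lemma L_cong: "(\<And>j. j \<in> {1..m} \<Longrightarrow> u j = v j) \<Longrightarrow> L u = L v"
  using sym unfolding sym_multilinear_def by blast

lemma L_permute: "\<sigma> permutes {1..m} \<Longrightarrow> L (\<lambda>j. u (\<sigma> j)) = L u"
  using sym unfolding sym_multilinear_def comp_def by blast

lemma L_row: "j \<in> {1..m} \<Longrightarrow> L (u(j := (\<lambda>k. a * w k + b * w' k))) = sc a (L (u(j := w))) + sc b (L (u(j := w')))"
  using sym unfolding sym_multilinear_def by blast

lemma L_row_sum:
  assumes "j \<in> {1..m}" "finite S"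
  shows "L (u(j := (\<lambda>k. \<Sum>i\<in>S. a i * w i k))) = (\<Sum>i\<in>S. sc (a i) (L (u(j := w i))))"
  using assms(2)
proof (induction S rule: finite_induct)
  case empty
  show ?case using L_row[OF assms(1), of u 0 "\<lambda>_. 0" 0 "\<lambda>_. 0"] by (simp add: fun_upd_def)
next
  case (insert i S)
  have "L (u(j := (\<lambda>k. \<Sum>i\<in>insert i S. a i * w i k))) = L (u(j := (\<lambda>k. a i * w i k + 1 * (\<Sum>i\<in>S. a i * w i k))))"
    using insert by simp
  also have "\<dots> = sc (a i) (L (u(j := w i))) + sc 1 (L (u(j := (\<lambda>k. \<Sum>i\<in>S. a i * w i k))))"
    by (rule L_row[OF assms(1)])
  finally show ?case unfolding insert.IH sum.insert[OF insert(1,2)] sc_1 .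
qed

lemma L_expand:
  assumes "J \<subseteq> {1..m}" "finite S"
  shows "L (\<lambda>j. if j \<in> J then (\<lambda>k. \<Sum>i\<in>S. a j i * w j i k) else v j)
    = (\<Sum>f\<in>PiE J (\<lambda>_. S). sc (\<Prod>j\<in>J. a j (f j)) (L (\<lambda>j. if j \<in> J then w j (f j) else v j)))"
  using finite_subset[OF assms(1) finite_atLeastAtMost] assms(1)
proof (induction J arbitrary: v rule: finite_induct)
  case (insert l J)
  let ?row = "\<lambda>j k. \<Sum>i\<in>S. a j i * w j i k"
  have l: "l \<in> {1..m}" using insert by auto
  have 1: "(\<lambda>j. if j \<in> insert l J then ?row j else v j) = (\<lambda>j. if j \<in> J then ?row j else (v(l := ?row l)) j)"
    using insert(2) by (auto simp: fun_eq_iff)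
  have 2: "(\<lambda>j. if j \<in> J then w j (f j) else (v(l := y)) j) = (\<lambda>j. if j \<in> J then w j (f j) else v j)(l := y)" for f y
    using insert(2) by (auto simp: fun_eq_iff)
  have 3: "(\<lambda>j. if j \<in> J then w j (f j) else v j)(l := w l i) =
      (\<lambda>j. if j \<in> insert l J then w j ((f(l := i)) j) else v j)" for f i
    using insert(2) by (auto simp: fun_eq_iff)
  have "L (\<lambda>j. if j \<in> insert l J then ?row j else v j) =
    (\<Sum>f\<in>PiE J (\<lambda>_. S). sc (\<Prod>j\<in>J. a j (f j)) (L (\<lambda>j. if j \<in> J then w j (f j) else (v(l := ?row l)) j)))"
    unfolding 1 using insert by (intro insert.IH) auto
  also have "\<dots> = (\<Sum>f\<in>PiE J (\<lambda>_. S). \<Sum>i\<in>S. sc (a l i * (\<Prod>j\<in>J. a j (f j)))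
        (L (\<lambda>j. if j \<in> insert l J then w j ((f(l := i)) j) else v j)))"
    unfolding 2 L_row_sum[OF l assms(2)] sc_sum_right 3 sc_mult[symmetric] by (simp only: mult.commute)
  also have "\<dots> = (\<Sum>f\<in>PiE J (\<lambda>_. S). \<Sum>i\<in>S. sc (\<Prod>j\<in>insert l J. a j ((f(l := i)) j))
        (L (\<lambda>j. if j \<in> insert l J then w j ((f(l := i)) j) else v j)))"
  proof (intro sum.cong refl arg_cong2[where f = sc])
    fix f i
    have "(\<Prod>j\<in>J. a j ((f(l := i)) j)) = (\<Prod>j\<in>J. a j (f j))" using insert(2) by (intro prod.cong) auto
    then show "a l i * (\<Prod>j\<in>J. a j (f j)) = (\<Prod>j\<in>insert l J. a j ((f(l := i)) j))"
      using insert(1,2) by simp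
  qed
  also have "\<dots> = (\<Sum>(i, f)\<in>S \<times> PiE J (\<lambda>_. S). sc (\<Prod>j\<in>insert l J. a j ((f(l := i)) j))
        (L (\<lambda>j. if j \<in> insert l J then w j ((f(l := i)) j) else v j)))"
    by (subst sum.swap) (simp only: sum.cartesian_product)
  also have "\<dots> = (\<Sum>f\<in>PiE (insert l J) (\<lambda>_. S). sc (\<Prod>j\<in>insert l J. a j (f j))
        (L (\<lambda>j. if j \<in> insert l J then w j (f j) else v j)))"
    unfolding PiE_insert_eq using inj_combinator[OF insert(2), of "\<lambda>_. S"]
    by (subst sum.reindex) (auto simp: case_prod_unfold)
  finally show ?case .
qed simp

text \<open>Multilinear expansion yields the terms L(u o f) over all maps f of {1..m} into itself.
  Orthogonality keeps the permutations, and symmetry of L makes their m! contributions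
  equal.\<close>

lemma polarization:
  "fact m *\<^sub>R L u = savg {1..m} (\<lambda>\<theta>. (\<Prod>j\<in>{1..m}. \<theta> j) *\<^sub>R P (\<lambda>k. \<Sum>j\<in>{1..m}. of_real (\<theta> j) * u j k))"
proof -
  let ?I = "{1..m}"
  let ?F = "PiE ?I (\<lambda>_. ?I)"
  have exp: "P (\<lambda>k. \<Sum>j\<in>?I. of_real (\<theta> j) * u j k) = (\<Sum>f\<in>?F. (\<Prod>j\<in>?I. \<theta> (f j)) *\<^sub>R L (\<lambda>j. u (f j)))" for \<theta>
  proof -
    have "P (\<lambda>k. \<Sum>j\<in>?I. of_real (\<theta> j) * u j k) = L (\<lambda>_ k. \<Sum>j\<in>?I. of_real (\<theta> j) * u j k)" by (rule diag[symmetric])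
    also have "\<dots> = L (\<lambda>j. if j \<in> ?I then (\<lambda>k. \<Sum>i\<in>?I. of_real (\<theta> i) * u i k) else u j)" by (rule L_cong) simp
    also have "\<dots> = (\<Sum>f\<in>?F. sc (\<Prod>j\<in>?I. of_real (\<theta> (f j))) (L (\<lambda>j. if j \<in> ?I then u (f j) else u j)))"
      by (rule L_expand) auto
    also have "\<dots> = (\<Sum>f\<in>?F. (\<Prod>j\<in>?I. \<theta> (f j)) *\<^sub>R L (\<lambda>j. u (f j)))"
    proof (intro sum.cong refl)
      fix f
      have "L (\<lambda>j. if j \<in> ?I then u (f j) else u j) = L (\<lambda>j. u (f j))" by (rule L_cong) simp
      then show "sc (\<Prod>j\<in>?I. of_real (\<theta> (f j))) (L (\<lambda>j. if j \<in> ?I then u (f j) else u j)) = (\<Prod>j\<in>?I. \<theta> (f j)) *\<^sub>R L (\<lambda>j. u (f j))"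
        by (simp only: of_real_prod[symmetric] sc_of_real)
    qed
    finally show ?thesis .
  qed
  have "savg ?I (\<lambda>\<theta>. (\<Prod>j\<in>?I. \<theta> j) *\<^sub>R P (\<lambda>k. \<Sum>j\<in>?I. of_real (\<theta> j) * u j k))
      = savg ?I (\<lambda>\<theta>. \<Sum>f\<in>?F. ((\<Prod>j\<in>?I. \<theta> j) * (\<Prod>j\<in>?I. \<theta> (f j))) *\<^sub>R L (\<lambda>j. u (f j)))"
    by (simp only: exp scaleR_sum_right scaleR_scaleR)
  also have "\<dots> = (\<Sum>f\<in>?F. savg ?I (\<lambda>\<theta>. (\<Prod>j\<in>?I. \<theta> j) * (\<Prod>j\<in>?I. \<theta> (f j))) *\<^sub>R L (\<lambda>j. u (f j)))"
    unfolding savg_sum by (simp add: savg_def scaleR_sum_left sum_divide_distrib scaleR_sum_right)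
  also have "\<dots> = (\<Sum>f\<in>?F. if bij_betw f ?I ?I then L u else 0)"
  proof (intro sum.cong refl)
    fix f assume f: "f \<in> ?F"
    have s: "savg ?I (\<lambda>\<theta>. (\<Prod>j\<in>?I. \<theta> j) * (\<Prod>j\<in>?I. \<theta> (f j))) = (if bij_betw f ?I ?I then 1 else 0)"
      using f by (intro savg_prod_colouring) (auto dest: PiE_mem)
    show "savg ?I (\<lambda>\<theta>. (\<Prod>j\<in>?I. \<theta> j) * (\<Prod>j\<in>?I. \<theta> (f j))) *\<^sub>R L (\<lambda>j. u (f j)) = (if bij_betw f ?I ?I then L u else 0)"
    proof (cases "bij_betw f ?I ?I")
      case True
      define \<sigma> where "\<sigma> j = (if j \<in> ?I then f j else j)" for j
      have "bij_betw \<sigma> ?I ?I" using bij_betw_cong[of ?I \<sigma> f ?I] True by (simp add: \<sigma>_def)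
      then have "\<sigma> permutes ?I" by (rule bij_imp_permutes) (simp add: \<sigma>_def del: atLeastAtMost_iff)
      moreover have "L (\<lambda>j. u (f j)) = L (\<lambda>j. u (\<sigma> j))" by (rule L_cong) (simp add: \<sigma>_def)
      ultimately have "L (\<lambda>j. u (f j)) = L u" by (simp only: L_permute)
      then show ?thesis unfolding s using True by simp
    next
      case False
      then show ?thesis unfolding s by simp
    qed
  qed
  also have "\<dots> = (\<Sum>f\<in>{f\<in>?F. bij_betw f ?I ?I}. L u)"
    by (rule sum.inter_filter[symmetric]) (auto intro: finite_PiE)
  also have "\<dots> = fact m *\<^sub>R L u"
    using card_bijections[of ?I ?I] by (simp add: sum_constant_scaleR)
  finally show ?thesis by simp
qed

text \<open>Polarization again, with P expanded through its coefficients. The resulting formula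
  shows that L depends on finitely many entries, is continuous and is homogeneous, none of which is
  part of the definition of \<open>L\<close>.\<close>

lemma L_coefficients:
  "fact m *\<^sub>R L u = (\<Sum>A\<in>\<A>. \<Sum>\<sigma>\<in>{\<sigma>\<in>PiE A (\<lambda>_. {1..m}). bij_betw \<sigma> A {1..m}}. sc (\<Prod>k\<in>A. u (\<sigma> k) k) (x A))"
proof -
  let ?I = "{1..m}"
  have exp: "P (\<lambda>k. \<Sum>j\<in>?I. of_real (\<theta> j) * u j k) =
      (\<Sum>A\<in>\<A>. \<Sum>\<sigma>\<in>PiE A (\<lambda>_. ?I). (\<Prod>k\<in>A. \<theta> (\<sigma> k)) *\<^sub>R sc (\<Prod>k\<in>A. u (\<sigma> k) k) (x A))" for \<theta>
    unfolding tetra_poly_def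
  proof (intro sum.cong refl)
    fix A assume A: "A \<in> \<A>"
    have "(\<Prod>k\<in>A. \<Sum>j\<in>?I. of_real (\<theta> j) * u j k) = (\<Sum>\<sigma>\<in>PiE A (\<lambda>_. ?I). \<Prod>k\<in>A. of_real (\<theta> (\<sigma> k)) * u (\<sigma> k) k)"
      using \<A>D(1)[OF A] by (intro prod_sum_PiE) auto
    also have "\<dots> = (\<Sum>\<sigma>\<in>PiE A (\<lambda>_. ?I). (\<Prod>k\<in>A. \<theta> (\<sigma> k)) *\<^sub>R (\<Prod>k\<in>A. u (\<sigma> k) k))"
      by (simp add: prod.distrib scaleR_conv_of_real)
    finally show "sc (\<Prod>k\<in>A. \<Sum>j\<in>?I. of_real (\<theta> j) * u j k) (x A) = (\<Sum>\<sigma>\<in>PiE A (\<lambda>_. ?I). (\<Prod>k\<in>A. \<theta> (\<sigma> k)) *\<^sub>R sc (\<Prod>k\<in>A. u (\<sigma> k) k) (x A))"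
      by (simp only: sc_sum_left sc_scaleR_left)
  qed
  have pull: "savg ?I (\<lambda>\<theta>. g \<theta> *\<^sub>R y) = savg ?I g *\<^sub>R y" for g and y :: 'x
    by (simp add: savg_def scaleR_sum_left sum_divide_distrib scaleR_sum_right)
  have "fact m *\<^sub>R L u = savg ?I (\<lambda>\<theta>. \<Sum>A\<in>\<A>. \<Sum>\<sigma>\<in>PiE A (\<lambda>_. ?I).
      ((\<Prod>j\<in>?I. \<theta> j) * (\<Prod>k\<in>A. \<theta> (\<sigma> k))) *\<^sub>R sc (\<Prod>k\<in>A. u (\<sigma> k) k) (x A))"
    unfolding polarization exp by (simp only: scaleR_sum_right scaleR_scaleR)
  also have "\<dots> = (\<Sum>A\<in>\<A>. \<Sum>\<sigma>\<in>PiE A (\<lambda>_. ?I). savg ?I (\<lambda>\<theta>. (\<Prod>j\<in>?I. \<theta> j) * (\<Prod>k\<in>A. \<theta> (\<sigma> k))) *\<^sub>R sc (\<Prod>k\<in>A. u (\<sigma> k) k) (x A))"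
    by (simp only: savg_sum pull)
  also have "\<dots> = (\<Sum>A\<in>\<A>. \<Sum>\<sigma>\<in>{\<sigma>\<in>PiE A (\<lambda>_. ?I). bij_betw \<sigma> A ?I}. sc (\<Prod>k\<in>A. u (\<sigma> k) k) (x A))"
  proof (rule sum.cong[OF refl])
    fix A assume A: "A \<in> \<A>"
    have "(\<Sum>\<sigma>\<in>PiE A (\<lambda>_. ?I). savg ?I (\<lambda>\<theta>. (\<Prod>j\<in>?I. \<theta> j) * (\<Prod>k\<in>A. \<theta> (\<sigma> k))) *\<^sub>R sc (\<Prod>k\<in>A. u (\<sigma> k) k) (x A))
      = (\<Sum>\<sigma>\<in>PiE A (\<lambda>_. ?I). if bij_betw \<sigma> A ?I then sc (\<Prod>k\<in>A. u (\<sigma> k) k) (x A) else 0)"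
    proof (intro sum.cong refl)
      fix \<sigma> assume "\<sigma> \<in> PiE A (\<lambda>_. ?I)"
      then have "savg ?I (\<lambda>\<theta>. (\<Prod>j\<in>?I. \<theta> j) * (\<Prod>k\<in>A. \<theta> (\<sigma> k))) = (if bij_betw \<sigma> A ?I then 1 else 0)"
        using \<A>D[OF A] by (intro savg_prod_colouring) (auto dest: PiE_mem)
      then show "savg ?I (\<lambda>\<theta>. (\<Prod>j\<in>?I. \<theta> j) * (\<Prod>k\<in>A. \<theta> (\<sigma> k))) *\<^sub>R sc (\<Prod>k\<in>A. u (\<sigma> k) k) (x A) =
        (if bij_betw \<sigma> A ?I then sc (\<Prod>k\<in>A. u (\<sigma> k) k) (x A) else 0)" by simp
    qed
    also have "\<dots> = (\<Sum>\<sigma>\<in>{\<sigma>\<in>PiE A (\<lambda>_. ?I). bij_betw \<sigma> A ?I}. sc (\<Prod>k\<in>A. u (\<sigma> k) k) (x A))"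
      using \<A>D(1)[OF A] by (intro sum.inter_filter[symmetric] finite_PiE) auto
    finally show "(\<Sum>\<sigma>\<in>PiE A (\<lambda>_. ?I). savg ?I (\<lambda>\<theta>. (\<Prod>j\<in>?I. \<theta> j) * (\<Prod>k\<in>A. \<theta> (\<sigma> k))) *\<^sub>R sc (\<Prod>k\<in>A. u (\<sigma> k) k) (x A))
      = (\<Sum>\<sigma>\<in>{\<sigma>\<in>PiE A (\<lambda>_. ?I). bij_betw \<sigma> A ?I}. sc (\<Prod>k\<in>A. u (\<sigma> k) k) (x A))" .
  qed
  finally show ?thesis .
qed

text \<open>In the term of A and \<sigma>, each k in A occurs once, in row \<sigma> k. Summation
  over the independent values \<tau> k therefore factors; every row gives the same sum
  \<open>s k\<close>, and each of the n - m indices outside A contributes m. Taking for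
  \<open>g\<close> a single entry per column gives the decomposition by colour classes, taking
  cyclic shifts gives column sums.\<close>

lemma sum_L_colourings:
  assumes "\<And>k j. k \<in> {1..n} \<Longrightarrow> j \<in> {1..m} \<Longrightarrow> (\<Sum>i\<in>{1..m}. g k j i) = s k" "m > 0"
  shows "(\<Sum>\<tau>\<in>PiE {1..n} (\<lambda>_. {1..m}). L (\<lambda>j k. g k j (\<tau> k))) = (real m ^ n / real m ^ m) *\<^sub>R P s"
proof -
  let ?I = "{1..m}" and ?T = "PiE {1..n} (\<lambda>_. {1..m})"
  let ?B = "\<lambda>A. {\<sigma>\<in>PiE A (\<lambda>_. ?I). bij_betw \<sigma> A ?I}"
  have inner: "(\<Sum>\<tau>\<in>?T. \<Prod>k\<in>A. g k (\<sigma> k) (\<tau> k)) = of_real (real m ^ n / real m ^ m) * (\<Prod>k\<in>A. s k)"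
    if A: "A \<in> \<A>" and \<sigma>: "\<sigma> \<in> ?B A" for A \<sigma>
  proof -
    have "(\<Sum>\<tau>\<in>?T. \<Prod>k\<in>A. g k (\<sigma> k) (\<tau> k)) = (\<Sum>\<tau>\<in>?T. \<Prod>k\<in>{1..n}. if k \<in> A then g k (\<sigma> k) (\<tau> k) else 1)"
      using \<A>D(3)[OF A] by (simp add: prod.If_cases Int_absorb1)
    also have "\<dots> = (\<Prod>k\<in>{1..n}. \<Sum>i\<in>?I. if k \<in> A then g k (\<sigma> k) i else 1)"
      by (rule prod_sum_PiE[symmetric]) auto
    also have "\<dots> = (\<Prod>k\<in>{1..n}. if k \<in> A then s k else of_nat m)"
    proof (intro prod.cong refl)
      fix k assume k: "k \<in> {1..n}"
      have "\<sigma> k \<in> ?I" if "k \<in> A" using \<sigma> that by (auto dest: PiE_mem)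
      then show "(\<Sum>i\<in>?I. if k \<in> A then g k (\<sigma> k) i else 1) = (if k \<in> A then s k else of_nat m)"
        using assms(1)[OF k] by simp
    qed
    also have "\<dots> = (\<Prod>k\<in>A. s k) * of_nat m ^ card ({1..n} - A)"
      using \<A>D(3)[OF A] by (simp add: prod.If_cases Int_absorb1 Diff_eq)
    also have "card ({1..n} - A) = n - m"
      using \<A>D[OF A] by (simp add: card_Diff_subset)
    also have "(of_nat m ^ (n - m) :: complex) = of_real (real m ^ n / real m ^ m)"
    proof -
      have "m \<le> n" using \<A>D[OF A] card_mono[of "{1..n}" A] by simp
      then show ?thesis using assms(2) by (simp add: power_diff)
    qed
    finally show ?thesis by (simp only: mult.commute)
  qed
  have "fact m *\<^sub>R (\<Sum>\<tau>\<in>?T. L (\<lambda>j k. g k j (\<tau> k))) =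
     (\<Sum>\<tau>\<in>?T. \<Sum>A\<in>\<A>. \<Sum>\<sigma>\<in>?B A. sc (\<Prod>k\<in>A. g k (\<sigma> k) (\<tau> k)) (x A))"
    by (simp only: scaleR_sum_right L_coefficients)
  also have "\<dots> = (\<Sum>A\<in>\<A>. \<Sum>\<tau>\<in>?T. \<Sum>\<sigma>\<in>?B A. sc (\<Prod>k\<in>A. g k (\<sigma> k) (\<tau> k)) (x A))"
    by (rule sum.swap)
  also have "\<dots> = (\<Sum>A\<in>\<A>. \<Sum>\<sigma>\<in>?B A. \<Sum>\<tau>\<in>?T. sc (\<Prod>k\<in>A. g k (\<sigma> k) (\<tau> k)) (x A))"
    by (intro sum.cong refl sum.swap)
  also have "\<dots> = (\<Sum>A\<in>\<A>. \<Sum>\<sigma>\<in>?B A. (real m ^ n / real m ^ m) *\<^sub>R sc (\<Prod>k\<in>A. s k) (x A))"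
    by (intro sum.cong refl) (simp only: sc_sum_left[symmetric] inner sc_mult sc_of_real)
  also have "\<dots> = (\<Sum>A\<in>\<A>. fact m *\<^sub>R (real m ^ n / real m ^ m) *\<^sub>R sc (\<Prod>k\<in>A. s k) (x A))"
  proof (intro sum.cong refl)
    fix A assume A: "A \<in> \<A>"
    have "card (?B A) = fact m"
      using card_bijections[of A ?I] \<A>D[OF A] by simp
    then show "(\<Sum>\<sigma>\<in>?B A. (real m ^ n / real m ^ m) *\<^sub>R sc (\<Prod>k\<in>A. s k) (x A)) =
       fact m *\<^sub>R (real m ^ n / real m ^ m) *\<^sub>R sc (\<Prod>k\<in>A. s k) (x A)"
      by (simp only: sum_constant_scaleR) simp
  qed
  also have "\<dots> = fact m *\<^sub>R ((real m ^ n / real m ^ m) *\<^sub>R P s)"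
    unfolding tetra_poly_def by (simp only: scaleR_sum_right)
  finally show ?thesis
    by (simp only: real_vector.scale_left_imp_eq fact_nonzero scaleR_cancel_left) simp
qed

end

section \<open>Comparison of P and L at signs, and transfer to general laws\<close>

section \<open>Decoupling\<close>

context sym_poly
begin

lemma L_local:
  assumes "\<And>j k. j \<in> {1..m} \<Longrightarrow> k \<in> {1..n} \<Longrightarrow> u j k = v j k"
  shows "L u = L v"
proof -
  have "fact m *\<^sub>R L u = fact m *\<^sub>R L v"
    unfolding L_coefficients
  proof (rule sum.cong[OF refl], rule sum.cong[OF refl])
    fix A \<sigma> assume A: "A \<in> \<A>" and \<sigma>: "\<sigma> \<in> {\<sigma>\<in>PiE A (\<lambda>_. {1..m}). bij_betw \<sigma> A {1..m}}"
    have "(\<Prod>k\<in>A. u (\<sigma> k) k) = (\<Prod>k\<in>A. v (\<sigma> k) k)"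
    proof (rule prod.cong[OF refl])
      fix k assume "k \<in> A"
      then show "u (\<sigma> k) k = v (\<sigma> k) k" using \<A>D(3)[OF A] \<sigma> by (intro assms) (auto dest: PiE_mem)
    qed
    then show "sc (\<Prod>k\<in>A. u (\<sigma> k) k) (x A) = sc (\<Prod>k\<in>A. v (\<sigma> k) k) (x A)" by simp
  qed
  then show ?thesis by simp
qed

lemma P_local:
  assumes "\<And>k. k \<in> {1..n} \<Longrightarrow> y k = z k"
  shows "P y = P z"
  unfolding diag[symmetric] by (rule L_local) (rule assms)

lemma continuous_on_L:
  assumes "\<And>j k. continuous_on S (\<lambda>z. f z j k)"
  shows "continuous_on S (\<lambda>z. L (f z))"
proof -
  have "L u = (1 / fact m) *\<^sub>R (\<Sum>A\<in>\<A>. \<Sum>\<sigma>\<in>{\<sigma>\<in>PiE A (\<lambda>_. {1..m}). bij_betw \<sigma> A {1..m}}. sc (\<Prod>k\<in>A. u (\<sigma> k) k) (x A))" for u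
    unfolding L_coefficients[symmetric] by simp
  then show ?thesis by (simp only:) (intro continuous_intros assms)
qed

lemma continuous_on_P:
  assumes "\<And>k. continuous_on S (\<lambda>z. f z k)"
  shows "continuous_on S (\<lambda>z. P (f z))"
  unfolding diag[symmetric] by (rule continuous_on_L) (rule assms)

lemma L_homogeneous: "L (\<lambda>j k. u j k * c) = sc (c ^ m) (L u)"
proof -
  have "fact m *\<^sub>R L (\<lambda>j k. u j k * c) = fact m *\<^sub>R sc (c ^ m) (L u)"
    unfolding sc_scaleR[symmetric] L_coefficients sc_sum_right sc_mult[symmetric]
  proof (rule sum.cong[OF refl], rule sum.cong[OF refl])
    fix A \<sigma> assume "A \<in> \<A>"
    then show "sc (\<Prod>k\<in>A. u (\<sigma> k) k * c) (x A) = sc (c ^ m * (\<Prod>k\<in>A. u (\<sigma> k) k)) (x A)"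
      by (simp add: prod.distrib mult.commute)
  qed
  then show ?thesis by simp
qed

lemma P_homogeneous: "P (\<lambda>k. z k * c) = sc (c ^ m) (P z)"
  unfolding diag[symmetric] by (rule L_homogeneous)

lemma L_row_expand:
  assumes "j \<in> {1..m}"
  shows "L (u(j := r)) = (\<Sum>k\<in>{1..n}. sc (r k) (L (u(j := (\<lambda>i. if i = k then 1 else 0)))))"
proof -
  have "L (u(j := r)) = L (u(j := (\<lambda>i. \<Sum>k\<in>{1..n}. r k * (if i = k then 1 else 0))))"
    by (rule L_local) (simp add: if_distrib[of "\<lambda>y. _ * y"] cong: if_cong)
  also have "\<dots> = (\<Sum>k\<in>{1..n}. sc (r k) (L (u(j := (\<lambda>i. if i = k then 1 else 0)))))"
    by (rule L_row_sum[OF assms]) simp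
  finally show ?thesis .
qed

lemma L_affine:
  assumes "q \<in> {1..m} \<times> {1..n}"
  shows "\<exists>a b. \<forall>t. L (\<lambda>j k. (w(q := t)) (j, k)) = a + sc t b"
proof -
  obtain j k where q: "q = (j, k)" "j \<in> {1..m}" using assms by auto
  let ?u = "\<lambda>i l. w (i, l)"
  have "L (\<lambda>i l. (w(q := t)) (i, l)) =
     sc 1 (L (?u(j := (\<lambda>l. if l = k then 0 else w (j, l))))) + sc t (L (?u(j := (\<lambda>l. if l = k then 1 else 0))))" for t
    unfolding L_row[OF q(2), symmetric] q(1) by (rule arg_cong[where f = L]) (auto simp: fun_eq_iff)
  then show ?thesis by blast
qed

text \<open>Tetrahedrality: a monomial contains the coordinate k at most once, so the sets A
  containing k give the linear part and the others the constant.\<close>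

lemma P_affine: "\<exists>a b. \<forall>t. P (z(k := t)) = a + sc t b"
proof -
  have "sc (\<Prod>i\<in>A. (z(k := t)) i) (x A) =
      (if k \<in> A then 0 else sc (\<Prod>i\<in>A. z i) (x A)) + sc t (if k \<in> A then sc (\<Prod>i\<in>A - {k}. z i) (x A) else 0)"
    if "A \<in> \<A>" for A t
  proof (cases "k \<in> A")
    case True
    have "(\<Prod>i\<in>A. (z(k := t)) i) = (z(k := t)) k * (\<Prod>i\<in>A - {k}. (z(k := t)) i)"
      using True \<A>D(1)[OF that] by (rule prod.remove[rotated])
    also have "(\<Prod>i\<in>A - {k}. (z(k := t)) i) = (\<Prod>i\<in>A - {k}. z i)" by (rule prod.cong) auto
    finally show ?thesis using True by (simp add: sc_mult)
  next
    case False
    then have "(\<Prod>i\<in>A. (z(k := t)) i) = (\<Prod>i\<in>A. z i)" by (intro prod.cong) auto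
    then show ?thesis using False by simp
  qed
  then have "P (z(k := t)) = (\<Sum>A\<in>\<A>. if k \<in> A then 0 else sc (\<Prod>i\<in>A. z i) (x A)) +
      sc t (\<Sum>A\<in>\<A>. if k \<in> A then sc (\<Prod>i\<in>A - {k}. z i) (x A) else 0)" for t
    by (simp only: tetra_poly_def sum.distrib sc_sum_right cong: sum.cong)
  then show ?thesis by blast
qed

lemma polarization_moment:
  assumes "p \<ge> 1"
  shows "norm (L u) powr p \<le> (1 / fact m) powr p *
     savg {1..m} (\<lambda>\<theta>. norm (P (\<lambda>k. \<Sum>j\<in>{1..m}. of_real (\<theta> j) * u j k)) powr p)"
proof -
  let ?S = "savg {1..m} (\<lambda>\<theta>. (\<Prod>j\<in>{1..m}. \<theta> j) *\<^sub>R P (\<lambda>k. \<Sum>j\<in>{1..m}. of_real (\<theta> j) * u j k))"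
  have "L u = (1 / fact m) *\<^sub>R ?S" unfolding polarization[symmetric] by simp
  then have "norm (L u) powr p = (1 / fact m) powr p * norm ?S powr p"
    by (simp add: powr_mult powr_divide)
  also have "norm ?S powr p \<le> savg {1..m} (\<lambda>\<theta>. norm ((\<Prod>j\<in>{1..m}. \<theta> j) *\<^sub>R P (\<lambda>k. \<Sum>j\<in>{1..m}. of_real (\<theta> j) * u j k)) powr p)"
    by (rule norm_savg_powr_le[OF assms]) simp
  also have "\<dots> = savg {1..m} (\<lambda>\<theta>. norm (P (\<lambda>k. \<Sum>j\<in>{1..m}. of_real (\<theta> j) * u j k)) powr p)"
  proof (rule savg_cong)
    fix \<theta> :: "nat \<Rightarrow> real" assume "\<And>k. \<theta> k = 1 \<or> \<theta> k = -1"
    then have "\<bar>\<theta> j\<bar> = 1" for j by (metis abs_1 abs_minus)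
    then have "\<bar>\<Prod>j\<in>{1..m}. \<theta> j\<bar> = 1" by (simp add: abs_prod)
    then show "norm ((\<Prod>j\<in>{1..m}. \<theta> j) *\<^sub>R P (\<lambda>k. \<Sum>j\<in>{1..m}. of_real (\<theta> j) * u j k)) powr p =
      norm (P (\<lambda>k. \<Sum>j\<in>{1..m}. of_real (\<theta> j) * u j k)) powr p" by simp
  qed
  finally show ?thesis by simp
qed

lemma colouring_moment:
  assumes "p \<ge> 1" "m > 0" "\<And>k j. k \<in> {1..n} \<Longrightarrow> j \<in> {1..m} \<Longrightarrow> (\<Sum>i\<in>{1..m}. g k j i) = s k"
  shows "norm (P s) powr p \<le> (real m ^ m) powr p / real m ^ n *
     (\<Sum>\<tau>\<in>PiE {1..n} (\<lambda>_. {1..m}). norm (L (\<lambda>j k. g k j (\<tau> k))) powr p)"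
proof -
  let ?T = "PiE {1..n} (\<lambda>_. {1..m})"
  let ?N = "\<lambda>\<tau>. norm (L (\<lambda>j k. g k j (\<tau> k)))"
  have cT: "real (card ?T) = real m ^ n" by (simp add: card_PiE)
  have "P s = (real m ^ m / real m ^ n) *\<^sub>R (\<Sum>\<tau>\<in>?T. L (\<lambda>j k. g k j (\<tau> k)))"
    using assms(2) by (simp only: sum_L_colourings[OF assms(3,2)] scaleR_scaleR) simp
  then have "norm (P s) \<le> (real m ^ m / real m ^ n) * (\<Sum>\<tau>\<in>?T. ?N \<tau>)"
    by (simp add: divide_right_mono mult_left_mono norm_sum)
  also have "\<dots> = real m ^ m * ((\<Sum>\<tau>\<in>?T. ?N \<tau>) / card ?T)" by (simp add: cT del: One_nat_def)
  finally have "norm (P s) powr p \<le> (real m ^ m * ((\<Sum>\<tau>\<in>?T. ?N \<tau>) / card ?T)) powr p"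
    using assms(1) by (intro powr_mono2) auto
  also have "\<dots> = (real m ^ m) powr p * ((\<Sum>\<tau>\<in>?T. ?N \<tau>) / card ?T) powr p"
    by (rule powr_mult)
  also have "\<dots> \<le> (real m ^ m) powr p * ((\<Sum>\<tau>\<in>?T. ?N \<tau> powr p) / card ?T)"
    using assms(1,2) by (intro mult_left_mono average_powr_le) (auto intro!: finite_PiE simp: PiE_eq_empty_iff)
  finally show ?thesis by (simp add: cT del: One_nat_def)
qed

definition SP :: "real \<Rightarrow> real" where
  "SP p = savg {1..n} (\<lambda>e. norm (P (\<lambda>k. of_real (e k))) powr p)"

definition SL :: "real \<Rightarrow> real" where
  "SL p = savg ({1..m} \<times> {1..n}) (\<lambda>e. norm (L (\<lambda>j k. of_real (e (j, k)))) powr p)"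

text \<open>The link between the other two sign moments: exchanged with \<open>SL\<close> by
  polarization and cyclic shifts, it is up to normalization the moment of P under products of
  \<open>nsum_law m\<close>, which is compared with \<open>SP\<close>.\<close>

definition SS :: "real \<Rightarrow> real" where
  "SS p = savg ({1..m} \<times> {1..n}) (\<lambda>e. norm (P (\<lambda>k. \<Sum>j\<in>{1..m}. of_real (e (j, k)))) powr p)"

text \<open>The signs \<theta> of the polarization formula multiply whole rows of the sign matrix
  and are absorbed by its symmetry, so averaging over them is harmless.\<close>

lemma SL_le_SS:
  assumes "p \<ge> 1"
  shows "SL p \<le> (1 / fact m) powr p * SS p"
proof -
  let ?J = "{1..m} \<times> {1..n}"
  let ?f = "\<lambda>e :: nat \<times> nat \<Rightarrow> real. norm (P (\<lambda>k. \<Sum>j\<in>{1..m}. of_real (e (j, k)))) powr p"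
  have "SL p \<le> savg ?J (\<lambda>e. (1 / fact m) powr p * savg {1..m} (\<lambda>\<theta>. ?f (\<lambda>q. \<theta> (fst q) * e q)))"
    unfolding SL_def
  proof (rule savg_mono)
    fix e :: "nat \<times> nat \<Rightarrow> real"
    show "norm (L (\<lambda>j k. of_real (e (j, k)))) powr p \<le> (1 / fact m) powr p * savg {1..m} (\<lambda>\<theta>. ?f (\<lambda>q. \<theta> (fst q) * e q))"
      using polarization_moment[OF assms, of "\<lambda>j k. of_real (e (j, k))"] by simp
  qed
  also have "\<dots> = (1 / fact m) powr p * savg {1..m} (\<lambda>\<theta>. savg ?J (\<lambda>e. ?f (\<lambda>q. \<theta> (fst q) * e q)))"
    by (simp only: savg_cmult) (rule arg_cong[where f = "\<lambda>a. (1 / fact m) powr p * a"], rule savg_swap)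
  also have "savg {1..m} (\<lambda>\<theta>. savg ?J (\<lambda>e. ?f (\<lambda>q. \<theta> (fst q) * e q))) = savg {1..m} (\<lambda>\<theta>. SS p)"
    unfolding SS_def
  proof (rule savg_cong, rule savg_flip)
    show "local_on ?J ?f"
      by (intro local_onI arg_cong[where f = "\<lambda>y. norm y powr p"] P_local sum.cong refl) auto
  qed auto
  finally show ?thesis by simp
qed

text \<open>For each row j, running through all shifts recovers the full column sum, the hypothesis
  of the colouring identity. For fixed \<tau> the shifts only permute the entries within each column
  of the sign matrix, so every \<tau> yields the same moment \<open>SL p\<close>.\<close>

lemma SS_le_SL:
  assumes "p \<ge> 1" "m > 0"
  shows "SS p \<le> (real m ^ m) powr p * SL p"
proof -
  let ?J = "{1..m} \<times> {1..n}" and ?T = "PiE {1..n} (\<lambda>_. {1..m})"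
  let ?f = "\<lambda>e :: nat \<times> nat \<Rightarrow> real. norm (L (\<lambda>j k. of_real (e (j, k)))) powr p"
  \<comment> \<open>Addition modulo m with representatives 1, ..., m instead of 0, ..., m - 1; it is
    injective in either argument.\<close>
  define sh where "sh j t = (if j + t \<le> m then j + t else j + t - m)" for j t :: nat
  have sh_in: "sh j t \<in> {1..m}" if "j \<in> {1..m}" "t \<in> {1..m}" for j t
    using that by (auto simp: sh_def)
  have sh_inj: "inj_on (sh j) {1..m}" "inj_on (\<lambda>j. sh j t) {1..m}" if "j \<in> {1..m}" "t \<in> {1..m}" for j t
    using that by (auto simp: sh_def inj_on_def split: if_splits)
  have sum_sh: "(\<Sum>i\<in>{1..m}. of_real (e (sh j i, k)) :: complex) = (\<Sum>j\<in>{1..m}. of_real (e (j, k)))"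
    if j: "j \<in> {1..m}" for j k and e :: "nat \<times> nat \<Rightarrow> real"
  proof -
    have "sh j ` {1..m} = {1..m}"
      using sh_in[OF j] sh_inj(1)[OF j j] by (intro endo_inj_surj) auto
    then have "bij_betw (sh j) {1..m} {1..m}" using sh_inj(1)[OF j j] by (simp add: bij_betw_def)
    then show ?thesis by (rule sum.reindex_bij_betw)
  qed
  have perm: "savg ?J (\<lambda>e. norm (L (\<lambda>j k. of_real (e (sh j (\<tau> k), k)))) powr p) = SL p" if \<tau>: "\<tau> \<in> ?T" for \<tau>
  proof -
    define \<pi> where "\<pi> q = (if q \<in> ?J then (sh (fst q) (\<tau> (snd q)), snd q) else q)" for q
    have \<tau>': "\<tau> k \<in> {1..m}" if "k \<in> {1..n}" for k using \<tau> that by (rule PiE_mem)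
    have "inj_on \<pi> ?J"
    proof (rule inj_onI)
      fix q q' assume q: "q \<in> ?J" "q' \<in> ?J" and eq: "\<pi> q = \<pi> q'"
      from eq have s: "snd q = snd q'" and f: "sh (fst q) (\<tau> (snd q)) = sh (fst q') (\<tau> (snd q))"
        using q by (auto simp: \<pi>_def)
      have "\<tau> (snd q) \<in> {1..m}" using q \<tau>' by auto
      from inj_onD[OF sh_inj(2)[OF this this] f] q s show "q = q'" by (auto intro: prod_eqI)
    qed
    moreover have "\<pi> ` ?J \<subseteq> ?J"
    proof
      fix q assume "q \<in> \<pi> ` ?J"
      then obtain j k where jk: "j \<in> {1..m}" "k \<in> {1..n}" "q = (sh j (\<tau> k), k)" by (auto simp: \<pi>_def)
      then show "q \<in> ?J" using sh_in[OF jk(1) \<tau>'[OF jk(2)]] by simp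
    qed
    ultimately have "bij_betw \<pi> ?J ?J" by (simp add: bij_betw_def endo_inj_surj)
    then have "\<pi> permutes ?J" by (rule bij_imp_permutes) (simp only: \<pi>_def if_False)
    then have "savg ?J (\<lambda>e. ?f (\<lambda>q. e (\<pi> q))) = savg ?J ?f" by (intro savg_permute) auto
    moreover have "?f (\<lambda>q. e (\<pi> q)) = norm (L (\<lambda>j k. of_real (e (sh j (\<tau> k), k)))) powr p" for e
      by (intro arg_cong[where f = "\<lambda>y. norm y powr p"] L_local) (simp add: \<pi>_def)
    ultimately show ?thesis by (simp add: SL_def)
  qed
  have "SS p \<le> savg ?J (\<lambda>e. (real m ^ m) powr p / real m ^ n *
     (\<Sum>\<tau>\<in>?T. norm (L (\<lambda>j k. of_real (e (sh j (\<tau> k), k)))) powr p))"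
    unfolding SS_def
  proof (rule savg_mono)
    fix e :: "nat \<times> nat \<Rightarrow> real"
    show "norm (P (\<lambda>k. \<Sum>j\<in>{1..m}. of_real (e (j, k)))) powr p \<le> (real m ^ m) powr p / real m ^ n *
     (\<Sum>\<tau>\<in>?T. norm (L (\<lambda>j k. of_real (e (sh j (\<tau> k), k)))) powr p)"
      by (rule colouring_moment[OF assms, of "\<lambda>k j i. of_real (e (sh j i, k))"]) (rule sum_sh)
  qed
  also have "\<dots> = (real m ^ m) powr p / real m ^ n * (\<Sum>\<tau>\<in>?T. SL p)"
    by (simp only: savg_cmult savg_sum perm cong: sum.cong)
  also have "\<dots> = (real m ^ m) powr p * SL p" using assms(2) by (simp add: card_PiE)
  finally show ?thesis .
qed

text \<open>\<open>Q \<tau>\<close> is L with the coordinates distributed over the rows by colour: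
  linear in each of the m classes, hence dominated by signs at cost K^m. At signs, polarization
  leads back from \<open>Q \<tau>\<close> to P. Averaging over \<tau> contributes m^m and
  polarization 1/m!.\<close>

lemma P_upper:
  assumes "lform_moment_bound \<nu> p K TYPE(nat)" "borel_prob \<nu>" "K \<ge> 0" "1 \<le> p" "m > 0"
  shows "(\<integral>\<^sup>+z. ennreal (norm (P z) powr p) \<partial>PiM {1..n} (\<lambda>_. \<nu>))
     \<le> ennreal ((real m ^ m / fact m) powr p * K ^ m * SP p)"
proof -
  let ?I = "{1..n}" and ?T = "PiE {1..n} (\<lambda>_. {1..m})" and ?c = "(real m ^ m) powr p / real m ^ n"
  define Q where "Q \<tau> z = L (\<lambda>j k. if \<tau> k = j then z k else 0)" for \<tau> :: "nat \<Rightarrow> nat" and z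
  have Qcont: "continuous_on UNIV (Q \<tau>)" for \<tau>
    unfolding Q_def
  proof (rule continuous_on_L)
    fix j k show "continuous_on UNIV (\<lambda>z. if \<tau> k = j then z k else 0 :: complex)"
      by (cases "\<tau> k = j") (simp_all add: continuous_on_product_coordinates)
  qed
  have Qloc: "local_on ?I (Q \<tau>)" for \<tau>
    unfolding Q_def by (intro local_onI L_local) simp
  have "ennreal (norm (P z) powr p) \<le> ennreal ?c * (\<Sum>\<tau>\<in>?T. ennreal (norm (Q \<tau> z) powr p))" for z
  proof -
    have "norm (P z) powr p \<le> ?c * (\<Sum>\<tau>\<in>?T. norm (Q \<tau> z) powr p)"
      unfolding Q_def
      by (rule colouring_moment[OF assms(4,5), of "\<lambda>k j i. if i = j then z k else 0"]) simp
    then have "ennreal (norm (P z) powr p) \<le> ennreal (?c * (\<Sum>\<tau>\<in>?T. norm (Q \<tau> z) powr p))" by (rule ennreal_leI)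
    also have "\<dots> = ennreal ?c * ennreal (\<Sum>\<tau>\<in>?T. norm (Q \<tau> z) powr p)"
      by (intro ennreal_mult sum_nonneg) auto
    also have "ennreal (\<Sum>\<tau>\<in>?T. norm (Q \<tau> z) powr p) = (\<Sum>\<tau>\<in>?T. ennreal (norm (Q \<tau> z) powr p))"
      by (rule sum_ennreal[symmetric]) simp
    finally show ?thesis .
  qed
  then have "(\<integral>\<^sup>+z. ennreal (norm (P z) powr p) \<partial>PiM ?I (\<lambda>_. \<nu>)) \<le>
      (\<integral>\<^sup>+z. ennreal ?c * (\<Sum>\<tau>\<in>?T. ennreal (norm (Q \<tau> z) powr p)) \<partial>PiM ?I (\<lambda>_. \<nu>))"
    by (intro nn_integral_mono)
  also have "\<dots> = ennreal ?c * (\<Sum>\<tau>\<in>?T. \<integral>\<^sup>+z. ennreal (norm (Q \<tau> z) powr p) \<partial>PiM ?I (\<lambda>_. \<nu>))"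
  proof -
    have m: "(\<lambda>z. norm (Q \<tau> z) powr p) \<in> borel_measurable (PiM ?I (\<lambda>_. \<nu>))" for \<tau>
      using assms(4) borel_probD(2)[OF assms(2)]
      by (intro measurable_local_continuous[where I = ?I] continuous_on_norm_powr Qcont
          local_onI arg_cong[where f = "\<lambda>y. norm y powr p"] local_onD[OF Qloc]) auto
    then have m': "(\<lambda>z. ennreal (norm (Q \<tau> z) powr p)) \<in> borel_measurable (PiM ?I (\<lambda>_. \<nu>))" for \<tau>
      by (rule measurable_compose[OF _ measurable_ennreal])
    show ?thesis
      by (subst nn_integral_cmult, intro borel_measurable_sum m', subst nn_integral_sum, rule m', rule refl)
  qed
  also have "\<dots> \<le> ennreal ?c * (\<Sum>\<tau>\<in>?T. ennreal (K ^ m * ((1 / fact m) powr p * SP p)))"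
  proof (intro mult_left_mono sum_mono)
    fix \<tau> assume \<tau>: "\<tau> \<in> ?T"
    have "(\<integral>\<^sup>+z. ennreal (norm (Q \<tau> z) powr p) \<partial>PiM ?I (\<lambda>_. \<nu>)) \<le>
        ennreal (K ^ card {1..m} * savg ?I (\<lambda>e. norm (Q \<tau> (\<lambda>k. of_real (e k))) powr p))"
    proof (rule upper_moment[OF assms(1-4) _ _ _ Qcont Qloc])
      show "\<tau> ` ?I \<subseteq> {1..m}" using \<tau> by (auto dest: PiE_mem)
    next
      fix j and z :: "nat \<Rightarrow> complex" assume j: "j \<in> {1..m}"
      let ?B = "{k\<in>?I. \<tau> k = j}" and ?u = "\<lambda>i k. if \<tau> k = i then z k else 0"
      define Y where "Y k = L (?u(j := (\<lambda>i. if i = k then 1 else 0)))" for k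
      have "Q \<tau> (\<lambda>k. if k \<in> ?B then w k else z k) = (\<Sum>k\<in>?B. sc (w k) (Y k))" for w
      proof -
        \<comment> \<open>Row j carries only coordinates of colour j, all of which lie in the block,
          so no value of \<open>z\<close> survives in it; the other rows do not see
          \<open>w\<close>.\<close>
        have "Q \<tau> (\<lambda>k. if k \<in> ?B then w k else z k) = L (?u(j := (\<lambda>k. if k \<in> ?B then w k else 0)))"
          unfolding Q_def by (rule L_local) auto
        also have "\<dots> = (\<Sum>k\<in>?I. sc (if k \<in> ?B then w k else 0) (Y k))"
          unfolding Y_def by (rule L_row_expand[OF j])
        also have "\<dots> = (\<Sum>k\<in>?I. if \<tau> k = j then sc (w k) (Y k) else 0)"
          by (rule sum.cong) auto
        also have "\<dots> = (\<Sum>k\<in>?B. sc (w k) (Y k))"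
          by (rule sum.inter_filter[symmetric]) simp
        finally show ?thesis .
      qed
      then show "\<exists>Y. \<forall>w. Q \<tau> (\<lambda>k. if k \<in> ?B then w k else z k) = (\<Sum>k\<in>?B. sc (w k) (Y k))" by blast
    qed auto
    also have "savg ?I (\<lambda>e. norm (Q \<tau> (\<lambda>k. of_real (e k))) powr p) \<le> (1 / fact m) powr p * SP p"
    proof -
      let ?f = "\<lambda>e :: nat \<Rightarrow> real. norm (P (\<lambda>k. of_real (e k))) powr p"
      have "savg ?I (\<lambda>e. norm (Q \<tau> (\<lambda>k. of_real (e k))) powr p) \<le>
         savg ?I (\<lambda>e. (1 / fact m) powr p * savg {1..m} (\<lambda>\<theta>. ?f (\<lambda>k. \<theta> (\<tau> k) * e k)))"
      proof (rule savg_mono)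
        fix e :: "nat \<Rightarrow> real"
        \<comment> \<open>Column k has a single nonzero entry, in row \<tau> k; polarization thus
          merely multiplies the sign of k by the sign of its colour.\<close>
        have "P (\<lambda>k. \<Sum>j\<in>{1..m}. of_real (\<theta> j) * (if \<tau> k = j then of_real (e k) else 0)) = P (\<lambda>k. of_real (\<theta> (\<tau> k) * e k))" for \<theta>
        proof (rule P_local)
          fix k assume "k \<in> ?I"
          then have "\<tau> k \<in> {1..m}" using \<tau> by (auto dest: PiE_mem)
          then show "(\<Sum>j\<in>{1..m}. of_real (\<theta> j) * (if \<tau> k = j then of_real (e k) else 0)) = (of_real (\<theta> (\<tau> k) * e k) :: complex)"
            by (simp add: if_distrib[of "\<lambda>y. _ * y"] cong: if_cong)
        qed
        then show "norm (Q \<tau> (\<lambda>k. of_real (e k))) powr p \<le> (1 / fact m) powr p * savg {1..m} (\<lambda>\<theta>. ?f (\<lambda>k. \<theta> (\<tau> k) * e k))"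
          using polarization_moment[OF assms(4), of "\<lambda>j k. if \<tau> k = j then of_real (e k) else 0"]
          unfolding Q_def by simp
      qed
      also have "\<dots> = (1 / fact m) powr p * savg {1..m} (\<lambda>\<theta>. savg ?I (\<lambda>e. ?f (\<lambda>k. \<theta> (\<tau> k) * e k)))"
        by (simp only: savg_cmult) (rule arg_cong[where f = "\<lambda>a. (1 / fact m) powr p * a"], rule savg_swap)
      also have "savg {1..m} (\<lambda>\<theta>. savg ?I (\<lambda>e. ?f (\<lambda>k. \<theta> (\<tau> k) * e k))) = savg {1..m} (\<lambda>\<theta>. SP p)"
        unfolding SP_def
      proof (rule savg_cong, rule savg_flip)
        show "local_on ?I ?f"
          by (intro local_onI arg_cong[where f = "\<lambda>y. norm y powr p"] P_local) auto
      qed auto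
      finally show ?thesis by simp
    qed
    finally show "(\<integral>\<^sup>+z. ennreal (norm (Q \<tau> z) powr p) \<partial>PiM ?I (\<lambda>_. \<nu>)) \<le> ennreal (K ^ m * ((1 / fact m) powr p * SP p))"
      using assms(3) by (simp add: mult_left_mono ennreal_leI)
  qed simp
  also have "\<dots> = ennreal (?c * (real m ^ n * (K ^ m * ((1 / fact m) powr p * SP p))))"
  proof -
    let ?D = "K ^ m * ((1 / fact m) powr p * SP p)"
    have "0 \<le> SP p" unfolding SP_def by (intro savg_nonneg) auto
    then have D: "0 \<le> ?D" using assms(3) by simp
    then have "(\<Sum>\<tau>\<in>?T. ennreal ?D) = ennreal (\<Sum>\<tau>\<in>?T. ?D)" by (rule sum_ennreal)
    also have "(\<Sum>\<tau>\<in>?T. ?D) = real m ^ n * ?D" by (simp add: card_PiE del: One_nat_def)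
    finally show ?thesis using D by (simp only:) (intro ennreal_mult[symmetric], auto)
  qed
  also have "?c * (real m ^ n * (K ^ m * ((1 / fact m) powr p * SP p))) = (real m ^ m / fact m) powr p * K ^ m * SP p"
    using assms(5) by (simp add: powr_divide)
  finally show ?thesis .
qed

lemma L_upper:
  assumes "lform_moment_bound \<nu> p K TYPE(nat \<times> nat)" "borel_prob \<nu>" "K \<ge> 0" "1 \<le> p"
  shows "(\<integral>\<^sup>+w. ennreal (norm (L (\<lambda>j k. w (j, k))) powr p) \<partial>PiM ({1..m} \<times> {1..n}) (\<lambda>_. \<nu>)) \<le> ennreal (K ^ m * SL p)"
proof -
  let ?J = "{1..m} \<times> {1..n}" and ?F = "\<lambda>w. L (\<lambda>j k. w (j, k))"
  have "(\<integral>\<^sup>+w. ennreal (norm (?F w) powr p) \<partial>PiM ?J (\<lambda>_. \<nu>))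
     \<le> ennreal (K ^ card {1..m} * savg ?J (\<lambda>e. norm (?F (\<lambda>q. of_real (e q))) powr p))"
  proof (rule upper_moment[OF assms, where \<delta> = fst])
    show "continuous_on UNIV ?F" by (intro continuous_on_L continuous_on_product_coordinates)
    show "local_on ?J ?F" by (intro local_onI L_local) auto
  next
    fix j and z :: "nat \<times> nat \<Rightarrow> complex" assume j: "j \<in> {1..m}"
    let ?B = "{q\<in>?J. fst q = j}" and ?u = "\<lambda>i k. z (i, k)"
    define Y where "Y q = L (?u(j := (\<lambda>i. if i = snd q then 1 else 0)))" for q :: "nat \<times> nat"
    have "?F (\<lambda>q. if q \<in> ?B then w q else z q) = (\<Sum>q\<in>?B. sc (w q) (Y q))" for w
    proof -
      have "?F (\<lambda>q. if q \<in> ?B then w q else z q) = L (?u(j := (\<lambda>k. w (j, k))))"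
        using j by (intro L_local) auto
      also have "\<dots> = (\<Sum>k\<in>{1..n}. sc (w (j, k)) (Y (j, k)))"
        unfolding Y_def snd_conv by (rule L_row_expand[OF j])
      also have "\<dots> = (\<Sum>q\<in>?B. sc (w q) (Y q))"
        using j by (intro sum.reindex_bij_witness[where i = snd and j = "Pair j"]) auto
      finally show ?thesis .
    qed
    then show "\<exists>Y. \<forall>w. ?F (\<lambda>q. if q \<in> ?B then w q else z q) = (\<Sum>q\<in>?B. sc (w q) (Y q))" by blast
  qed auto
  then show ?thesis by (simp add: SL_def)
qed

text \<open>Replacing the law by signs of amplitude c is free, and homogeneity extracts |c|^m,
  independently of n.\<close>

lemma P_lower:
  assumes "symmetric_law \<nu>" "integrable \<nu> (\<lambda>z. z)" "h \<in> borel_measurable borel" "\<And>z. h z = 1 \<or> h z = (-1::real)" "1 \<le> p"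
  shows "ennreal ((cmod (\<integral>z. h z *\<^sub>R z \<partial>\<nu>) ^ m) powr p * SP p) \<le> (\<integral>\<^sup>+z. ennreal (norm (P z) powr p) \<partial>PiM {1..n} (\<lambda>_. \<nu>))"
proof -
  let ?c = "\<integral>z. h z *\<^sub>R z \<partial>\<nu>"
  have "ennreal (savg {1..n} (\<lambda>e. norm (P (\<lambda>k. of_real (e k) * ?c)) powr p)) \<le> (\<integral>\<^sup>+z. ennreal (norm (P z) powr p) \<partial>PiM {1..n} (\<lambda>_. \<nu>))"
    by (rule lower_moment[OF _ assms _ _ P_affine])
       (auto intro!: continuous_on_P continuous_on_product_coordinates local_onI P_local)
  moreover have "savg {1..n} (\<lambda>e. norm (P (\<lambda>k. of_real (e k) * ?c)) powr p) = (cmod ?c ^ m) powr p * SP p"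
    unfolding SP_def P_homogeneous norm_sc norm_power powr_mult by (rule savg_cmult)
  ultimately show ?thesis by simp
qed

lemma L_lower:
  assumes "symmetric_law \<nu>" "integrable \<nu> (\<lambda>z. z)" "h \<in> borel_measurable borel" "\<And>z. h z = 1 \<or> h z = (-1::real)" "1 \<le> p"
  shows "ennreal ((cmod (\<integral>z. h z *\<^sub>R z \<partial>\<nu>) ^ m) powr p * SL p)
     \<le> (\<integral>\<^sup>+w. ennreal (norm (L (\<lambda>j k. w (j, k))) powr p) \<partial>PiM ({1..m} \<times> {1..n}) (\<lambda>_. \<nu>))"
proof -
  let ?c = "\<integral>z. h z *\<^sub>R z \<partial>\<nu>" and ?J = "{1..m} \<times> {1..n}"
  have "ennreal (savg ?J (\<lambda>e. norm (L (\<lambda>j k. of_real (e (j, k)) * ?c)) powr p)) \<le>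
     (\<integral>\<^sup>+w. ennreal (norm (L (\<lambda>j k. w (j, k))) powr p) \<partial>PiM ?J (\<lambda>_. \<nu>))"
  proof (rule lower_moment[OF _ assms, of ?J "\<lambda>w. L (\<lambda>j k. w (j, k))"])
    show "\<exists>a b. \<forall>t. L (\<lambda>j k. (w(q := t)) (j, k)) = a + sc t b" if "q \<in> ?J" for q w
      by (rule L_affine[OF that])
  qed (auto intro!: continuous_on_L continuous_on_product_coordinates local_onI L_local)
  moreover have "savg ?J (\<lambda>e. norm (L (\<lambda>j k. of_real (e (j, k)) * ?c)) powr p) = (cmod ?c ^ m) powr p * SL p"
    unfolding SL_def L_homogeneous norm_sc norm_power powr_mult by (rule savg_cmult)
  ultimately show ?thesis by simp
qed

end

section \<open>The law of the normalized sum of m signs, with bounds uniform in m\<close>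

section \<open>Normalized Rademacher sums\<close>

lemma savg_image:
  assumes "bij_betw \<pi> I J" "local_on I f"
  shows "savg J (\<lambda>e. f (\<lambda>k. e (\<pi> k))) = savg I f"
proof -
  have inj: "inj_on \<pi> I" and J: "J = \<pi> ` I" using assms(1) by (auto simp: bij_betw_def)
  have "(\<Sum>T\<in>Pow J. f (\<lambda>k. if \<pi> k \<in> T then -1 else 1)) = (\<Sum>T\<in>Pow I. f (\<lambda>k. if k \<in> T then -1 else 1))"
  proof (rule sum.reindex_cong[of "(`) \<pi>"])
    show "inj_on ((`) \<pi>) (Pow I)" using inj by (rule inj_on_image_Pow)
    show "Pow J = (`) \<pi> ` Pow I" unfolding J by (rule image_Pow_surj[symmetric]) simp
    show "f (\<lambda>k. if \<pi> k \<in> \<pi> ` T then -1 else 1) = f (\<lambda>k. if k \<in> T then -1 else 1)" if "T \<in> Pow I" for T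
      using that inj by (intro local_onD[OF assms(2)]) (auto simp: inj_on_image_mem_iff)
  qed
  then show ?thesis using bij_betw_same_card[OF assms(1)] by (simp add: savg_def)
qed

definition nsum :: "nat \<Rightarrow> (nat \<Rightarrow> real) \<Rightarrow> real" where
  "nsum m e = (\<Sum>j\<in>{1..m}. e j) / sqrt (real m)"

text \<open>Realized on a uniformly random subset of {1..m}, the coding of sign vectors used by
  \<open>savg\<close>, so that its integrals are sign averages.\<close>

definition nsum_law :: "nat \<Rightarrow> complex measure" where
  "nsum_law m = distr (measure_pmf (pmf_of_set (Pow {1..m}))) borel (\<lambda>T. of_real (nsum m (\<lambda>k. if k \<in> T then -1 else 1)))"

lemma borel_prob_nsum_law: "borel_prob (nsum_law m)"
  unfolding borel_prob_def nsum_law_def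
  by (auto intro!: prob_space.prob_space_distr measure_pmf.prob_space_axioms)

lemma nn_integral_nsum_law:
  fixes g :: "complex \<Rightarrow> real"
  assumes "g \<in> borel_measurable borel" "\<And>z. 0 \<le> g z"
  shows "(\<integral>\<^sup>+z. ennreal (g z) \<partial>nsum_law m) = ennreal (savg {1..m} (\<lambda>e. g (of_real (nsum m e))))"
proof -
  have ne: "finite (Pow {1..m})" "Pow {1..m} \<noteq> {}" by auto
  have "(\<integral>\<^sup>+z. ennreal (g z) \<partial>nsum_law m) =
      (\<Sum>T\<in>Pow {1..m}. ennreal (g (of_real (nsum m (\<lambda>k. if k \<in> T then -1 else 1))))) / of_nat (card (Pow {1..m}))"
    unfolding nsum_law_def using assms(1) ne
    by (subst nn_integral_distr) (auto simp: nn_integral_pmf_of_set)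
  also have "\<dots> = ennreal (\<Sum>T\<in>Pow {1..m}. g (of_real (nsum m (\<lambda>k. if k \<in> T then -1 else 1)))) / ennreal (2 ^ m)"
    using assms(2) by (simp add: card_Pow ennreal_power flip: ennreal_numeral)
  also have "\<dots> = ennreal (savg {1..m} (\<lambda>e. g (of_real (nsum m e))))"
    using assms(2) by (subst divide_ennreal) (auto simp: savg_def sum_nonneg)
  finally show ?thesis .
qed

lemma local_on_nsum: "local_on {1..m} (nsum m)"
  unfolding nsum_def by (intro local_onI arg_cong2[where f = "(/)"] sum.cong refl) auto

lemma symmetric_law_nsum_law: "symmetric_law (nsum_law m)"
  unfolding symmetric_law_def
proof (intro conjI borel_prob_nsum_law measure_eqI)
  have sets: "sets (nsum_law m) = sets borel" using borel_prob_nsum_law borel_probD by blast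
  have m: "uminus \<in> measurable (nsum_law m) (borel :: complex measure)" "(\<lambda>z. z) \<in> measurable (nsum_law m) (borel :: complex measure)"
    using sets by (auto cong: measurable_cong_sets)
  fix A assume "A \<in> sets (distr (nsum_law m) borel (uminus :: complex \<Rightarrow> complex))"
  then have A[measurable]: "A \<in> sets borel" by simp
  have "emeasure (distr (nsum_law m) borel uminus) A = (\<integral>\<^sup>+z. indicator A z \<partial>distr (nsum_law m) borel uminus)"
    by simp
  also have "\<dots> = (\<integral>\<^sup>+z. ennreal (indicator A (- z)) \<partial>nsum_law m)"
    using m by (subst nn_integral_distr) (auto simp: ennreal_indicator)
  also have "\<dots> = ennreal (savg {1..m} (\<lambda>e. indicator A (- of_real (nsum m e))))"
    by (rule nn_integral_nsum_law) auto
  also have "(\<lambda>e. indicator A (- of_real (nsum m e)) :: real) = (\<lambda>e. indicator A (of_real (nsum m (\<lambda>k. -1 * e k))))"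
    by (simp add: nsum_def sum_negf)
  also have "savg {1..m} \<dots> = savg {1..m} (\<lambda>e. indicator A (of_real (nsum m e)))"
  proof (rule savg_flip[where d = "\<lambda>_. -1"])
    show "local_on {1..m} (\<lambda>e. indicator A (complex_of_real (nsum m e)) :: real)"
      by (intro local_onI arg_cong[where f = "\<lambda>y. indicator A (complex_of_real y)"] local_onD[OF local_on_nsum])
  qed auto
  also have "ennreal \<dots> = (\<integral>\<^sup>+z. ennreal (indicator A z) \<partial>nsum_law m)"
    by (rule nn_integral_nsum_law[symmetric]) auto
  also have "\<dots> = (\<integral>\<^sup>+z. indicator A z \<partial>distr (nsum_law m) borel (\<lambda>z. z))"
    using m by (subst nn_integral_distr) (auto simp: ennreal_indicator)
  also have "\<dots> = emeasure (distr (nsum_law m) borel (\<lambda>z. z)) A" by simp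
  finally show "emeasure (distr (nsum_law m) borel uminus) A = emeasure (distr (nsum_law m) borel (\<lambda>z. z)) A" .
qed simp

text \<open>Independent normalized sums are read off one sign matrix with m rows, column k producing
  coordinate k. In the induction the new column is split off and reindexed by {1..m}.\<close>

lemma nn_integral_PiM_nsum_law:
  fixes g :: "('i::countable \<Rightarrow> complex) \<Rightarrow> real"
  assumes "finite I" "continuous_on UNIV g" "local_on I g" "\<And>z. 0 \<le> g z"
  shows "(\<integral>\<^sup>+z. ennreal (g z) \<partial>PiM I (\<lambda>_. nsum_law m)) =
     ennreal (savg ({1..m} \<times> I) (\<lambda>e. g (\<lambda>k. of_real (nsum m (\<lambda>j. e (j, k))))))"
  using assms
proof (induction I arbitrary: g rule: finite_induct)
  case empty
  have "g (\<lambda>_. undefined) = g (\<lambda>k. of_real (nsum m (\<lambda>j. 1)))" using empty by (auto simp: local_on_def)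
  then show ?case by (simp add: PiM_empty nn_integral_count_space_finite)
next
  case (insert i I)
  interpret product_sigma_finite "\<lambda>_::'i. nsum_law m"
    by (rule product_sigma_finite_borel_prob) (rule borel_prob_nsum_law)
  have sets: "sets (nsum_law m) = sets borel" using borel_prob_nsum_law borel_probD by blast
  note cont = continuous_on_update(1)[OF insert.prems(1), of i] and cont' = continuous_on_update(2)[OF insert.prems(1), of _ i]
  define G where "G x = savg {1..m} (\<lambda>e. g (x(i := of_real (nsum m e))))" for x
  have "(\<integral>\<^sup>+z. ennreal (g z) \<partial>PiM (insert i I) (\<lambda>_. nsum_law m)) =
     (\<integral>\<^sup>+x. \<integral>\<^sup>+y. ennreal (g (x(i := y))) \<partial>nsum_law m \<partial>PiM I (\<lambda>_. nsum_law m))"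
    using insert by (intro product_nn_integral_insert measurable_compose[OF measurable_local_continuous measurable_ennreal] sets) auto
  also have "\<dots> = (\<integral>\<^sup>+x. ennreal (G x) \<partial>PiM I (\<lambda>_. nsum_law m))"
    unfolding G_def by (intro nn_integral_cong nn_integral_nsum_law borel_measurable_continuous_onI cont' insert.prems)
  also have "\<dots> = ennreal (savg ({1..m} \<times> I) (\<lambda>e. G (\<lambda>k. of_real (nsum m (\<lambda>j. e (j, k))))))"
  proof (rule insert.IH)
    show "continuous_on UNIV G" unfolding G_def savg_def by (intro continuous_intros cont)
    show "local_on I G" unfolding G_def
      by (intro local_onI arg_cong[where f = "savg _"] ext local_onD[OF insert.prems(2)]) auto
    show "0 \<le> G z" for z unfolding G_def by (intro savg_nonneg insert.prems)
  qed
  also have "savg ({1..m} \<times> I) (\<lambda>e. G (\<lambda>k. of_real (nsum m (\<lambda>j. e (j, k))))) =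
     savg ({1..m} \<times> insert i I) (\<lambda>e. g (\<lambda>k. of_real (nsum m (\<lambda>j. e (j, k)))))"
  proof -
    let ?A = "{1..m} \<times> I" and ?B = "{1..m} \<times> {i}"
    have "savg (?A \<union> ?B) (\<lambda>e. g (\<lambda>k. of_real (nsum m (\<lambda>j. e (j, k))))) =
        savg ?A (\<lambda>e. savg ?B (\<lambda>e'. g (\<lambda>k. of_real (nsum m (\<lambda>j. if (j, k) \<in> ?B then e' (j, k) else e (j, k))))))"
      using insert(1,2) by (intro savg_Un) auto
    also have "\<dots> = savg ?A (\<lambda>e. savg ?B (\<lambda>e'. g ((\<lambda>k. of_real (nsum m (\<lambda>j. e (j, k))))(i := of_real (nsum m (\<lambda>j. e' (j, i)))))))"
    proof (rule savg_cong, rule savg_cong, rule arg_cong[where f = g], rule ext)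
      fix e e' :: "nat \<times> 'i \<Rightarrow> real" and k
      have "nsum m (\<lambda>j. if (j, k) \<in> ?B then e' (j, k) else e (j, k)) = nsum m (\<lambda>j. if k = i then e' (j, i) else e (j, k))"
        by (rule local_onD[OF local_on_nsum]) auto
      then show "complex_of_real (nsum m (\<lambda>j. if (j, k) \<in> ?B then e' (j, k) else e (j, k))) =
         ((\<lambda>k. of_real (nsum m (\<lambda>j. e (j, k))))(i := of_real (nsum m (\<lambda>j. e' (j, i))))) k" by simp
    qed
    also have "\<dots> = savg ?A (\<lambda>e. G (\<lambda>k. of_real (nsum m (\<lambda>j. e (j, k)))))"
    proof (rule savg_cong)
      fix e :: "nat \<times> 'i \<Rightarrow> real"
      have "bij_betw (\<lambda>j. (j, i)) {1..m} ?B" by (rule bij_betwI[where g = fst]) auto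
      moreover have "local_on {1..m} (\<lambda>e'. g ((\<lambda>k. of_real (nsum m (\<lambda>j. e (j, k))))(i := of_real (nsum m e'))))"
        by (intro local_onI arg_cong[where f = "\<lambda>y. g ((\<lambda>k. of_real (nsum m (\<lambda>j. e (j, k))))(i := complex_of_real y))"]
            local_onD[OF local_on_nsum])
      ultimately show "savg ?B (\<lambda>e'. g ((\<lambda>k. of_real (nsum m (\<lambda>j. e (j, k))))(i := of_real (nsum m (\<lambda>j. e' (j, i)))))) =
         G (\<lambda>k. of_real (nsum m (\<lambda>j. e (j, k))))"
        unfolding G_def by (rule savg_image)
    qed
    finally have "savg (?A \<union> ?B) (\<lambda>e. g (\<lambda>k. of_real (nsum m (\<lambda>j. e (j, k))))) =
      savg ?A (\<lambda>e. G (\<lambda>k. of_real (nsum m (\<lambda>j. e (j, k)))))" .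
    moreover have "{1..m} \<times> insert i I = ?A \<union> ?B" by auto
    ultimately show ?thesis by simp
  qed
  finally show ?case .
qed

lemma savg_sum_square: "finite I \<Longrightarrow> savg I (\<lambda>e. (\<Sum>j\<in>I. e j)\<^sup>2) = real (card I)"
proof (induction I rule: finite_induct)
  case (insert k I)
  have "(\<Sum>j\<in>insert k I. (e(k := c)) j) = c + (\<Sum>j\<in>I. e j)" for e and c :: real
  proof -
    have "(\<Sum>j\<in>I. (e(k := c)) j) = (\<Sum>j\<in>I. e j)" using insert(2) by (intro sum.cong) auto
    then show ?thesis by (simp only: sum.insert[OF insert(1,2)]) simp
  qed
  then have "savg (insert k I) (\<lambda>e. (\<Sum>j\<in>insert k I. e j)\<^sup>2) =
     (1/2) * (savg I (\<lambda>e. (1 + (\<Sum>j\<in>I. e j))\<^sup>2) + savg I (\<lambda>e. (-1 + (\<Sum>j\<in>I. e j))\<^sup>2))"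
    by (simp only: savg_insert[OF insert(1,2)] real_scaleR_def)
  also have "\<dots> = (1/2) * savg I (\<lambda>e. 2 + 2 * (\<Sum>j\<in>I. e j)\<^sup>2)"
    unfolding savg_add[symmetric] by (rule arg_cong, rule savg_cong) (simp add: power2_eq_square algebra_simps)
  also have "\<dots> = 1 + savg I (\<lambda>e. (\<Sum>j\<in>I. e j)\<^sup>2)"
    using insert(1) by (simp add: savg_add savg_cmult)
  finally show ?case using insert by simp
qed simp

lemma savg_nsum_square:
  assumes "m > 0"
  shows "savg {1..m} (\<lambda>e. \<bar>nsum m e\<bar> powr 2) = 1"
proof -
  have "\<bar>nsum m e\<bar> powr 2 = (1 / real m) * (\<Sum>j\<in>{1..m}. e j)\<^sup>2" for e
    using assms by (cases "nsum m e = 0") (auto simp: nsum_def power_divide power2_eq_square[symmetric])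
  then show ?thesis using assms by (simp only: savg_cmult savg_sum_square finite_atLeastAtMost) simp
qed

lemma kahane_nsum:
  assumes "p \<ge> 1" "r \<ge> 2" "p \<le> r"
  shows "savg {1..m} (\<lambda>e. \<bar>nsum m e\<bar> powr r) powr (p / r)
       \<le> 2 * (2 * 3 powr r) powr ((r - p) / r) * savg {1..m} (\<lambda>e. \<bar>nsum m e\<bar> powr p)"
  using kahane_inequality[OF assms, of "{1..m}" "\<lambda>_. 1 / sqrt (real m)"]
  by (simp add: nsum_def sum_divide_distrib)

text \<open>The second moment is 1, and Kahane's inequality between 2 and s gives a bound that does
  not contain m.\<close>

lemma nsum_moment_le:
  assumes "s \<ge> 2" "m > 0"
  shows "savg {1..m} (\<lambda>e. \<bar>nsum m e\<bar> powr s) \<le> (2 * (2 * 3 powr s) powr ((s - 2) / s)) powr (s / 2)"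
proof -
  have 0: "0 \<le> savg {1..m} (\<lambda>e. \<bar>nsum m e\<bar> powr s)" by (intro savg_nonneg) auto
  have "savg {1..m} (\<lambda>e. \<bar>nsum m e\<bar> powr s) powr (2 / s) \<le> 2 * (2 * 3 powr s) powr ((s - 2) / s)"
    using kahane_nsum[of 2 s m] assms(1) unfolding savg_nsum_square[OF assms(2)] by simp
  then have "(savg {1..m} (\<lambda>e. \<bar>nsum m e\<bar> powr s) powr (2 / s)) powr (s / 2) \<le> (2 * (2 * 3 powr s) powr ((s - 2) / s)) powr (s / 2)"
    using assms by (intro powr_mono2) auto
  then show ?thesis using assms 0 by (simp add: powr_powr)
qed

text \<open>Kahane's inequality between 1 and 2 prevents the first moment from being small while the
  second is 1.\<close>

lemma nsum_abs_moment_ge: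
  assumes "m > 0"
  shows "1 / 12 \<le> savg {1..m} (\<lambda>e. \<bar>nsum m e\<bar>)"
proof -
  \<comment> \<open>Kahane's constant for these exponents is 2 * sqrt 18; rounding sqrt 18 up to 6
    produces the 12.\<close>
  have "(2 * 3 powr 2) powr (1 / 2) \<le> (6::real)"
  proof -
    have "(2 * 3 powr 2) powr (1 / 2) = sqrt (18::real)" by (simp add: powr_half_sqrt)
    also have "\<dots> \<le> sqrt (6\<^sup>2)" by (intro real_sqrt_le_mono) simp
    finally show ?thesis by simp
  qed
  moreover have "0 \<le> savg {1..m} (\<lambda>e. \<bar>nsum m e\<bar>)" by (intro savg_nonneg) auto
  moreover have "1 \<le> 2 * (2 * 3 powr 2) powr (1 / 2) * savg {1..m} (\<lambda>e. \<bar>nsum m e\<bar>)"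
    using kahane_nsum[of 1 2 m] unfolding savg_nsum_square[OF assms] by simp
  ultimately have "1 \<le> 2 * 6 * savg {1..m} (\<lambda>e. \<bar>nsum m e\<bar>)"
    by (smt (verit) mult_right_mono)
  then show ?thesis by simp
qed

lemma integral_nsum_law:
  fixes f :: "complex \<Rightarrow> complex"
  assumes "f \<in> borel_measurable borel"
  shows "(\<integral>z. f z \<partial>nsum_law m) = savg {1..m} (\<lambda>e. f (of_real (nsum m e)))"
proof -
  have ne: "finite (Pow {1..m})" "Pow {1..m} \<noteq> {}" by auto
  have "(\<integral>z. f z \<partial>nsum_law m) = (\<integral>T. f (of_real (nsum m (\<lambda>k. if k \<in> T then -1 else 1))) \<partial>measure_pmf (pmf_of_set (Pow {1..m})))"
    unfolding nsum_law_def using assms by (intro integral_distr) auto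
  also have "\<dots> = (\<Sum>T\<in>Pow {1..m}. pmf (pmf_of_set (Pow {1..m})) T *\<^sub>R f (of_real (nsum m (\<lambda>k. if k \<in> T then -1 else 1))))"
    using ne by (intro integral_measure_pmf) auto
  also have "\<dots> = savg {1..m} (\<lambda>e. f (of_real (nsum m e)))"
    unfolding savg_def scaleR_sum_right using ne by (intro sum.cong) (auto simp: card_Pow)
  finally show ?thesis .
qed

lemma integrable_nsum_law: "integrable (nsum_law m) (\<lambda>z. z)"
proof -
  have "finite (set_pmf (pmf_of_set (Pow {1..m})))" by (subst set_pmf_of_set) auto
  then show ?thesis
    unfolding nsum_law_def by (subst integrable_distr_eq) (auto intro!: integrable_measure_pmf_finite)
qed

text \<open>The value 1 on the boundary keeps the function in {-1, 1} everywhere, as the choice of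
  \<open>h\<close> demands.\<close>

definition sgn_re :: "complex \<Rightarrow> real" where "sgn_re z = (if Re z < 0 then -1 else 1)"
definition sgn_im :: "complex \<Rightarrow> real" where "sgn_im z = (if Im z < 0 then -1 else 1)"

lemma sgn_re_measurable: "sgn_re \<in> borel_measurable borel"
  and sgn_im_measurable: "sgn_im \<in> borel_measurable borel"
  unfolding sgn_re_def sgn_im_def by measurable

lemma cmod_mean_nsum_law:
  assumes "m > 0"
  shows "1 / 12 \<le> cmod (\<integral>z. sgn_re z *\<^sub>R z \<partial>nsum_law m)"
proof -
  have "(\<integral>z. sgn_re z *\<^sub>R z \<partial>nsum_law m) = savg {1..m} (\<lambda>e. sgn_re (of_real (nsum m e)) *\<^sub>R of_real (nsum m e))"
    using sgn_re_measurable by (intro integral_nsum_law) auto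
  also have "\<dots> = savg {1..m} (\<lambda>e. of_real \<bar>nsum m e\<bar>)"
    by (rule savg_cong) (auto simp: sgn_re_def scaleR_conv_of_real)
  also have "\<dots> = of_real (savg {1..m} (\<lambda>e. \<bar>nsum m e\<bar>))"
    unfolding savg_def by (simp add: scaleR_conv_of_real)
  finally show ?thesis using nsum_abs_moment_ge[OF assms] by simp
qed

text \<open>With the sign of the real part as \<open>h\<close> the mean has real part E |Re z|, and
  with the sign of the imaginary part it has imaginary part E |Im z|. If both means vanished, z
  would be 0 almost everywhere.\<close>

lemma ex_nonzero_mean:
  assumes "borel_prob \<mu>" "integrable \<mu> (\<lambda>z. z)" "\<not> (AE z in \<mu>. z = 0)"
  shows "\<exists>h\<in>borel_measurable borel. (\<forall>z. h z = 1 \<or> h z = (-1::real)) \<and> (\<integral>z. h z *\<^sub>R z \<partial>\<mu>) \<noteq> 0"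
proof (rule ccontr)
  assume no: "\<not> ?thesis"
  have sets[measurable_cong]: "sets \<mu> = sets borel" using assms(1) by (rule borel_probD)
  note sgn_re_measurable[measurable] sgn_im_measurable[measurable]
  have pm: "sgn_re z = 1 \<or> sgn_re z = -1" "sgn_im z = 1 \<or> sgn_im z = -1" for z
    by (auto simp: sgn_re_def sgn_im_def)
  then have z: "(\<integral>z. sgn_re z *\<^sub>R z \<partial>\<mu>) = 0" "(\<integral>z. sgn_im z *\<^sub>R z \<partial>\<mu>) = 0"
    using no sgn_re_measurable sgn_im_measurable by blast+
  have int: "integrable \<mu> (\<lambda>z. sgn_re z *\<^sub>R z)" "integrable \<mu> (\<lambda>z. sgn_im z *\<^sub>R z)"
    by (rule Bochner_Integration.integrable_bound[OF assms(2)]; auto simp: sgn_re_def sgn_im_def)+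
  have re: "Re (sgn_re z *\<^sub>R z) = \<bar>Re z\<bar>" and im: "Im (sgn_im z *\<^sub>R z) = \<bar>Im z\<bar>" for z
    by (auto simp: sgn_re_def sgn_im_def)
  have "(\<integral>z. \<bar>Re z\<bar> \<partial>\<mu>) = 0" "(\<integral>z. \<bar>Im z\<bar> \<partial>\<mu>) = 0"
    using integral_Re[OF int(1)] integral_Im[OF int(2)] unfolding z re im by simp_all
  moreover have "integrable \<mu> (\<lambda>z. \<bar>Re z\<bar>)" "integrable \<mu> (\<lambda>z. \<bar>Im z\<bar>)"
    using assms(2) by auto
  ultimately have "AE z in \<mu>. \<bar>Re z\<bar> = 0" "AE z in \<mu>. \<bar>Im z\<bar> = 0"
    by (simp_all add: integral_nonneg_eq_0_iff_AE)
  then have "AE z in \<mu>. z = 0" by eventually_elim (simp add: complex_eq_iff)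
  then show False using assms(3) by simp
qed

section \<open>Combining the bounds and collecting the constants\<close>

section \<open>The comparison of moments\<close>

context sym_poly
begin

lemma nsum_law_moment:
  assumes "1 \<le> p" "m > 0"
  shows "(\<integral>\<^sup>+z. ennreal (norm (P z) powr p) \<partial>PiM {1..n} (\<lambda>_. nsum_law m)) =
    ennreal (((1 / sqrt (real m)) ^ m) powr p * SS p)"
proof -
  have "(\<integral>\<^sup>+z. ennreal (norm (P z) powr p) \<partial>PiM {1..n} (\<lambda>_. nsum_law m)) =
      ennreal (savg ({1..m} \<times> {1..n}) (\<lambda>e. norm (P (\<lambda>k. of_real (nsum m (\<lambda>j. e (j, k))))) powr p))"
    using assms(1)
    by (intro nn_integral_PiM_nsum_law continuous_on_norm_powr continuous_on_P continuous_on_product_coordinates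
        local_onI arg_cong[where f = "\<lambda>y. norm y powr p"] P_local) auto
  also have "(\<lambda>e. norm (P (\<lambda>k. of_real (nsum m (\<lambda>j. e (j, k))))) powr p) =
      (\<lambda>e. ((1 / sqrt (real m)) ^ m) powr p * norm (P (\<lambda>k. \<Sum>j\<in>{1..m}. of_real (e (j, k)))) powr p)"
  proof
    fix e :: "nat \<times> nat \<Rightarrow> real"
    have "(\<lambda>k. complex_of_real (nsum m (\<lambda>j. e (j, k)))) = (\<lambda>k. (\<Sum>j\<in>{1..m}. of_real (e (j, k))) * of_real (1 / sqrt (real m)))"
      by (simp add: nsum_def divide_inverse)
    then have "P (\<lambda>k. of_real (nsum m (\<lambda>j. e (j, k)))) = sc (of_real (1 / sqrt (real m)) ^ m) (P (\<lambda>k. \<Sum>j\<in>{1..m}. of_real (e (j, k))))"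
      by (simp only: P_homogeneous)
    then show "norm (P (\<lambda>k. of_real (nsum m (\<lambda>j. e (j, k))))) powr p =
      ((1 / sqrt (real m)) ^ m) powr p * norm (P (\<lambda>k. \<Sum>j\<in>{1..m}. of_real (e (j, k)))) powr p"
      by (simp only: norm_sc norm_power norm_of_real powr_mult) simp
  qed
  also have "savg ({1..m} \<times> {1..n}) \<dots> = ((1 / sqrt (real m)) ^ m) powr p * SS p"
    unfolding SS_def by (rule savg_cmult)
  finally show ?thesis .
qed

end

text \<open>The left side is one term of the exponential series at m, and e < 3.\<close>

lemma power_over_fact_le: "real m ^ m / fact m \<le> 3 ^ m"
proof -
  have "(\<Sum>i\<in>{m}. real m ^ i /\<^sub>R fact i) \<le> (\<Sum>i. real m ^ i /\<^sub>R fact i)"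
    by (rule sum_le_suminf[OF summable_exp_generic]) auto
  also have "\<dots> = exp (real m)" by (simp add: exp_def)
  also have "\<dots> = exp 1 ^ m" by (simp add: exp_of_nat_mult[symmetric])
  also have "\<dots> \<le> 3 ^ m" using e_less_272 by (intro power_mono) auto
  finally show ?thesis by (simp add: divide_inverse mult.commute)
qed

text \<open>\<open>A\<close>, \<open>B\<close> and \<open>D\<close> stand for the sign moments
  \<open>SP p\<close>, \<open>SL p\<close> and \<open>SS p\<close>; \<open>d1\<close> and
  \<open>d2\<close> bound from below the means belonging to the given law and to the normalized
  sums. What remains is bookkeeping of m-th powers.\<close>

lemma comparison_real_inequalities:
  fixes A B D :: real
  assumes "1 \<le> p" "m > 0" "1 \<le> K" "0 < d1" "0 < d2" "d2 \<le> 1" "0 \<le> A" "0 \<le> B" "0 \<le> D"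
    and i5: "(d2 ^ m) powr p * A \<le> ((1 / sqrt (real m)) ^ m) powr p * D"
    and i5': "((1 / sqrt (real m)) ^ m) powr p * D \<le> (real m ^ m / fact m) powr p * K ^ m * A"
    and i6: "B \<le> (1 / fact m) powr p * D" and i6': "D \<le> (real m ^ m) powr p * B"
  defines "w \<equiv> sqrt (real m) ^ m" and "C \<equiv> 9 * K\<^sup>2 / (d1 * d2)"
  shows "(real m ^ m / fact m) powr p * K ^ m * A \<le> (C ^ m) powr p * w powr p * ((d1 ^ m) powr p * B)"
    and "w powr p * (K ^ m * B) \<le> (C ^ m) powr p * ((d1 ^ m) powr p * A)"
proof -
  define X where "X a = (a ^ m) powr p" for a :: real
  have X_mult: "X (a * b) = X a * X b" for a b
    by (simp add: X_def power_mult_distrib powr_mult)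
  have X_mono: "X a \<le> X b" if "0 \<le> a" "a \<le> b" for a b
    unfolding X_def using that assms(1) by (intro powr_mono2 power_mono) auto
  have X0: "0 \<le> X a" for a by (simp add: X_def)
  have w: "w > 0" using assms(2) by (simp add: w_def)
  have inv: "((1 / sqrt (real m)) ^ m) powr p = 1 / w powr p"
    by (simp add: w_def power_divide powr_divide)
  \<comment> \<open>As m^m = w^2, one factor w undoes the normalization of the sums and the other is
    the factor m^(m/2) of the comparison.\<close>
  have q: "(real m ^ m) powr p = w powr p * w powr p"
    by (simp add: w_def flip: powr_mult power_mult_distrib)
  have KX: "K ^ m \<le> X K"
  proof -
    have "K ^ m = (K ^ m) powr 1" using assms by simp
    also have "\<dots> \<le> X K" unfolding X_def using assms by (intro powr_mono) auto
    finally show ?thesis .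
  qed
  define F where "F = (real m ^ m / fact m) powr p"
  have F: "F \<le> X 3" "0 \<le> F" unfolding F_def X_def using assms(1) power_over_fact_le[of m]
    by (auto intro!: powr_mono2)
  have FD: "F = w powr p * w powr p * (1 / fact m) powr p"
    by (simp add: F_def q[symmetric] powr_divide)
  have K0: "0 \<le> K ^ m" using assms by simp
  \<comment> \<open>The lower bound for the normalized sums controls \<open>X d2 * A\<close>, so
    \<open>X d2\<close> is carried along and cancelled at the end.\<close>
  have "X d2 * (F * K ^ m * A) \<le> X 3 * X K * (X d2 * A)"
  proof -
    have "F * K ^ m \<le> X 3 * X K" using F KX K0 by (intro mult_mono X0) auto
    from mult_right_mono[OF this, of "X d2 * A"] show ?thesis
      using X0 assms(7) by (simp add: mult_ac)
  qed
  also have "\<dots> \<le> X 3 * X K * (w powr p * B)"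
  proof (intro mult_left_mono mult_nonneg_nonneg X0)
    have "X d2 * A \<le> D / w powr p" using i5 unfolding inv X_def by simp
    also have "\<dots> \<le> w powr p * B" using i6' w unfolding q by (simp add: pos_divide_le_eq mult_ac)
    finally show "X d2 * A \<le> w powr p * B" .
  qed
  also have "\<dots> = X (3 * K) * (w powr p * B)" by (simp only: X_mult)
  also have "\<dots> \<le> X (C * d1 * d2) * (w powr p * B)"
  proof (intro mult_right_mono X_mono)
    have "C * d1 * d2 = 9 * K\<^sup>2" using assms by (simp add: C_def)
    moreover have "3 * K \<le> 9 * K\<^sup>2"
    proof -
      have "K * 1 \<le> K * K" using assms(3) by (intro mult_left_mono) auto
      then show ?thesis using assms(3) by (simp add: power2_eq_square)
    qed
    ultimately show "3 * K \<le> C * d1 * d2" by simp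
  qed (use assms in auto)
  also have "\<dots> = X d2 * (X C * w powr p * (X d1 * B))" by (simp add: X_mult mult_ac)
  finally have "F * K ^ m * A \<le> X C * w powr p * (X d1 * B)"
    using assms(5) by (simp add: X_def)
  then show "(real m ^ m / fact m) powr p * K ^ m * A \<le> (C ^ m) powr p * w powr p * ((d1 ^ m) powr p * B)"
    by (simp add: F_def X_def)
  \<comment> \<open>Here \<open>K\<close> and m^m / m! both enter twice: \<open>K\<close> through
    the left side and through \<open>i5'\<close>, m^m / m! through \<open>i5'\<close> and by joining
    w^2 to the 1/m! of polarization. This is the origin of 9 K^2 in \<open>C\<close>.\<close>
  have "w powr p * (K ^ m * B) \<le> w powr p * (K ^ m * ((1 / fact m) powr p * D))"
    using K0 i6 by (intro mult_left_mono) auto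
  also have "\<dots> = (w powr p * (1 / fact m) powr p * K ^ m) * D" by (simp add: mult_ac)
  also have "\<dots> \<le> (w powr p * (1 / fact m) powr p * K ^ m) * (w powr p * (F * K ^ m * A))"
  proof (rule mult_left_mono)
    show "D \<le> w powr p * (F * K ^ m * A)"
      using i5' w unfolding inv F_def[symmetric] by (simp add: pos_divide_le_eq mult_ac)
  qed (use K0 in auto)
  also have "\<dots> = (F * F) * (K ^ m * K ^ m) * A" by (simp add: FD mult_ac)
  also have "\<dots> \<le> (X 3 * X 3) * (X K * X K) * A"
    using F KX K0 X0 assms(7) by (intro mult_right_mono mult_mono) auto
  also have "\<dots> = X (9 * K\<^sup>2) * A" by (simp add: X_mult[symmetric] power2_eq_square)
  also have "\<dots> \<le> X (C * d1) * A"
  proof (intro mult_right_mono X_mono)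
    have "C * d1 = 9 * K\<^sup>2 / d2" using assms by (simp add: C_def)
    moreover have "9 * K\<^sup>2 * d2 \<le> 9 * K\<^sup>2 * 1" using assms(5,6) by (intro mult_left_mono) auto
    ultimately show "9 * K\<^sup>2 \<le> C * d1" using assms(5) by (simp add: pos_le_divide_eq)
  qed (use assms in auto)
  also have "\<dots> = X C * (X d1 * A)" by (simp add: X_mult mult_ac)
  finally show "w powr p * (K ^ m * B) \<le> (C ^ m) powr p * ((d1 ^ m) powr p * A)"
    by (simp add: X_def)
qed

lemma (in sym_poly) moment_comparison:
  assumes "m > 0" "1 \<le> p" "1 \<le> K" "symmetric_law \<mu>" "integrable \<mu> (\<lambda>z. z)"
    and h: "h \<in> borel_measurable borel" "\<And>z. h z = 1 \<or> h z = (-1::real)"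
    and d: "0 < d" "d \<le> 1" "d \<le> cmod (\<integral>z. h z *\<^sub>R z \<partial>\<mu>)"
    and bound: "lform_moment_bound \<mu> p K TYPE(nat)" "lform_moment_bound \<mu> p K TYPE(nat \<times> nat)"
      "lform_moment_bound (nsum_law m) p K TYPE(nat)"
  defines "C \<equiv> 9 * K\<^sup>2 / (d * (1 / 12))"
    and "EP \<equiv> \<integral>\<^sup>+z. ennreal (norm (P z) powr p) \<partial>PiM {1..n} (\<lambda>_. \<mu>)"
    and "EM \<equiv> \<integral>\<^sup>+w. ennreal (norm (L (\<lambda>j k. w (j, k))) powr p) \<partial>PiM ({1..m} \<times> {1..n}) (\<lambda>_. \<mu>)"
  shows "EP \<le> ennreal (C powr (real m * p)) * (ennreal ((sqrt (real m) ^ m) powr p) * EM)"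
    and "ennreal ((sqrt (real m) ^ m) powr p) * EM \<le> ennreal (C powr (real m * p)) * EP"
proof -
  note bp = symmetric_law_borel_prob[OF assms(4)]
  have A: "0 \<le> SP p" and B: "0 \<le> SL p" and D: "0 \<le> SS p"
    unfolding SP_def SL_def SS_def by (auto intro!: savg_nonneg)
  have K: "0 \<le> K" using assms(3) by simp
  have C0: "0 < C" unfolding C_def using assms(3) d(1) by (simp add: zero_less_divide_iff)
  have CX: "C powr (real m * p) = (C ^ m) powr p"
    using C0 by (simp add: powr_powr[symmetric] powr_realpow)
  let ?w = "sqrt (real m) ^ m" and ?F = "(real m ^ m / fact m) powr p"
  have mono: "(a ^ m) powr p * y \<le> (b ^ m) powr p * y" if "0 \<le> a" "a \<le> b" "0 \<le> y" for a b y :: real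
    using that assms(2) by (intro mult_right_mono powr_mono2 power_mono) auto
  have 1: "EP \<le> ennreal (?F * K ^ m * SP p)"
    unfolding EP_def by (rule P_upper[OF bound(1) bp K assms(2,1)])
  have 2: "ennreal ((d ^ m) powr p * SP p) \<le> EP"
    unfolding EP_def
    by (rule order_trans[OF ennreal_leI[OF mono] P_lower[OF assms(4,5) h assms(2)]]) (use d A in auto)
  have 3: "EM \<le> ennreal (K ^ m * SL p)"
    unfolding EM_def by (rule L_upper[OF bound(2) bp K assms(2)])
  have 4: "ennreal ((d ^ m) powr p * SL p) \<le> EM"
    unfolding EM_def
    by (rule order_trans[OF ennreal_leI[OF mono] L_lower[OF assms(4,5) h assms(2)]]) (use d B in auto)
  \<comment> \<open>The moment of P at the normalized sums. Bounding it from both sides by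
    \<open>SP p\<close> connects \<open>SS p\<close> with \<open>SP p\<close>, with constants that
    do not depend on m beyond an m-th power.\<close>
  let ?N = "((1 / sqrt (real m)) ^ m) powr p * SS p"
  have "ennreal (((1 / 12) ^ m) powr p * SP p) \<le> ennreal ?N"
    unfolding nsum_law_moment[OF assms(2,1), symmetric]
  proof (rule order_trans[OF ennreal_leI[OF mono] P_lower[OF symmetric_law_nsum_law integrable_nsum_law sgn_re_measurable _ assms(2)]])
    show "1 / 12 \<le> cmod (\<integral>z. sgn_re z *\<^sub>R z \<partial>nsum_law m)" by (rule cmod_mean_nsum_law[OF assms(1)])
  qed (use A in \<open>auto simp: sgn_re_def\<close>)
  then have N5: "((1 / 12) ^ m) powr p * SP p \<le> ?N" using D by (simp add: ennreal_le_iff)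
  have "ennreal ?N \<le> ennreal (?F * K ^ m * SP p)"
    unfolding nsum_law_moment[OF assms(2,1), symmetric]
    by (rule P_upper[OF bound(3) borel_prob_nsum_law K assms(2,1)])
  then have N6: "?N \<le> ?F * K ^ m * SP p" using A K by (simp add: ennreal_le_iff)
  have d2: "0 < (1 / 12 :: real)" "(1 / 12 :: real) \<le> 1" by simp_all
  note ineqs = comparison_real_inequalities[OF assms(2,1,3) d(1) d2 A B D N5 N6 SL_le_SS[OF assms(2)] SS_le_SL[OF assms(2,1)],
      folded C_def]
  have "EP \<le> ennreal ((C ^ m) powr p * ?w powr p * ((d ^ m) powr p * SL p))"
    by (rule order_trans[OF 1 ennreal_leI[OF ineqs(1)]])
  also have "\<dots> = ennreal ((C ^ m) powr p) * (ennreal (?w powr p) * ennreal ((d ^ m) powr p * SL p))"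
    using B by (simp add: mult.assoc flip: ennreal_mult)
  also have "\<dots> \<le> ennreal ((C ^ m) powr p) * (ennreal (?w powr p) * EM)"
    by (intro mult_left_mono 4) auto
  finally show "EP \<le> ennreal (C powr (real m * p)) * (ennreal (?w powr p) * EM)" unfolding CX .
  have "ennreal (?w powr p) * EM \<le> ennreal (?w powr p) * ennreal (K ^ m * SL p)"
    by (intro mult_left_mono 3) auto
  also have "\<dots> = ennreal (?w powr p * (K ^ m * SL p))" using B K by (simp add: ennreal_mult)
  also have "\<dots> \<le> ennreal ((C ^ m) powr p * ((d ^ m) powr p * SP p))" by (rule ennreal_leI[OF ineqs(2)])
  also have "\<dots> = ennreal ((C ^ m) powr p) * ennreal ((d ^ m) powr p * SP p)" using A by (simp add: ennreal_mult)
  also have "\<dots> \<le> ennreal ((C ^ m) powr p) * EP" by (intro mult_left_mono 2) auto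
  finally show "ennreal (?w powr p) * EM \<le> ennreal (C powr (real m * p)) * EP" unfolding CX .
qed

text \<open>Without rows, P and L are one and the same constant. This degree is treated apart
  because there are no colours to average over and no normalization by sqrt m.\<close>

lemma (in sym_poly) moments_degree_0:
  assumes "m = 0" "prob_space \<mu>"
  shows "(\<integral>\<^sup>+z. ennreal (norm (P z) powr p) \<partial>PiM {1..n} (\<lambda>_. \<mu>)) =
    (\<integral>\<^sup>+w. ennreal (norm (L (\<lambda>j k. w (j, k))) powr p) \<partial>PiM ({1..m} \<times> {1..n}) (\<lambda>_. \<mu>))"
proof -
  define y where "y = L undefined"
  have "P z = y" for z unfolding diag[symmetric] y_def by (rule L_cong) (simp add: assms)
  moreover have "L u = y" for u unfolding y_def by (rule L_cong) (simp add: assms)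
  moreover have "emeasure (PiM {1..n} (\<lambda>_. \<mu>)) (space (PiM {1..n} (\<lambda>_. \<mu>))) = 1"
    by (intro prob_space.emeasure_space_1 prob_space_PiM assms(2))
  moreover have "emeasure (PiM ({1..m} \<times> {1..n}) (\<lambda>_. \<mu>)) (space (PiM ({1..m} \<times> {1..n}) (\<lambda>_. \<mu>))) = 1"
    by (intro prob_space.emeasure_space_1 prob_space_PiM assms(2))
  ultimately show ?thesis by (simp only: nn_integral_const)
qed

lemma (in complex_normed) lform_moment_bound_mono:
  fixes T :: "'i itself"
  assumes "lform_moment_bound \<nu> p K T" "K \<le> K'"
  shows "lform_moment_bound \<nu> p K' T"
  unfolding lform_moment_bound_def
proof (intro allI impI)
  fix B :: "'i set" and Y :: "'i \<Rightarrow> 'x" assume "finite B"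
  then have "(\<integral>\<^sup>+z. ennreal (norm (\<Sum>k\<in>B. sc (z k) (Y k)) powr p) \<partial>PiM B (\<lambda>_. \<nu>))
      \<le> ennreal (K * savg B (\<lambda>e. norm (\<Sum>k\<in>B. e k *\<^sub>R Y k) powr p))"
    using assms(1) by (simp add: lform_moment_bound_def)
  also have "\<dots> \<le> ennreal (K' * savg B (\<lambda>e. norm (\<Sum>k\<in>B. e k *\<^sub>R Y k) powr p))"
    by (intro ennreal_leI mult_right_mono assms(2) savg_nonneg) simp
  finally show "(\<integral>\<^sup>+z. ennreal (norm (\<Sum>k\<in>B. sc (z k) (Y k)) powr p) \<partial>PiM B (\<lambda>_. \<nu>))
      \<le> ennreal (K' * savg B (\<lambda>e. norm (\<Sum>k\<in>B. e k *\<^sub>R Y k) powr p))" .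
qed

lemma symmetric_law_distr:
  assumes "prob_space M" "\<xi> \<in> borel_measurable M" "distr M borel \<xi> = distr M borel (\<lambda>\<omega>. - \<xi> \<omega>)"
  shows "symmetric_law (distr M borel \<xi>)"
proof -
  have "distr (distr M borel \<xi>) borel uminus = distr M borel (\<lambda>\<omega>. - \<xi> \<omega>)"
       "distr (distr M borel \<xi>) borel (\<lambda>z. z) = distr M borel \<xi>"
    using assms(2) by (simp_all add: distr_distr comp_def)
  then show ?thesis
    using assms by (simp add: symmetric_law_def borel_prob_def prob_space.prob_space_distr)
qed

lemma integrable_of_moment:
  assumes "prob_space \<mu>" "sets \<mu> = sets borel" "(\<integral>\<^sup>+z. ennreal (cmod z powr s) \<partial>\<mu>) < \<infinity>" "1 \<le> s"
  shows "integrable \<mu> (\<lambda>z. z)"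
proof (rule integrableI_bounded)
  interpret prob_space \<mu> by fact
  note [measurable_cong] = assms(2)
  show "(\<lambda>z. z) \<in> borel_measurable \<mu>" by measurable
  have "cmod z \<le> 1 + cmod z powr s" for z
  proof (cases "cmod z \<le> 1")
    case True then show ?thesis by (smt (verit) powr_ge_zero)
  next
    case False
    then have "cmod z powr 1 \<le> cmod z powr s" using assms(4) by (intro powr_mono) auto
    then show ?thesis using False by simp
  qed
  then have "(\<integral>\<^sup>+z. ennreal (norm z) \<partial>\<mu>) \<le> (\<integral>\<^sup>+z. 1 + ennreal (cmod z powr s) \<partial>\<mu>)"
    by (intro nn_integral_mono) (simp add: ennreal_leI flip: ennreal_1 ennreal_plus)
  also have "\<dots> = 1 + (\<integral>\<^sup>+z. ennreal (cmod z powr s) \<partial>\<mu>)"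
    by (subst nn_integral_add) (auto simp: emeasure_space_1)
  also have "\<dots> < \<infinity>" using assms(3) by simp
  finally show "(\<integral>\<^sup>+z. ennreal (norm z) \<partial>\<mu>) < \<infinity>" .
qed

lemma nsum_law_moment_bound:
  assumes "2 \<le> s" "m > 0"
  shows "(\<integral>\<^sup>+z. ennreal (cmod z powr s) \<partial>nsum_law m) \<le> ennreal ((2 * (2 * 3 powr s) powr ((s - 2) / s)) powr (s / 2))"
proof -
  have "(\<integral>\<^sup>+z. ennreal (cmod z powr s) \<partial>nsum_law m) = ennreal (savg {1..m} (\<lambda>e. cmod (of_real (nsum m e)) powr s))"
    by (rule nn_integral_nsum_law) auto
  also have "\<dots> = ennreal (savg {1..m} (\<lambda>e. \<bar>nsum m e\<bar> powr s))" by simp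
  also have "\<dots> \<le> ennreal ((2 * (2 * 3 powr s) powr ((s - 2) / s)) powr (s / 2))"
    by (rule ennreal_leI[OF nsum_moment_le[OF assms]])
  finally show ?thesis .
qed

theorem theorem2p1:
  fixes sc :: "complex \<Rightarrow> 'x::banach \<Rightarrow> 'x"
    and M :: "'a measure" and \<xi>0 :: "'a \<Rightarrow> complex"
    and s p :: real
  assumes "complex_structure sc"
    and "\<exists>q. has_cotype TYPE('x) q"
    and "prob_space M"
    and "\<xi>0 \<in> borel_measurable M"
    and "distr M borel \<xi>0 = distr M borel (\<lambda>\<omega>. - \<xi>0 \<omega>)"
    and "\<not> (AE \<omega> in M. \<xi>0 \<omega> = 0)"
    and "s > cotype_index TYPE('x)"
    and "(\<integral>\<^sup>+ \<omega>. ennreal (cmod (\<xi>0 \<omega>) powr s) \<partial>M) < \<infinity>"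
    and "1 \<le> p" and "p < s"
  shows "\<exists>C\<ge>1. \<forall>(m::nat) (n::nat) (x :: nat set \<Rightarrow> 'x) L.
           sym_multilinear sc m L \<and> (\<forall>z. L (\<lambda>_. z) = tetra_poly sc n m x z) \<longrightarrow>
           (let \<mu> = distr M borel \<xi>0;
                EP = (\<integral>\<^sup>+ z. ennreal (norm (tetra_poly sc n m x z) powr p) \<partial>(PiM {1..n} (\<lambda>_. \<mu>)));
                EM = (\<integral>\<^sup>+ w. ennreal (norm (L (\<lambda>j k. w (j, k))) powr p)
                        \<partial>(PiM ({1..m} \<times> {1..n}) (\<lambda>_. \<mu>)))
            in ennreal (C powr (- (real m * p))) * EP \<le> ennreal ((sqrt (real m) ^ m) powr p) * EM
             \<and> ennreal ((sqrt (real m) ^ m) powr p) * EM \<le> ennreal (C powr (real m * p)) * EP)"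
proof -
  interpret complex_normed sc by unfold_locales (rule assms(1))
  interpret M: prob_space M by fact
  note [measurable] = assms(4)
  define \<mu> where "\<mu> = distr M borel \<xi>0"
  obtain q where q: "has_cotype TYPE('x) q" "2 \<le> q" "q < s"
    using ex_cotype_less[OF assms(2,7)] by blast
  have s2: "2 \<le> s" "1 \<le> s" using q by auto
  have symm: "symmetric_law \<mu>" unfolding \<mu>_def by (rule symmetric_law_distr[OF assms(3-5)])
  note bp = symmetric_law_borel_prob[OF symm]
  have mom: "(\<integral>\<^sup>+z. ennreal (cmod z powr s) \<partial>\<mu>) < \<infinity>"
    unfolding \<mu>_def using assms(8) by (subst nn_integral_distr) auto
  have int: "integrable \<mu> (\<lambda>z. z)"
    by (rule integrable_of_moment[OF borel_probD[OF bp] mom s2(2)])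
  have nt: "\<not> (AE z in \<mu>. z = 0)"
    unfolding \<mu>_def using assms(6) by (subst AE_distr_iff) auto
  obtain h where h: "h \<in> borel_measurable borel" "\<And>z. h z = 1 \<or> h z = (-1::real)"
    and ne: "(\<integral>z. h z *\<^sub>R z \<partial>\<mu>) \<noteq> 0"
    using ex_nonzero_mean[OF bp int nt] by blast
  define d where "d = min 1 (cmod (\<integral>z. h z *\<^sub>R z \<partial>\<mu>))"
  have d: "0 < d" "d \<le> 1" "d \<le> cmod (\<integral>z. h z *\<^sub>R z \<partial>\<mu>)" using ne by (auto simp: d_def)
  define k1 where "k1 = enn2real (\<integral>\<^sup>+z. ennreal (cmod z powr s) \<partial>\<mu>)"
  define k2 where "k2 = (2 * (2 * 3 powr s) powr ((s - 2) / s)) powr (s / 2)"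
  \<comment> \<open>A common bound for the s-th moments of the given law and of all normalized sums;
    the summand 1 makes it positive.\<close>
  define K0 where "K0 = k1 + k2 + 1"
  have k: "0 \<le> k1" "0 \<le> k2" by (simp_all add: k1_def k2_def)
  then have K0: "K0 > 0" by (simp add: K0_def)
  have "(\<integral>\<^sup>+z. ennreal (cmod z powr s) \<partial>\<mu>) = ennreal k1" using mom by (simp add: k1_def)
  then have mom\<mu>: "(\<integral>\<^sup>+z. ennreal (cmod z powr s) \<partial>\<mu>) \<le> ennreal K0" using k by (simp add: K0_def ennreal_leI)
  have mom_nsum: "(\<integral>\<^sup>+z. ennreal (cmod z powr s) \<partial>nsum_law m) \<le> ennreal K0" if "m > 0" for m
    by (rule order_trans[OF nsum_law_moment_bound[OF s2(1) that] ennreal_leI]) (use k in \<open>simp add: K0_def k2_def\<close>)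
  obtain K1 where K1: "K1 \<ge> 1" "\<And>\<nu>. symmetric_law \<nu> \<Longrightarrow> (\<integral>\<^sup>+z. ennreal (cmod z powr s) \<partial>\<nu>) \<le> ennreal K0 \<Longrightarrow>
      lform_moment_bound \<nu> p K1 TYPE(nat)"
    using lform_moment_bound_ex[where 'i = nat, OF q(1,3) assms(9,10) K0] by blast
  obtain K2 where K2: "K2 \<ge> 1" "\<And>\<nu>. symmetric_law \<nu> \<Longrightarrow> (\<integral>\<^sup>+z. ennreal (cmod z powr s) \<partial>\<nu>) \<le> ennreal K0 \<Longrightarrow>
      lform_moment_bound \<nu> p K2 TYPE(nat \<times> nat)"
    using lform_moment_bound_ex[where 'i = "nat \<times> nat", OF q(1,3) assms(9,10) K0] by blast
  \<comment> \<open>The domination constant was obtained separately for the index types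
    \<open>nat\<close> and \<open>nat \<times> nat\<close>; the maximum serves both.\<close>
  define K where "K = max K1 K2"
  have K: "1 \<le> K" "K1 \<le> K" "K2 \<le> K" using K1(1) by (auto simp: K_def)
  define C' where "C' = 9 * K\<^sup>2 / (d * (1 / 12))"
  define C where "C = max 1 C'"
  show ?thesis
  proof (intro exI[of _ C] conjI allI impI)
    show "1 \<le> C" by (simp add: C_def)
    fix m n :: nat and x :: "nat set \<Rightarrow> 'x" and L
    assume L: "sym_multilinear sc m L \<and> (\<forall>z. L (\<lambda>_. z) = tetra_poly sc n m x z)"
    then interpret sym_poly sc m n x L by unfold_locales auto
    define EP where "EP = (\<integral>\<^sup>+z. ennreal (norm (tetra_poly sc n m x z) powr p) \<partial>PiM {1..n} (\<lambda>_. \<mu>))"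
    define EM where "EM = (\<integral>\<^sup>+w. ennreal (norm (L (\<lambda>j k. w (j, k))) powr p) \<partial>PiM ({1..m} \<times> {1..n}) (\<lambda>_. \<mu>))"
    let ?w = "ennreal ((sqrt (real m) ^ m) powr p)"
    have bounds: "EP \<le> ennreal (C powr (real m * p)) * (?w * EM)" "?w * EM \<le> ennreal (C powr (real m * p)) * EP"
    proof -
      have "EP \<le> ennreal (C powr (real m * p)) * (?w * EM) \<and> ?w * EM \<le> ennreal (C powr (real m * p)) * EP"
      proof (cases "m = 0")
        case True
        have "EP = EM" unfolding EP_def EM_def by (rule moments_degree_0[OF True borel_probD(1)[OF bp]])
        moreover have "C powr 0 = 1" by (simp add: C_def)
        ultimately show ?thesis using True by simp
      next
        case False
        then have m: "m > 0" by simp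
        note cmp = moment_comparison[OF m assms(9) K(1) symm int h d
            lform_moment_bound_mono[OF K1(2)[OF symm mom\<mu>] K(2)] lform_moment_bound_mono[OF K2(2)[OF symm mom\<mu>] K(3)]
            lform_moment_bound_mono[OF K1(2)[OF symmetric_law_nsum_law mom_nsum[OF m]] K(2)],
            folded C'_def EP_def EM_def]
        have "0 \<le> C'" using K(1) d(1) by (simp add: C'_def)
        then have "C' powr (real m * p) \<le> C powr (real m * p)"
          using assms(9) by (intro powr_mono2) (auto simp: C_def)
        then have le: "ennreal (C' powr (real m * p)) \<le> ennreal (C powr (real m * p))" by (rule ennreal_leI)
        show ?thesis
          using order_trans[OF cmp(1) mult_right_mono[OF le]] order_trans[OF cmp(2) mult_right_mono[OF le]] by simp
      qed
      then show "EP \<le> ennreal (C powr (real m * p)) * (?w * EM)" "?w * EM \<le> ennreal (C powr (real m * p)) * EP" by auto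
    qed
    \<comment> \<open>The left inequality of the claim is the upper bound for \<open>EP\<close>
      divided by C^(m p), written as a product with the inverse power to remain within
      \<open>ennreal\<close>.\<close>
    have "ennreal (C powr (- (real m * p))) * EP \<le> ennreal (C powr (- (real m * p))) * (ennreal (C powr (real m * p)) * (?w * EM))"
      by (rule mult_left_mono[OF bounds(1)]) simp
    also have "\<dots> = (ennreal (C powr (- (real m * p))) * ennreal (C powr (real m * p))) * (?w * EM)"
      by (simp only: mult.assoc)
    also have "ennreal (C powr (- (real m * p))) * ennreal (C powr (real m * p)) = 1"
    proof -
      have "C > 0" by (simp add: C_def)
      then have "C powr (- (real m * p)) * C powr (real m * p) = 1" by (simp flip: powr_add)
      then show ?thesis by (simp flip: ennreal_mult)
    qed
    finally have "ennreal (C powr (- (real m * p))) * EP \<le> ?w * EM" by simp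
    with bounds(2) show "let \<mu> = distr M borel \<xi>0;
                EP = (\<integral>\<^sup>+ z. ennreal (norm (tetra_poly sc n m x z) powr p) \<partial>(PiM {1..n} (\<lambda>_. \<mu>)));
                EM = (\<integral>\<^sup>+ w. ennreal (norm (L (\<lambda>j k. w (j, k))) powr p)
                        \<partial>(PiM ({1..m} \<times> {1..n}) (\<lambda>_. \<mu>)))
            in ennreal (C powr (- (real m * p))) * EP \<le> ennreal ((sqrt (real m) ^ m) powr p) * EM
             \<and> ennreal ((sqrt (real m) ^ m) powr p) * EM \<le> ennreal (C powr (real m * p)) * EP"
      unfolding Let_def EP_def EM_def \<mu>_def by blast
  qed
qed

end
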